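(* Let $R$ be a left Artinian ring. Then $\mathrm{soc}^{\ast}({}_R R)$ embeds, as a left $R$-module, into ${}_R(R/\mathrm{rad}\,R)$ if and only if the compact right $R$-module $\widehat{R}_R$ is almost monothetic.
   Context: Rings are unital (not necessarily commutative). $\mathrm{rad}\,R$ is the Jacobson radical of $R$. The finitary left socle $\mathrm{soc}^{\ast}({}_R R)$ is the sum of all minimal left ideals of $R$ that are finite as sets. A module embeds into another if there is an injective module homomorphism. $\widehat{R}=\mathrm{Hom}(R,\mathbb{T})$ is the Pontryagin dual of the discrete additive group of $R$, where $\mathbb{T}=\{z\in\mathbb{C}:|z|=1\}$; it is a compact abelian group (topology of pointwise convergence), and a right $R$-module via $(\chi r)(x)=\chi(rx)$ for $\chi\in\widehat{R}$, $r,x\in R$. A compact right $R$-module is a compact (Hausdorff) abelian group $X$ with a right $R$-module structure such that $x\mapsto xr$ is continuous for every $r\in R$. It is almost monothetic if for every finite set $\mathcal{M}$ of closed submodules of $X_R$, $X=\bigcup\mathcal{M}$ implies $X\in\mathcal{M}$. *)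

theory Defs
  imports "HOL-Analysis.Analysis" "HOL-Algebra.QuotRing" "HOL-Algebra.Module"
begin

section \<open>One-sided modules\<close>

text \<open>
  The library locale \<^verbatim>\<open>module\<close> requires a commutative ring, so only its record type is reused.
  The \<^verbatim>\<open>mult\<close> and \<^verbatim>\<open>one\<close> fields of that record play no role.
\<close>

locale left_module = ring R + M: abelian_group M
  for R :: "('a, 'm) ring_scheme" (structure) and M :: "('a, 'b, 'n) module_scheme" +
  assumes lsmult_closed: "\<lbrakk>r \<in> carrier R; x \<in> carrier M\<rbrakk> \<Longrightarrow> r \<odot>\<^bsub>M\<^esub> x \<in> carrier M"
    and lsmult_l_distr: "\<lbrakk>r \<in> carrier R; s \<in> carrier R; x \<in> carrier M\<rbrakk>
      \<Longrightarrow> (r \<oplus> s) \<odot>\<^bsub>M\<^esub> x = r \<odot>\<^bsub>M\<^esub> x \<oplus>\<^bsub>M\<^esub> s \<odot>\<^bsub>M\<^esub> x"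
    and lsmult_r_distr: "\<lbrakk>r \<in> carrier R; x \<in> carrier M; y \<in> carrier M\<rbrakk>
      \<Longrightarrow> r \<odot>\<^bsub>M\<^esub> (x \<oplus>\<^bsub>M\<^esub> y) = r \<odot>\<^bsub>M\<^esub> x \<oplus>\<^bsub>M\<^esub> r \<odot>\<^bsub>M\<^esub> y"
    and lsmult_assoc: "\<lbrakk>r \<in> carrier R; s \<in> carrier R; x \<in> carrier M\<rbrakk>
      \<Longrightarrow> (r \<otimes> s) \<odot>\<^bsub>M\<^esub> x = r \<odot>\<^bsub>M\<^esub> (s \<odot>\<^bsub>M\<^esub> x)"
    and lsmult_one: "x \<in> carrier M \<Longrightarrow> \<one> \<odot>\<^bsub>M\<^esub> x = x"

text \<open>For a right module, \<^verbatim>\<open>smult X r x\<close> stands for the product $xr$; note the order in \<^verbatim>\<open>rsmult_assoc\<close>.\<close>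

locale right_module = ring R + X: abelian_group X
  for R :: "('a, 'm) ring_scheme" (structure) and X :: "('a, 'b, 'n) module_scheme" +
  assumes rsmult_closed: "\<lbrakk>r \<in> carrier R; x \<in> carrier X\<rbrakk> \<Longrightarrow> r \<odot>\<^bsub>X\<^esub> x \<in> carrier X"
    and rsmult_l_distr: "\<lbrakk>r \<in> carrier R; s \<in> carrier R; x \<in> carrier X\<rbrakk>
      \<Longrightarrow> (r \<oplus> s) \<odot>\<^bsub>X\<^esub> x = r \<odot>\<^bsub>X\<^esub> x \<oplus>\<^bsub>X\<^esub> s \<odot>\<^bsub>X\<^esub> x"
    and rsmult_r_distr: "\<lbrakk>r \<in> carrier R; x \<in> carrier X; y \<in> carrier X\<rbrakk>
      \<Longrightarrow> r \<odot>\<^bsub>X\<^esub> (x \<oplus>\<^bsub>X\<^esub> y) = r \<odot>\<^bsub>X\<^esub> x \<oplus>\<^bsub>X\<^esub> r \<odot>\<^bsub>X\<^esub> y"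
    and rsmult_assoc: "\<lbrakk>r \<in> carrier R; s \<in> carrier R; x \<in> carrier X\<rbrakk>
      \<Longrightarrow> (r \<otimes> s) \<odot>\<^bsub>X\<^esub> x = s \<odot>\<^bsub>X\<^esub> (r \<odot>\<^bsub>X\<^esub> x)"
    and rsmult_one: "x \<in> carrier X \<Longrightarrow> \<one> \<odot>\<^bsub>X\<^esub> x = x"

definition left_module_hom ::
  "('a, 'm) ring_scheme \<Rightarrow> ('a, 'b, 'n) module_scheme \<Rightarrow> ('a, 'c, 'k) module_scheme \<Rightarrow> ('b \<Rightarrow> 'c) set"
  where "left_module_hom R M N =
    {f \<in> carrier M \<rightarrow> carrier N.
      (\<forall>x\<in>carrier M. \<forall>y\<in>carrier M. f (x \<oplus>\<^bsub>M\<^esub> y) = f x \<oplus>\<^bsub>N\<^esub> f y) \<and>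
      (\<forall>r\<in>carrier R. \<forall>x\<in>carrier M. f (r \<odot>\<^bsub>M\<^esub> x) = r \<odot>\<^bsub>N\<^esub> f x)}"

definition left_module_embeds ::
  "('a, 'm) ring_scheme \<Rightarrow> ('a, 'b, 'n) module_scheme \<Rightarrow> ('a, 'c, 'k) module_scheme \<Rightarrow> bool"
  where "left_module_embeds R M N \<longleftrightarrow> (\<exists>f\<in>left_module_hom R M N. inj_on f (carrier M))"

section \<open>Left ideals\<close>

definition left_ideal :: "'a set \<Rightarrow> ('a, 'm) ring_scheme \<Rightarrow> bool"
  where "left_ideal I R \<longleftrightarrow>
    additive_subgroup I R \<and> (\<forall>r\<in>carrier R. \<forall>x\<in>I. r \<otimes>\<^bsub>R\<^esub> x \<in> I)"

definition left_artinian :: "('a, 'm) ring_scheme \<Rightarrow> bool"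
  where "left_artinian R \<longleftrightarrow>
    (\<forall>I :: nat \<Rightarrow> 'a set. (\<forall>n. left_ideal (I n) R \<and> I (Suc n) \<subseteq> I n) \<longrightarrow> (\<exists>m. \<forall>n\<ge>m. I n = I m))"

definition minimal_left_ideal :: "'a set \<Rightarrow> ('a, 'm) ring_scheme \<Rightarrow> bool"
  where "minimal_left_ideal L R \<longleftrightarrow> left_ideal L R \<and> L \<noteq> {\<zero>\<^bsub>R\<^esub>} \<and>
    (\<forall>I. left_ideal I R \<and> I \<subseteq> L \<longrightarrow> I = {\<zero>\<^bsub>R\<^esub>} \<or> I = L)"

definition maximal_left_ideal :: "'a set \<Rightarrow> ('a, 'm) ring_scheme \<Rightarrow> bool"
  where "maximal_left_ideal L R \<longleftrightarrow> left_ideal L R \<and> L \<noteq> carrier R \<and>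
    (\<forall>I. left_ideal I R \<and> L \<subseteq> I \<longrightarrow> I = L \<or> I = carrier R)"

text \<open>The intersection is taken inside \<^verbatim>\<open>carrier R\<close>, so the radical of the zero ring is the zero ring.\<close>

definition jacobson_radical :: "('a, 'm) ring_scheme \<Rightarrow> 'a set"
  where "jacobson_radical R = {x \<in> carrier R. \<forall>L. maximal_left_ideal L R \<longrightarrow> x \<in> L}"

text \<open>Elements of a sum of a family of left ideals are the finite sums of elements of the members.\<close>

definition finitary_left_socle :: "('a, 'm) ring_scheme \<Rightarrow> 'a set"
  where "finitary_left_socle R =
    {finsum R x F | x F. finite F \<and> F \<subseteq> {L. minimal_left_ideal L R \<and> finite L} \<and> (\<forall>L\<in>F. x L \<in> L)}"

definition left_regular_module :: "('a, 'm) ring_scheme \<Rightarrow> ('a, 'a) module"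
  where "left_regular_module R =
    \<lparr>carrier = carrier R, mult = mult R, one = one R, zero = zero R, add = add R, smult = mult R\<rparr>"

definition left_ideal_module :: "('a, 'm) ring_scheme \<Rightarrow> 'a set \<Rightarrow> ('a, 'a) module"
  where "left_ideal_module R I = (left_regular_module R)\<lparr>carrier := I\<rparr>"

text \<open>
  The quotient left module $R/I$ by a left ideal. It is not read off from \<^verbatim>\<open>R Quot I\<close>, whose
  multiplication is only meaningful for two-sided ideals.
\<close>

definition left_quotient_module :: "('a, 'm) ring_scheme \<Rightarrow> 'a set \<Rightarrow> ('a, 'a set) module"
  where "left_quotient_module R I =
    \<lparr>carrier = a_rcosets\<^bsub>R\<^esub> I, mult = undefined, one = undefined, zero = I, add = set_add R,
     smult = (\<lambda>r A. \<Union>a\<in>A. I +>\<^bsub>R\<^esub> (r \<otimes>\<^bsub>R\<^esub> a))\<rparr>"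

section \<open>Compact right modules and the Pontryagin dual\<close>

locale compact_right_module = right_module R X
  for R :: "('a, 'm) ring_scheme" (structure) and X :: "('a, 'b, 'n) module_scheme" +
  fixes T :: "'b topology"
  assumes topspace_eq: "topspace T = carrier X"
    and compact: "compact_space T"
    and Hausdorff: "Hausdorff_space T"
    and continuous_add: "continuous_map (prod_topology T T) T (\<lambda>(x, y). x \<oplus>\<^bsub>X\<^esub> y)"
    and continuous_minus: "continuous_map T T (\<lambda>x. \<ominus>\<^bsub>X\<^esub> x)"
    and continuous_smult: "r \<in> carrier R \<Longrightarrow> continuous_map T T (\<lambda>x. r \<odot>\<^bsub>X\<^esub> x)"

definition closed_submodule ::
  "('a, 'm) ring_scheme \<Rightarrow> ('a, 'b, 'n) module_scheme \<Rightarrow> 'b topology \<Rightarrow> 'b set \<Rightarrow> bool"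
  where "closed_submodule R X T N \<longleftrightarrow>
    additive_subgroup N X \<and> (\<forall>r\<in>carrier R. \<forall>x\<in>N. r \<odot>\<^bsub>X\<^esub> x \<in> N) \<and> closedin T N"

definition almost_monothetic ::
  "('a, 'm) ring_scheme \<Rightarrow> ('a, 'b, 'n) module_scheme \<Rightarrow> 'b topology \<Rightarrow> bool"
  where "almost_monothetic R X T \<longleftrightarrow>
    (\<forall>\<M>. finite \<M> \<and> (\<forall>N\<in>\<M>. closed_submodule R X T N) \<and> carrier X = \<Union>\<M> \<longrightarrow> carrier X \<in> \<M>)"

definition circle_group :: "complex monoid"
  where "circle_group = \<lparr>carrier = sphere 0 1, mult = (*), one = 1\<rparr>"

text \<open>
  Characters are made extensional, so that each is represented by exactly one function. The group
  of characters is written additively, as required by the record of modules: its addition is the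
  pointwise product, its zero the trivial character.
\<close>

definition dual_module :: "('a, 'm) ring_scheme \<Rightarrow> ('a, 'a \<Rightarrow> complex) module"
  where "dual_module R =
    \<lparr>carrier = hom (add_monoid R) circle_group \<inter> extensional (carrier R),
     mult = undefined, one = undefined,
     zero = (\<lambda>x\<in>carrier R. 1), add = (\<lambda>f g. \<lambda>x\<in>carrier R. f x * g x),
     smult = (\<lambda>r f. \<lambda>x\<in>carrier R. f (r \<otimes>\<^bsub>R\<^esub> x))\<rparr>"

definition dual_topology :: "('a, 'm) ring_scheme \<Rightarrow> ('a \<Rightarrow> complex) topology"
  where "dual_topology R =
    subtopology (product_topology (\<lambda>_. top_of_set (sphere 0 1)) (carrier R)) (carrier (dual_module R))"

section \<open>Well-definedness\<close>

lemma (in ring) left_idealI: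
  assumes "I \<subseteq> carrier R" "\<zero> \<in> I" "\<And>x y. \<lbrakk>x \<in> I; y \<in> I\<rbrakk> \<Longrightarrow> x \<oplus> y \<in> I"
    "\<And>r x. \<lbrakk>r \<in> carrier R; x \<in> I\<rbrakk> \<Longrightarrow> r \<otimes> x \<in> I"
  shows "left_ideal I R"
proof -
  have "\<ominus> x \<in> I" if "x \<in> I" for x
  proof -
    have "\<ominus> x = (\<ominus> \<one>) \<otimes> x" using that assms(1) by (simp add: l_minus subset_iff)
    then show ?thesis using assms(4)[OF _ that, of "\<ominus> \<one>"] by simp
  qed
  then have "additive_subgroup I R"
    using assms by (intro additive_subgroup.intro add.subgroupI) (auto simp: a_inv_def)
  then show ?thesis using assms(4) by (auto simp: left_ideal_def)
qed

lemma (in ring) left_idealD: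
  assumes "left_ideal I R"
  shows "I \<subseteq> carrier R" "\<zero> \<in> I" "\<And>x y. \<lbrakk>x \<in> I; y \<in> I\<rbrakk> \<Longrightarrow> x \<oplus> y \<in> I"
    "\<And>r x. \<lbrakk>r \<in> carrier R; x \<in> I\<rbrakk> \<Longrightarrow> r \<otimes> x \<in> I" "\<And>x. x \<in> I \<Longrightarrow> \<ominus> x \<in> I"
proof -
  interpret additive_subgroup I R using assms by (simp add: left_ideal_def)
  show "I \<subseteq> carrier R" "\<zero> \<in> I" "\<And>x y. \<lbrakk>x \<in> I; y \<in> I\<rbrakk> \<Longrightarrow> x \<oplus> y \<in> I"
    "\<And>r x. \<lbrakk>r \<in> carrier R; x \<in> I\<rbrakk> \<Longrightarrow> r \<otimes> x \<in> I"
    using assms a_subset by (auto simp: left_ideal_def)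
  show "\<And>x. x \<in> I \<Longrightarrow> \<ominus> x \<in> I"
    using a_subgroup subgroup.m_inv_closed[of I "add_monoid R"] by (simp add: a_inv_def)
qed

lemma (in ring) left_ideal_jacobson_radical: "left_ideal (jacobson_radical R) R"
  by (rule left_idealI) (auto simp: jacobson_radical_def maximal_left_ideal_def dest: left_idealD)

lemma (in ring) left_ideal_finitary_left_socle: "left_ideal (finitary_left_socle R) R"
proof (rule left_idealI)
  let ?S = "{L. minimal_left_ideal L R \<and> finite L}"
  have id: "left_ideal L R" if "L \<in> ?S" for L using that by (simp add: minimal_left_ideal_def)
  have PiI: "x \<in> F \<rightarrow> carrier R" if "F \<subseteq> ?S" "\<forall>L\<in>F. x L \<in> L" for x F
    using that left_idealD(1)[OF id] by blast
  show "finitary_left_socle R \<subseteq> carrier R"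
    using PiI by (fastforce simp: finitary_left_socle_def intro: finsum_closed)
  show "\<zero> \<in> finitary_left_socle R"
    unfolding finitary_left_socle_def by (rule CollectI) (auto intro!: exI[of _ "{}"])
  fix u v assume "u \<in> finitary_left_socle R" "v \<in> finitary_left_socle R"
  then obtain x F y G where u: "u = finsum R x F" "finite F" "F \<subseteq> ?S" "\<forall>L\<in>F. x L \<in> L"
    and v: "v = finsum R y G" "finite G" "G \<subseteq> ?S" "\<forall>L\<in>G. y L \<in> L"
    unfolding finitary_left_socle_def by blast
  define x' where "x' = (\<lambda>L. if L \<in> F then x L else \<zero>)"
  define y' where "y' = (\<lambda>L. if L \<in> G then y L else \<zero>)"
  have m: "\<forall>L\<in>F \<union> G. x' L \<in> L" "\<forall>L\<in>F \<union> G. y' L \<in> L"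
    using u v left_idealD(2)[OF id] by (auto simp: x'_def y'_def)
  have FG: "F \<union> G \<subseteq> ?S" "finite (F \<union> G)" using u v by auto
  have "u = finsum R x' F" unfolding u(1)
    using u PiI[OF u(3,4)] by (intro add.finprod_cong') (auto simp: x'_def)
  also have "\<dots> = finsum R x' (F \<union> G)"
    using FG m PiI[OF FG(1) m(1)] by (intro add.finprod_mono_neutral_cong_left) (auto simp: x'_def)
  finally have 1: "u = finsum R x' (F \<union> G)" .
  have "v = finsum R y' G" unfolding v(1)
    using v PiI[OF v(3,4)] by (intro add.finprod_cong') (auto simp: y'_def)
  also have "\<dots> = finsum R y' (F \<union> G)"
    using FG m PiI[OF FG(1) m(2)] by (intro add.finprod_mono_neutral_cong_left) (auto simp: y'_def)
  finally have 2: "v = finsum R y' (F \<union> G)" .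
  have "u \<oplus> v = finsum R (\<lambda>L. x' L \<oplus> y' L) (F \<union> G)"
    unfolding 1 2 using PiI[OF FG(1)] m by (simp add: finsum_addf)
  moreover have "\<forall>L\<in>F \<union> G. x' L \<oplus> y' L \<in> L"
    using m FG(1) left_idealD(3)[OF id] by blast
  ultimately show "u \<oplus> v \<in> finitary_left_socle R"
    unfolding finitary_left_socle_def using FG
    by (intro CollectI exI[of _ "\<lambda>L. x' L \<oplus> y' L"] exI[of _ "F \<union> G"]) simp
next
  let ?S = "{L. minimal_left_ideal L R \<and> finite L}"
  fix r u assume r: "r \<in> carrier R" and "u \<in> finitary_left_socle R"
  then obtain x F where u: "u = finsum R x F" "finite F" "F \<subseteq> ?S" "\<forall>L\<in>F. x L \<in> L"
    unfolding finitary_left_socle_def by blast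
  have id: "left_ideal L R" if "L \<in> F" for L using that u(3) by (auto simp: minimal_left_ideal_def)
  have "r \<otimes> u = finsum R (\<lambda>L. r \<otimes> x L) F"
    unfolding u(1) using r u left_idealD(1)[OF id] by (intro finsum_rdistr) auto
  moreover have "\<forall>L\<in>F. r \<otimes> x L \<in> L" using r u(4) left_idealD(4)[OF id] by blast
  ultimately show "r \<otimes> u \<in> finitary_left_socle R"
    unfolding finitary_left_socle_def using u(2,3)
    by (intro CollectI exI[of _ "\<lambda>L. r \<otimes> x L"] exI[of _ F]) simp
qed

lemma (in ring) left_module_left_ideal:
  assumes "left_ideal I R"
  shows "left_module R (left_ideal_module R I)"
proof -
  note I = left_idealD[OF assms]
  have "abelian_group (left_ideal_module R I)"
  proof (rule abelian_groupI)
    fix x assume "x \<in> carrier (left_ideal_module R I)"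
    then have "\<ominus> x \<in> I" "\<ominus> x \<oplus> x = \<zero>"
      using I by (auto simp: left_ideal_module_def subset_iff l_neg)
    then show "\<exists>y\<in>carrier (left_ideal_module R I). y \<oplus>\<^bsub>left_ideal_module R I\<^esub> x = \<zero>\<^bsub>left_ideal_module R I\<^esub>"
      by (auto simp: left_ideal_module_def left_regular_module_def)
  qed (use I in \<open>auto simp: left_ideal_module_def left_regular_module_def subset_iff a_ac\<close>)
  then show ?thesis
    using I by (intro left_module.intro ring_axioms left_module_axioms.intro)
      (auto simp: left_ideal_module_def left_regular_module_def subset_iff m_assoc l_distr r_distr)
qed

lemma (in ring) left_module_quotient:
  assumes "left_ideal I R"
  shows "left_module R (left_quotient_module R I)"
proof -
  note I = left_idealD[OF assms]
  interpret abelian_subgroup I R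
    using assms by (intro abelian_subgroupI3 abelian_group_axioms) (simp add: left_ideal_def)
  let ?Q = "left_quotient_module R I"
  have car: "carrier ?Q = {I +> a | a. a \<in> carrier R}"
    by (auto simp: left_quotient_module_def A_RCOSETS_def RCOSETS_def a_r_coset_def)
  have add: "(I +> a) \<oplus>\<^bsub>?Q\<^esub> (I +> b) = I +> (a \<oplus> b)" if "a \<in> carrier R" "b \<in> carrier R" for a b
    using that by (simp add: left_quotient_module_def a_rcos_sum)
  have zero: "\<zero>\<^bsub>?Q\<^esub> = I +> \<zero>" using I(1) by (simp add: left_quotient_module_def)
  have eqI: "I +> b = I +> a" if "b \<in> I +> a" "a \<in> carrier R" for a b
    using a_repr_independence[OF that a_subgroup] by (rule sym)
  have smult: "r \<odot>\<^bsub>?Q\<^esub> (I +> a) = I +> (r \<otimes> a)" if r: "r \<in> carrier R" and a: "a \<in> carrier R" for r a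
  proof -
    have "I +> (r \<otimes> b) = I +> (r \<otimes> a)" if b: "b \<in> I +> a" for b
    proof -
      obtain i where i: "i \<in> I" "b = i \<oplus> a" using b by (auto simp: a_r_coset_def' )
      have "r \<otimes> b = (r \<otimes> i) \<oplus> (r \<otimes> a)" using i I(1) r a by (auto simp: r_distr)
      then have "r \<otimes> b \<in> I +> (r \<otimes> a)" using I(4)[OF r i(1)] by (auto simp: a_r_coset_def')
      then show ?thesis using eqI r a by simp
    qed
    then have "(\<Union>b\<in>I +> a. I +> (r \<otimes> b)) = (\<Union>b\<in>I +> a. I +> (r \<otimes> a))"
      by (intro SUP_cong refl)
    moreover have "I +> a \<noteq> {}" using a_rcos_self[OF a] by blast
    ultimately show ?thesis unfolding left_quotient_module_def by simp
  qed
  have "abelian_group ?Q"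
  proof (rule abelian_groupI)
    fix x assume "x \<in> carrier ?Q"
    then obtain a where a: "a \<in> carrier R" "x = I +> a" by (auto simp: car)
    then have "(I +> (\<ominus> a)) \<oplus>\<^bsub>?Q\<^esub> x = \<zero>\<^bsub>?Q\<^esub>" by (simp add: add zero l_neg)
    then show "\<exists>y\<in>carrier ?Q. y \<oplus>\<^bsub>?Q\<^esub> x = \<zero>\<^bsub>?Q\<^esub>" using a by (auto simp: car)
  next
    show "\<zero>\<^bsub>?Q\<^esub> \<in> carrier ?Q" unfolding car zero by blast
  next
    fix x y assume "x \<in> carrier ?Q" "y \<in> carrier ?Q"
    then show "x \<oplus>\<^bsub>?Q\<^esub> y \<in> carrier ?Q" unfolding car by (force simp: add)
  qed (auto simp: car add zero a_ac)
  moreover have "left_module_axioms R ?Q"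
  proof (rule left_module_axioms.intro)
    fix r x assume "r \<in> carrier R" "x \<in> carrier ?Q"
    then show "r \<odot>\<^bsub>?Q\<^esub> x \<in> carrier ?Q" unfolding car by (force simp: smult)
  qed (auto simp: car add smult l_distr r_distr m_assoc)
  ultimately show ?thesis by (intro left_module.intro ring_axioms)
qed

lemma (in ring) compact_right_module_dual:
  "compact_right_module R (dual_module R) (dual_topology R)"
proof -
  let ?X = "dual_module R" and ?P = "product_topology (\<lambda>_. top_of_set (sphere (0::complex) 1)) (carrier R)"
  have mem: "f \<in> carrier ?X \<longleftrightarrow> f \<in> extensional (carrier R) \<and> (\<forall>x\<in>carrier R. norm (f x) = 1) \<and>
      (\<forall>x\<in>carrier R. \<forall>y\<in>carrier R. f (x \<oplus> y) = f x * f y)" for f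
    by (auto simp: dual_module_def hom_def circle_group_def)
  have inv: "(\<lambda>x\<in>carrier R. inverse (f x)) \<in> carrier ?X"
    "(\<lambda>x\<in>carrier R. inverse (f x)) \<oplus>\<^bsub>?X\<^esub> f = \<zero>\<^bsub>?X\<^esub>" if "f \<in> carrier ?X" for f
  proof -
    have nz: "f x \<noteq> 0" if "x \<in> carrier R" for x using that \<open>f \<in> carrier ?X\<close> by (auto simp: mem)
    show "(\<lambda>x\<in>carrier R. inverse (f x)) \<in> carrier ?X"
      using that by (auto simp: mem norm_inverse)
    show "(\<lambda>x\<in>carrier R. inverse (f x)) \<oplus>\<^bsub>?X\<^esub> f = \<zero>\<^bsub>?X\<^esub>"
      using nz by (auto simp: dual_module_def restrict_def fun_eq_iff)
  qed
  have X: "abelian_group ?X"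
  proof (rule abelian_groupI)
    fix f assume f: "f \<in> carrier ?X"
    show "\<exists>g\<in>carrier ?X. g \<oplus>\<^bsub>?X\<^esub> f = \<zero>\<^bsub>?X\<^esub>" using inv[OF f] by blast
    show "\<zero>\<^bsub>?X\<^esub> \<oplus>\<^bsub>?X\<^esub> f = f"
      using f unfolding mem by (auto simp: dual_module_def restrict_def fun_eq_iff extensional_def)
  qed (unfold mem, auto simp: dual_module_def norm_mult restrict_def fun_eq_iff extensional_def)
  then interpret X: abelian_group ?X .
  have neg: "\<ominus>\<^bsub>?X\<^esub> f = (\<lambda>x\<in>carrier R. inverse (f x))" if "f \<in> carrier ?X" for f
    using X.minus_equality[OF inv(2)[OF that] that inv(1)[OF that]] .
  have sub: "carrier ?X \<subseteq> topspace ?P"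
    by (auto simp: mem PiE_def topspace_product_topology)
  have top: "topspace (dual_topology R) = carrier ?X"
    using sub by (auto simp: dual_topology_def)
  have proj: "continuous_map (dual_topology R) euclidean (\<lambda>f. f x)" if "x \<in> carrier R" for x
  proof -
    have "continuous_map ?P (top_of_set (sphere 0 1)) (\<lambda>f. f x)"
      using that by (rule continuous_map_product_projection)
    then show ?thesis unfolding dual_topology_def
      by (intro continuous_map_from_subtopology) (rule continuous_map_into_fulltopology)
  qed
  have contI: "continuous_map Y (dual_topology R) h"
    if "h \<in> topspace Y \<rightarrow> carrier ?X" "\<And>x. x \<in> carrier R \<Longrightarrow> continuous_map Y euclidean (\<lambda>y. h y x)"
    for h and Y :: "'z topology"
  proof -
    have "continuous_map Y ?P h"
      unfolding continuous_map_componentwise continuous_map_in_subtopology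
      using that by (auto simp: mem Pi_iff)
    then show ?thesis unfolding dual_topology_def continuous_map_in_subtopology using that(1) by auto
  qed
  have cmult: "continuous_map Y euclidean (\<lambda>y. h y * k y)"
    if "continuous_map Y euclidean h" "continuous_map Y euclidean k"
    for h k :: "'z \<Rightarrow> complex" and Y
    using that by (simp add: continuous_map_atin tendsto_mult)
  have PP: "continuous_map ?P euclidean (\<lambda>f. f x)" if "x \<in> carrier R" for x
    using continuous_map_product_projection[OF that, of "\<lambda>_. top_of_set (sphere (0::complex) 1)"]
    by (rule continuous_map_into_fulltopology)
  have cl: "closedin ?P {f \<in> topspace ?P. f (x \<oplus> y) = f x * f y}"
    if "x \<in> carrier R" "y \<in> carrier R" for x y
  proof -
    have "continuous_map ?P euclidean (\<lambda>f. f (x \<oplus> y) - f x * f y)"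
      using that by (intro continuous_map_diff cmult PP) auto
    from closedin_continuous_map_preimage[OF this, of "{0}"] show ?thesis by simp
  qed
  have "carrier ?X = topspace ?P \<inter> (\<Inter>x\<in>carrier R. \<Inter>y\<in>carrier R. {f \<in> topspace ?P. f (x \<oplus> y) = f x * f y})"
    using sub by (auto simp: mem topspace_product_topology PiE_def Pi_iff)
  also have "closedin ?P \<dots>"
    using cl by (intro closedin_Int closedin_topspace closedin_INT) auto
  finally have closed: "closedin ?P (carrier ?X)" .
  show ?thesis
  proof (intro compact_right_module.intro right_module.intro ring_axioms X
      right_module_axioms.intro compact_right_module_axioms.intro)
    show "compact_space (dual_topology R)"
      unfolding dual_topology_def
      by (rule compact_space_subtopology[OF closedin_compact_space[OF _ closed]])
        (simp add: compact_space_product_topology compact_space_subtopology)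
    show "Hausdorff_space (dual_topology R)"
      unfolding dual_topology_def
      by (simp add: Hausdorff_space_product_topology Hausdorff_space_subtopology)
    show "topspace (dual_topology R) = carrier ?X" by (rule top)
    show "continuous_map (dual_topology R) (dual_topology R) (\<lambda>x. \<ominus>\<^bsub>?X\<^esub> x)"
    proof (rule contI)
      fix x assume x: "x \<in> carrier R"
      have "continuous_map (dual_topology R) euclidean (\<lambda>f. inverse (f x))"
        using proj[OF x] top x by (simp add: continuous_map_atin, intro ballI tendsto_inverse) (auto simp: mem)
      then show "continuous_map (dual_topology R) euclidean (\<lambda>f. (\<ominus>\<^bsub>?X\<^esub> f) x)"
        using x by (rule_tac continuous_map_eq) (auto simp: top neg)
    qed (auto simp: top)
    show "continuous_map (prod_topology (dual_topology R) (dual_topology R)) (dual_topology R)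
      (\<lambda>(x, y). x \<oplus>\<^bsub>?X\<^esub> y)"
    proof (rule contI)
      fix x assume x: "x \<in> carrier R"
      have "continuous_map (prod_topology (dual_topology R) (dual_topology R)) euclidean (\<lambda>p. fst p x * snd p x)"
        using continuous_map_compose[OF continuous_map_fst proj[OF x]] continuous_map_compose[OF continuous_map_snd proj[OF x]]
        by (intro cmult) (auto simp: o_def)
      then show "continuous_map (prod_topology (dual_topology R) (dual_topology R)) euclidean
          (\<lambda>p. (case p of (f, g) \<Rightarrow> f \<oplus>\<^bsub>?X\<^esub> g) x)"
        using x by (simp add: dual_module_def case_prod_unfold)
    qed (auto simp: top)
    have sm: "r \<odot>\<^bsub>?X\<^esub> f = (\<lambda>x\<in>carrier R. f (r \<otimes> x))" for r f by (simp add: dual_module_def)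
    have smc: "r \<odot>\<^bsub>?X\<^esub> f \<in> carrier ?X" if "r \<in> carrier R" "f \<in> carrier ?X" for r f
      using that by (auto simp: mem sm r_distr)
    then show "\<And>r f. r \<in> carrier R \<Longrightarrow> f \<in> carrier ?X \<Longrightarrow> r \<odot>\<^bsub>?X\<^esub> f \<in> carrier ?X" .
    show "continuous_map (dual_topology R) (dual_topology R) (\<lambda>f. r \<odot>\<^bsub>?X\<^esub> f)" if r: "r \<in> carrier R" for r
      by (rule contI) (use r smc proj in \<open>auto simp: top sm\<close>)
    have ad: "f \<oplus>\<^bsub>?X\<^esub> g = (\<lambda>x\<in>carrier R. f x * g x)" for f g by (simp add: dual_module_def)
    show "(r \<oplus> s) \<odot>\<^bsub>?X\<^esub> f = r \<odot>\<^bsub>?X\<^esub> f \<oplus>\<^bsub>?X\<^esub> s \<odot>\<^bsub>?X\<^esub> f"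
      if "r \<in> carrier R" "s \<in> carrier R" "f \<in> carrier ?X" for r s f
      using that by (auto simp: sm ad mem l_distr fun_eq_iff)
    show "r \<odot>\<^bsub>?X\<^esub> (f \<oplus>\<^bsub>?X\<^esub> g) = r \<odot>\<^bsub>?X\<^esub> f \<oplus>\<^bsub>?X\<^esub> r \<odot>\<^bsub>?X\<^esub> g"
      if "r \<in> carrier R" for r f g
      using that by (auto simp: sm ad fun_eq_iff)
    show "(r \<otimes> s) \<odot>\<^bsub>?X\<^esub> f = s \<odot>\<^bsub>?X\<^esub> (r \<odot>\<^bsub>?X\<^esub> f)" if "r \<in> carrier R" "s \<in> carrier R" for r s f
      using that by (auto simp: sm fun_eq_iff m_assoc)
    show "\<one> \<odot>\<^bsub>?X\<^esub> f = f" if "f \<in> carrier ?X" for f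
      using that by (auto simp: sm mem fun_eq_iff extensional_def)
  qed
qed

end

theory Submission
  imports Defs "HOL-Algebra.Generated_Groups" "HOL-Algebra.Multiplicative_Group" "HOL-Real_Asymp.Real_Asymp"
begin

text \<open>
  A closed submodule \<open>N\<close> of the dual is proper iff its annihilator in \<open>R\<close> is a nonzero left ideal, so the
  dual is almost monothetic iff any finitely many minimal left ideals admit a character that is nontrivial
  on each of them. Infinite minimal left ideals impose no condition: given a character for the others, a
  torsion one is handled by a character trivial on a finite subgroup of witnesses, a divisible one by a
  large power of a character, since each of the divisible ideals excludes at most one exponent.

  On the other side, left ideals containing the radical have complements modulo the radical, hence the
  finitary socle \<open>S\<close> embeds into the quotient by the radical iff \<open>S\<close> is cyclic.

  Both conditions are compared one simple summand at a time. Let \<open>V \<oplus> L\<close> be a finite left ideal in \<open>S\<close> with \<open>L\<close>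
  minimal. If \<open>v\<close> generates \<open>V\<close>, a pair \<open>(v, t)\<close> generates \<open>V \<oplus> L\<close> iff \<open>t\<close> is not the image of \<open>v\<close> under a homomorphism
  \<open>V \<rightarrow> L\<close>, so \<open>t\<close> exists iff \<open>|Hom(V, L)| < |L|\<close>. Dually, a good character of \<open>V\<close> extends to a good one of \<open>V \<oplus> L\<close>
  iff \<open>|Hom(L, V)| < |L|\<close>, as \<open>L\<close> has \<open>|L|\<close> characters. The two numbers of homomorphisms agree because \<open>V\<close> is semisimple.
\<close>
section \<open>Characters of abelian groups\<close>

text \<open>That a proper closed submodule has a nonzero annihilator is the piece of Pontryagin
  duality used here: with zero annihilator the submodule would separate the points of
  \<open>R\<close>, and a group of characters that separates points is dense. Density is obtained
  from finite means and counting.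

  Comparing cardinalities of Hom sets replaces multiplicities of simple modules, so the structure
  theory of the quotient by the radical stays out; semisimplicity enters only through complements
  modulo the radical. The strict inequalities arise because a homomorphism
  \<open>V \<rightarrow> L\<close> is encoded by an element of \<open>L\<close> (the image of a
  generator), a homomorphism \<open>L \<rightarrow> V\<close> by a character of \<open>L\<close>,
  and in each case one element or character is missed. Both codes have \<open>|L|\<close> targets
  only for finite \<open>L\<close>.

  The finitary socle is not known to be finite, so all counting happens in finite left ideals inside
  it. To get a generator from characters, the candidate is an element with minimal annihilator:
  minimality is what bounds \<open>|Hom(V, L)|\<close> from below.\<close>

definition char_on :: "('a, 'm) monoid_scheme \<Rightarrow> 'a set \<Rightarrow> ('a \<Rightarrow> complex) \<Rightarrow> bool"
  where "char_on G H \<xi> \<longleftrightarrow>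
    (\<forall>x\<in>H. cmod (\<xi> x) = 1) \<and> (\<forall>x\<in>H. \<forall>y\<in>H. \<xi> (x \<otimes>\<^bsub>G\<^esub> y) = \<xi> x * \<xi> y)"

lemma char_on_cong: "(\<And>x. x \<in> H \<Longrightarrow> \<xi> x = \<psi> x) \<Longrightarrow> subgroup H G \<Longrightarrow> char_on G H \<xi> \<longleftrightarrow> char_on G H \<psi>"
  by (auto simp: char_on_def subgroup.m_closed)

lemma char_on_subset: "char_on G H \<xi> \<Longrightarrow> K \<subseteq> H \<Longrightarrow> char_on G K \<xi>"
  by (auto simp: char_on_def)

lemma char_on_nonzero: "char_on G H \<xi> \<Longrightarrow> x \<in> H \<Longrightarrow> \<xi> x \<noteq> 0"
  by (auto simp: char_on_def)

text \<open>In a commutative group this is the subgroup generated by \<open>H\<close> and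
  \<open>x\<close>; the explicit form exposes the integer exponent on which a character is to be
  defined.\<close>

definition adjoin :: "('a, 'm) monoid_scheme \<Rightarrow> 'a set \<Rightarrow> 'a \<Rightarrow> 'a set"
  where "adjoin G H x = {h \<otimes>\<^bsub>G\<^esub> x [^]\<^bsub>G\<^esub> k | h k. h \<in> H \<and> k \<in> (UNIV :: int set)}"

context comm_group
begin

lemma char_on_one:
  assumes "subgroup H G" "char_on G H \<xi>" shows "\<xi> \<one> = 1"
proof -
  have "\<one> \<in> H" using assms subgroup.one_closed by blast
  then have "\<xi> (\<one> \<otimes> \<one>) = \<xi> \<one> * \<xi> \<one>" "\<xi> \<one> \<noteq> 0"
    using assms char_on_nonzero[OF assms(2)] unfolding char_on_def by blast+
  then show ?thesis by simp
qed

lemma char_on_inv: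
  assumes "subgroup H G" "char_on G H \<xi>" "x \<in> H" shows "\<xi> (inv x) = inverse (\<xi> x)"
proof -
  have "inv x \<in> H" "x \<in> carrier G" using assms subgroup.m_inv_closed subgroup.mem_carrier by fast+
  then have "\<xi> (inv x) * \<xi> x = \<xi> \<one>" using assms(2,3) unfolding char_on_def by (metis l_inv)
  then show ?thesis using char_on_one[OF assms(1,2)] by (metis inverse_unique mult.commute)
qed

lemma char_on_nat_pow:
  assumes "subgroup H G" "char_on G H \<xi>" "x \<in> H" shows "\<xi> (x [^] (n::nat)) = \<xi> x ^ n"
proof (induction n)
  case 0 show ?case using char_on_one[OF assms(1,2)] by simp
next
  case (Suc n)
  have "x [^] n \<in> H" using subgroup_int_pow_closed[OF assms(1,3), of "int n"] by (simp add: int_pow_int)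
  then show ?case using Suc assms(2,3) by (simp add: char_on_def)
qed

lemma char_on_int_pow:
  assumes "subgroup H G" "char_on G H \<xi>" "x \<in> H" shows "\<xi> (x [^] (k::int)) = \<xi> x powi k"
proof (cases "k \<ge> 0")
  case True
  then obtain n where "k = int n" using nonneg_int_cases by blast
  then show ?thesis using char_on_nat_pow[OF assms] by (simp add: int_pow_int)
next
  case False
  then obtain n where k: "k = - int n" by (metis linear minus_minus neg_le_0_iff_le nonneg_int_cases)
  have x: "x \<in> carrier G" using assms subgroup.mem_carrier by fast
  have "x [^] int n \<in> H" using subgroup_int_pow_closed assms by blast
  then show ?thesis using char_on_nat_pow[OF assms, of n] x assms
    by (simp add: k int_pow_neg int_pow_int char_on_inv power_int_minus)
qed

lemma subgroup_adjoin:
  assumes "subgroup H G" "x \<in> carrier G"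
  shows "subgroup (adjoin G H x) G" "H \<subseteq> adjoin G H x" "x \<in> adjoin G H x"
proof -
  have H: "\<And>h. h \<in> H \<Longrightarrow> h \<in> carrier G" using assms subgroup.mem_carrier by fast
  show "H \<subseteq> adjoin G H x"
  proof
    fix h assume "h \<in> H"
    then have "h = h \<otimes> x [^] (0::int)" using H by simp
    then show "h \<in> adjoin G H x" unfolding adjoin_def using \<open>h \<in> H\<close> by blast
  qed
  have "\<one> \<in> H" "x = \<one> \<otimes> x [^] (1::int)" using assms subgroup.one_closed by auto
  then show "x \<in> adjoin G H x" unfolding adjoin_def by blast
  show "subgroup (adjoin G H x) G"
  proof (rule subgroupI)
    show "adjoin G H x \<subseteq> carrier G" using H assms by (auto simp: adjoin_def)
    show "adjoin G H x \<noteq> {}" using \<open>\<one> \<in> H\<close> by (auto simp: adjoin_def)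
    fix a assume "a \<in> adjoin G H x"
    then obtain h and k :: int where a: "h \<in> H" "a = h \<otimes> x [^] k" by (auto simp: adjoin_def)
    then have "inv a = inv h \<otimes> x [^] (-k)" using H assms by (simp add: inv_mult int_pow_neg)
    moreover have "inv h \<in> H" using a assms subgroup.m_inv_closed by fast
    ultimately show "inv a \<in> adjoin G H x" unfolding adjoin_def by blast
    fix b assume "b \<in> adjoin G H x"
    then obtain h' and k' :: int where b: "h' \<in> H" "b = h' \<otimes> x [^] k'" by (auto simp: adjoin_def)
    have "a \<otimes> b = (h \<otimes> h') \<otimes> (x [^] k \<otimes> x [^] k')"
      using a b H assms by (simp add: m_ac)
    also have "\<dots> = (h \<otimes> h') \<otimes> x [^] (k + k')" using assms by (simp add: int_pow_mult)
    finally have "a \<otimes> b = (h \<otimes> h') \<otimes> x [^] (k + k')" .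
    moreover have "h \<otimes> h' \<in> H" using a b assms subgroup.m_closed by fast
    ultimately show "a \<otimes> b \<in> adjoin G H x" unfolding adjoin_def by blast
  qed
qed

text \<open>Two ways of writing an element as \<open>h \<otimes> x [^] k\<close> differ by a power
  of \<open>x\<close> that lies in \<open>H\<close>. Hence agreement of \<open>\<xi>\<close> with
  the powers of \<open>z\<close> on such powers of \<open>x\<close> is exactly what makes the
  extension well defined.\<close>

lemma char_on_adjoin:
  assumes H: "subgroup H G" and \<xi>: "char_on G H \<xi>" and x: "x \<in> carrier G" and z: "cmod z = 1"
    and zx: "\<And>k::int. x [^] k \<in> H \<Longrightarrow> \<xi> (x [^] k) = z powi k"
  shows "\<exists>\<psi>. char_on G (adjoin G H x) \<psi> \<and> (\<forall>h\<in>H. \<psi> h = \<xi> h) \<and> \<psi> x = z"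
proof -
  have Hc: "\<And>h. h \<in> H \<Longrightarrow> h \<in> carrier G" using H subgroup.mem_carrier by fast
  have one: "\<one> \<in> H" using H subgroup.one_closed by fast
  have z0: "z \<noteq> 0" using z by auto
  define \<psi> where "\<psi> y = (SOME w. \<exists>h (k::int). h \<in> H \<and> y = h \<otimes> x [^] k \<and> w = \<xi> h * z powi k)" for y
  have uniq: "\<xi> h * z powi k = \<xi> h' * z powi k'"
    if h: "h \<in> H" "h' \<in> H" "h \<otimes> x [^] k = h' \<otimes> x [^] k'" for h h' and k k' :: int
  proof -
    have "x [^] (k - k') = x [^] k \<otimes> inv (x [^] k')" using x int_pow_diff by simp
    also have "\<dots> = inv h \<otimes> (h \<otimes> x [^] k) \<otimes> inv (x [^] k')" using x Hc[OF h(1)] by (simp add: m_assoc[symmetric])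
    also have "\<dots> = inv h \<otimes> h'" using x Hc[OF h(1)] Hc[OF h(2)] unfolding h(3) by (simp add: m_assoc)
    finally have e: "x [^] (k - k') = inv h \<otimes> h'" .
    have ih: "inv h \<in> H" using h H subgroup.m_inv_closed by fast
    then have "inv h \<otimes> h' \<in> H" using h H subgroup.m_closed by fast
    then have "z powi (k - k') = \<xi> (inv h \<otimes> h')" using zx[of "k - k'"] e by simp
    also have "\<dots> = inverse (\<xi> h) * \<xi> h'" using ih h \<xi> char_on_inv[OF H \<xi>] by (simp add: char_on_def)
    finally show ?thesis using z0 char_on_nonzero[OF \<xi> h(1)] by (simp add: power_int_diff field_simps)
  qed
  have eq: "\<psi> (h \<otimes> x [^] k) = \<xi> h * z powi k" if "h \<in> H" for h and k :: int
    unfolding \<psi>_def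
  proof (rule some_equality)
    show "\<exists>h' k'. h' \<in> H \<and> h \<otimes> x [^] k = h' \<otimes> x [^] (k'::int) \<and> \<xi> h * z powi k = \<xi> h' * z powi k'"
      using that by blast
    show "w = \<xi> h * z powi k"
      if "\<exists>h' k'. h' \<in> H \<and> h \<otimes> x [^] k = h' \<otimes> x [^] (k'::int) \<and> w = \<xi> h' * z powi k'" for w
      using that uniq[OF \<open>h \<in> H\<close>] by auto
  qed
  show ?thesis
  proof (intro exI[of _ \<psi>] conjI ballI)
    show "\<psi> h = \<xi> h" if "h \<in> H" for h using eq[OF that, of 0] Hc[OF that] by simp
    show "\<psi> x = z" using eq[OF one, of 1] x char_on_one[OF H \<xi>] by simp
    have "cmod (\<psi> y) = 1" if "y \<in> adjoin G H x" for y
      using that \<xi> z by (auto simp: adjoin_def eq norm_mult norm_power_int char_on_def)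
    moreover have "\<psi> (a \<otimes> b) = \<psi> a * \<psi> b" if mem: "a \<in> adjoin G H x" "b \<in> adjoin G H x" for a b
    proof -
      obtain h and k :: int where a: "h \<in> H" "a = h \<otimes> x [^] k" using mem by (auto simp: adjoin_def)
      obtain h' and k' :: int where b: "h' \<in> H" "b = h' \<otimes> x [^] k'" using mem by (auto simp: adjoin_def)
      note ab = a b
      have "a \<otimes> b = (h \<otimes> h') \<otimes> (x [^] k \<otimes> x [^] k')"
        using ab Hc x by (simp add: m_ac)
      also have "\<dots> = (h \<otimes> h') \<otimes> x [^] (k + k')" using x by (simp add: int_pow_mult)
      finally have "a \<otimes> b = (h \<otimes> h') \<otimes> x [^] (k + k')" .
      moreover have "h \<otimes> h' \<in> H" using ab H subgroup.m_closed by fast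
      ultimately show ?thesis using ab \<xi> z0 by (simp add: eq char_on_def power_int_add)
    qed
    ultimately show "char_on G (adjoin G H x) \<psi>" unfolding char_on_def by blast
  qed
qed

text \<open>\<open>n\<close> is the order of \<open>x\<close> modulo \<open>H\<close>, and \<open>0\<close> if that order is infinite.\<close>

lemma order_modulo_subgroup:
  assumes H: "subgroup H G" and x: "x \<in> carrier G"
  shows "\<exists>n::nat. \<forall>k::int. x [^] k \<in> H \<longleftrightarrow> int n dvd k"
proof -
  define n :: nat where "n = (if \<exists>n>0. x [^] (n::nat) \<in> H then LEAST n. n > 0 \<and> x [^] n \<in> H else 0)"
  have one: "\<one> \<in> H" using H subgroup.one_closed by fast
  have least: "n > 0 \<and> x [^] n \<in> H \<and> n \<le> m" if "m > 0" "x [^] m \<in> H" for m :: nat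
    using that LeastI[of "\<lambda>n. n > 0 \<and> x [^] n \<in> H" m] Least_le[of "\<lambda>n. n > 0 \<and> x [^] n \<in> H" m]
    unfolding n_def by auto
  have xn: "x [^] int n \<in> H"
  proof (cases "n = 0")
    case True then show ?thesis using one by simp
  next
    case False
    then show ?thesis using least unfolding int_pow_int n_def by meson
  qed
  have "x [^] k \<in> H \<longleftrightarrow> int n dvd k" for k :: int
  proof
    assume "int n dvd k"
    then obtain q where "k = int n * q" by auto
    then have "x [^] k = (x [^] int n) [^] q" using x by (simp add: int_pow_pow)
    then show "x [^] k \<in> H" using subgroup_int_pow_closed[OF H xn] by simp
  next
    assume k: "x [^] k \<in> H"
    have pos: "n > 0 \<and> int n \<le> m" if m: "m > 0" "x [^] m \<in> H" for m :: int
    proof -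
      have "x [^] nat m \<in> H" using m int_pow_int[of G x "nat m"] by simp
      then show ?thesis using least[of "nat m"] m(1) by linarith
    qed
    show "int n dvd k"
    proof (cases "k = 0")
      case False
      have "x [^] (- k) \<in> H" using H k x subgroup.m_inv_closed[OF H k] by (simp add: int_pow_neg)
      then have np: "n > 0" using pos[OF _ k] pos[of "- k"] False by linarith
      define m where "m = k mod int n"
      have "m = k - int n * (k div int n)" by (simp add: m_def minus_mult_div_eq_mod)
      then have "x [^] m = x [^] k \<otimes> inv ((x [^] int n) [^] (k div int n))"
        using x by (simp add: int_pow_diff int_pow_pow)
      then have "x [^] m \<in> H"
        using subgroup.m_closed[OF H k subgroup.m_inv_closed[OF H subgroup_int_pow_closed[OF H xn]]] by simp
      moreover have "0 \<le> m" "m < int n" using np by (auto simp: m_def)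
      ultimately have "m = 0" using pos[of m] by linarith
      then show ?thesis by (simp add: m_def dvd_eq_mod_eq_0)
    qed auto
  qed
  then show ?thesis by blast
qed

text \<open>The powers of \<open>x\<close> inside \<open>H\<close> are the powers of
  \<open>x [^] n\<close>, so compatibility reduces to one equation. For \<open>n = 0\<close> it
  reads \<open>1 = 1\<close> and leaves \<open>z\<close> free.\<close>

lemma char_on_adjoin_order:
  assumes H: "subgroup H G" and \<xi>: "char_on G H \<xi>" and x: "x \<in> carrier G" and z: "cmod z = 1"
    and n: "\<And>k::int. x [^] k \<in> H \<longleftrightarrow> int n dvd k" and zn: "z ^ n = \<xi> (x [^] n)"
  shows "\<exists>\<psi>. char_on G (adjoin G H x) \<psi> \<and> (\<forall>h\<in>H. \<psi> h = \<xi> h) \<and> \<psi> x = z"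
proof -
  have zx: "\<xi> (x [^] k) = z powi k" if "x [^] k \<in> H" for k :: int
  proof -
    have "int n dvd k" using n[THEN iffD1, OF that] .
    then obtain q where k: "k = int n * q" by (rule dvdE)
    have "x [^] int n \<in> H" by (rule n[THEN iffD2]) simp
    have "\<xi> (x [^] k) = \<xi> ((x [^] int n) [^] q)" unfolding k using x by (simp only: int_pow_pow)
    also have "\<dots> = \<xi> (x [^] int n) powi q" using \<open>x [^] int n \<in> H\<close> by (rule char_on_int_pow[OF H \<xi>])
    also have "\<dots> = (z powi (int n)) powi q" using zn by (simp add: int_pow_int)
    also have "\<dots> = z powi k" unfolding k by (rule power_int_mult[symmetric])
    finally show ?thesis .
  qed
  show ?thesis by (rule char_on_adjoin[OF H \<xi> x z zx])
qed

text \<open>Divisibility of the circle. The clause for \<open>n = 0\<close> lets elements of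
  infinite order modulo a subgroup be treated together with those of finite order.\<close>

lemma exists_root_norm_1:
  assumes "cmod w = 1" "n = 0 \<Longrightarrow> w = 1"
  obtains z where "cmod z = 1" "z ^ n = w"
proof (cases "n = 0")
  case True then show ?thesis using that[of 1] assms by simp
next
  case False
  have "w \<noteq> 0" using assms(1) by auto
  then have "cis (Arg w) = sgn w" by (rule cis_Arg)
  also have "\<dots> = w" using assms(1) by (simp add: sgn_eq)
  finally have w: "cis (Arg w) = w" .
  have "cis (Arg w / n) ^ n = cis (real n * (Arg w / n))" by (rule Complex.DeMoivre)
  also have "real n * (Arg w / n) = Arg w" using False by simp
  finally have "cis (Arg w / n) ^ n = w" unfolding w .
  with norm_cis show ?thesis by (rule that)
qed

lemma char_on_adjoin_exists:
  assumes H: "subgroup H G" and \<xi>: "char_on G H \<xi>" and x: "x \<in> carrier G"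
  shows "\<exists>\<psi>. char_on G (adjoin G H x) \<psi> \<and> (\<forall>h\<in>H. \<psi> h = \<xi> h)"
proof -
  obtain n :: nat where nn: "\<forall>k::int. x [^] k \<in> H \<longleftrightarrow> int n dvd k"
    using order_modulo_subgroup[OF H x] by blast
  note n = nn[rule_format]
  have "x [^] int n \<in> H" by (rule n[THEN iffD2]) simp
  then have xn: "x [^] n \<in> H" by (simp add: int_pow_int)
  have "cmod (\<xi> (x [^] n)) = 1" using \<xi> xn by (simp add: char_on_def)
  moreover have "n = 0 \<Longrightarrow> \<xi> (x [^] n) = 1" using char_on_one[OF H \<xi>] by simp
  ultimately obtain z where "cmod z = 1" "z ^ n = \<xi> (x [^] n)" by (rule exists_root_norm_1)
  from char_on_adjoin_order[OF H \<xi> x this(1) n this(2)] show ?thesis by blast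
qed

text \<open>The circle is divisible, hence injective among abelian groups: one-element extensions
  always exist, and Zorn's lemma does the rest.\<close>

lemma char_on_extend:
  assumes H: "subgroup H G" and \<xi>: "char_on G H \<xi>"
  shows "\<exists>\<psi>. char_on G (carrier G) \<psi> \<and> (\<forall>h\<in>H. \<psi> h = \<xi> h)"
proof -
  define ext where "ext K \<psi> \<longleftrightarrow> subgroup K G \<and> H \<subseteq> K \<and> char_on G K \<psi> \<and> (\<forall>h\<in>H. \<psi> h = \<xi> h)" for K \<psi>
  \<comment> \<open>Passing to graphs turns extension of characters into set inclusion.\<close>
  define gr :: "'a set \<Rightarrow> ('a \<Rightarrow> complex) \<Rightarrow> ('a \<times> complex) set" where "gr K \<psi> = (\<lambda>y. (y, \<psi> y)) ` K" for K \<psi>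
  define \<A> where "\<A> = {gr K \<psi> | K \<psi>. ext K \<psi>}"
  have "ext H \<xi>" using assms by (simp add: ext_def)
  then have ne: "\<A> \<noteq> {}" by (auto simp: \<A>_def)
  have union: "\<Union>\<C> \<in> \<A>" if C: "\<C> \<noteq> {}" "subset.chain \<A> \<C>" for \<C>
  proof -
    have "\<forall>E\<in>\<C>. \<exists>K \<psi>. E = gr K \<psi> \<and> ext K \<psi>" using C(2) by (auto simp: subset.chain_def \<A>_def)
    then obtain K \<psi> where K: "\<And>E. E \<in> \<C> \<Longrightarrow> E = gr (K E) (\<psi> E)" "\<And>E. E \<in> \<C> \<Longrightarrow> ext (K E) (\<psi> E)"
      by metis
    have tot: "E \<subseteq> \<Delta> \<or> \<Delta> \<subseteq> E" if "E \<in> \<C>" "\<Delta> \<in> \<C>" for E \<Delta>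
      using C(2) that unfolding subset_chain_def by blast
    have sub: "K E \<subseteq> K \<Delta> \<and> (\<forall>y\<in>K E. \<psi> E y = \<psi> \<Delta> y)" if "E \<in> \<C>" "\<Delta> \<in> \<C>" "E \<subseteq> \<Delta>" for E \<Delta>
      using K(1)[OF that(1)] K(1)[OF that(2)] that(3) unfolding gr_def by auto
    define L where "L = (\<Union>E\<in>\<C>. K E)"
    define \<theta> where "\<theta> y = \<psi> (SOME E. E \<in> \<C> \<and> y \<in> K E) y" for y
    have \<theta>: "\<theta> y = \<psi> E y" if "E \<in> \<C>" "y \<in> K E" for E y
    proof -
      define \<Delta> where "\<Delta> = (SOME E. E \<in> \<C> \<and> y \<in> K E)"
      have "\<Delta> \<in> \<C> \<and> y \<in> K \<Delta>" unfolding \<Delta>_def by (rule someI[of _ E]) (use that in blast)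
      then have "\<psi> \<Delta> y = \<psi> E y" using tot[of \<Delta> E] sub[of \<Delta> E] sub[of E \<Delta>] that by metis
      then show ?thesis by (simp add: \<theta>_def \<Delta>_def)
    qed
    have two: "\<exists>E\<in>\<C>. a \<in> K E \<and> b \<in> K E" if ab: "a \<in> L" "b \<in> L" for a b
    proof -
      obtain E \<Delta> where *: "E \<in> \<C>" "a \<in> K E" "\<Delta> \<in> \<C>" "b \<in> K \<Delta>" using ab by (auto simp: L_def)
      then show ?thesis using tot[of E \<Delta>] sub[of \<Delta> E] sub[of E \<Delta>] by blast
    qed
    have Ks: "subgroup (K E) G" "H \<subseteq> K E" "char_on G (K E) (\<psi> E)" "\<And>h. h \<in> H \<Longrightarrow> \<psi> E h = \<xi> h"
      if "E \<in> \<C>" for E using K(2)[OF that] by (auto simp: ext_def)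
    have sg: "subgroup L G"
    proof (rule subgroupI)
      show "L \<subseteq> carrier G" using Ks(1) subgroup.subset by (auto simp: L_def)
      obtain E where "E \<in> \<C>" using C(1) by blast
      then show "L \<noteq> {}" using Ks(1) subgroup.one_closed[of "K E" G] unfolding L_def by blast
      show "inv a \<in> L" if a: "a \<in> L" for a
      proof -
        obtain E where "E \<in> \<C>" "a \<in> K E" using a by (auto simp: L_def)
        then have "inv a \<in> K E" using subgroup.m_inv_closed[OF Ks(1)] by blast
        then show ?thesis using \<open>E \<in> \<C>\<close> by (auto simp: L_def)
      qed
      show "a \<otimes> b \<in> L" if ab: "a \<in> L" "b \<in> L" for a b
      proof -
        obtain E where "E \<in> \<C>" "a \<in> K E" "b \<in> K E" using two[OF ab] by blast
        then have "a \<otimes> b \<in> K E" using subgroup.m_closed[OF Ks(1)] by blast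
        then show ?thesis using \<open>E \<in> \<C>\<close> by (auto simp: L_def)
      qed
    qed
    have ch: "char_on G L \<theta>"
      unfolding char_on_def
    proof (intro conjI ballI)
      fix a assume "a \<in> L"
      then obtain E where "E \<in> \<C>" "a \<in> K E" by (auto simp: L_def)
      then show "cmod (\<theta> a) = 1" using \<theta> Ks(3) by (simp add: char_on_def)
      fix b assume "b \<in> L"
      then obtain E where *: "E \<in> \<C>" "a \<in> K E" "b \<in> K E" using two \<open>a \<in> L\<close> by blast
      then have "a \<otimes> b \<in> K E" using Ks(1) subgroup.m_closed by fast
      then show "\<theta> (a \<otimes> b) = \<theta> a * \<theta> b" using * \<theta>[OF *(1)] Ks(3)[OF *(1)] by (simp add: char_on_def)
    qed
    have HL: "H \<subseteq> L" "\<And>h. h \<in> H \<Longrightarrow> \<theta> h = \<xi> h"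
    proof -
      obtain E where G: "E \<in> \<C>" using C(1) by blast
      show "H \<subseteq> L" using Ks(2)[OF G] G by (auto simp: L_def)
      show "\<theta> h = \<xi> h" if "h \<in> H" for h using \<theta>[OF G] Ks(2)[OF G] Ks(4)[OF G that] that by auto
    qed
    have "\<Union>\<C> = gr L \<theta>"
    proof
      show "\<Union>\<C> \<subseteq> gr L \<theta>"
      proof
        fix p assume "p \<in> \<Union>\<C>"
        then obtain E where g: "E \<in> \<C>" "p \<in> E" by blast
        then have "p \<in> gr (K E) (\<psi> E)" using K(1) by simp
        then obtain y where "y \<in> K E" "p = (y, \<psi> E y)" by (auto simp: gr_def)
        then show "p \<in> gr L \<theta>" using \<theta>[OF g(1)] g(1) by (auto simp: gr_def L_def)
      qed
      show "gr L \<theta> \<subseteq> \<Union>\<C>"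
      proof
        fix p assume "p \<in> gr L \<theta>"
        then obtain y E where g: "E \<in> \<C>" "y \<in> K E" "p = (y, \<theta> y)" by (auto simp: gr_def L_def)
        then have "p \<in> gr (K E) (\<psi> E)" using \<theta> by (auto simp: gr_def)
        then show "p \<in> \<Union>\<C>" using K(1)[OF g(1)] g(1) by blast
      qed
    qed
    moreover have "ext L \<theta>" using sg ch HL by (simp add: ext_def)
    ultimately show ?thesis unfolding \<A>_def by blast
  qed
  obtain M where M: "M \<in> \<A>" "\<And>X. X \<in> \<A> \<Longrightarrow> M \<subseteq> X \<Longrightarrow> X = M"
    using subset_Zorn_nonempty[OF ne union] by blast
  then obtain K \<psi> where K: "M = gr K \<psi>" "ext K \<psi>" by (auto simp: \<A>_def)
  then have Ks: "subgroup K G" "H \<subseteq> K" "char_on G K \<psi>" "\<And>h. h \<in> H \<Longrightarrow> \<psi> h = \<xi> h" by (auto simp: ext_def)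
  have "carrier G \<subseteq> K"
  proof
    fix x assume x: "x \<in> carrier G"
    \<comment> \<open>A one-element extension of the maximal character has the same graph, so
      \<open>x\<close> was in its domain already.\<close>
    obtain \<theta> where \<theta>: "char_on G (adjoin G K x) \<theta>" "\<forall>h\<in>K. \<theta> h = \<psi> h"
      using char_on_adjoin_exists[OF Ks(1,3) x] by blast
    note ad = subgroup_adjoin[OF Ks(1) x]
    have "ext (adjoin G K x) \<theta>" using \<theta> ad Ks by (auto simp: ext_def)
    then have "gr (adjoin G K x) \<theta> \<in> \<A>" by (auto simp: \<A>_def)
    moreover have "M \<subseteq> gr (adjoin G K x) \<theta>" using \<theta>(2) ad(2) unfolding K(1) gr_def by force
    ultimately have "gr (adjoin G K x) \<theta> = M" by (rule M(2))
    then have "(x, \<theta> x) \<in> gr K \<psi>" using ad(3) K(1) by (auto simp: gr_def)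
    then show "x \<in> K" by (auto simp: gr_def)
  qed
  then have "K = carrier G" using Ks(1) subgroup.subset by blast
  then show ?thesis using Ks by blast
qed

text \<open>Here \<open>n\<close> will be the order of an element modulo a subgroup;
  \<open>n \<noteq> 1\<close> says that the element is outside it, and \<open>n = 0\<close> that its
  order is infinite.\<close>

lemma exists_nontrivial_root:
  assumes "n \<noteq> 1" obtains z :: complex where "cmod z = 1" "z ^ n = 1" "z \<noteq> 1"
proof (cases "n = 0")
  case True then show ?thesis using that[of "-1"] by simp
next
  case False
  then have n: "n \<ge> 2" using assms by linarith
  then have "card {z::complex. z ^ n = 1} = n" using card_nth_roots[of 1 n] by simp
  then have "\<not> {z::complex. z ^ n = 1} \<subseteq> {1}" using n card_mono[of "{1::complex}" "{z. z ^ n = 1}"] by force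
  then obtain z :: complex where z: "z ^ n = 1" "z \<noteq> 1" by blast
  have "cmod z ^ n = 1" using z(1) by (metis norm_one norm_power)
  then have "cmod z = 1" using n power_eq_imp_eq_base[of "cmod z" n 1] by simp
  then show ?thesis using that z by blast
qed

text \<open>The trivial character of \<open>H\<close> extends by a root of unity other than
  \<open>1\<close> at \<open>y\<close>, because the order of \<open>y\<close> modulo
  \<open>H\<close> is not \<open>1\<close>; the result then extends to the whole group.\<close>

lemma char_separates:
  assumes H: "subgroup H G" and y: "y \<in> carrier G" "y \<notin> H"
  shows "\<exists>\<psi>. char_on G (carrier G) \<psi> \<and> (\<forall>h\<in>H. \<psi> h = 1) \<and> \<psi> y \<noteq> 1"
proof -
  obtain n :: nat where nn: "\<forall>k::int. y [^] k \<in> H \<longleftrightarrow> int n dvd k"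
    using order_modulo_subgroup[OF H y(1)] by blast
  note n = nn[rule_format]
  have "n \<noteq> 1" using n[of 1] y by auto
  then obtain z where z: "cmod z = 1" "z ^ n = 1" "z \<noteq> 1" by (rule exists_nontrivial_root)
  have one: "char_on G H (\<lambda>_. 1)" by (simp add: char_on_def)
  obtain \<psi> where \<psi>: "char_on G (adjoin G H y) \<psi>" "\<forall>h\<in>H. \<psi> h = 1" "\<psi> y = z"
    using char_on_adjoin_order[OF H one y(1) z(1) n z(2)] by blast
  note ad = subgroup_adjoin[OF H y(1)]
  obtain \<theta> where "char_on G (carrier G) \<theta>" "\<forall>h\<in>adjoin G H y. \<theta> h = \<psi> h"
    using char_on_extend[OF ad(1) \<psi>(1)] by blast
  then show ?thesis using \<psi> ad z by (intro exI[of _ \<theta>]) auto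
qed

section \<open>Counting the characters of a finite subgroup\<close>

lemma finite_order_in_finite_subgroup:
  assumes H: "subgroup H G" "finite H" and x: "x \<in> H"
  shows "\<exists>m>0. x [^] (m::nat) = \<one>"
proof (rule ccontr)
  assume no: "\<not> ?thesis"
  have xc: "x \<in> carrier G" using H(1) x subgroup.mem_carrier by fast
  have "inj (\<lambda>k::nat. x [^] k)"
  proof (rule linorder_injI)
    fix k l :: nat assume kl: "k < l"
    show "x [^] k \<noteq> x [^] l"
    proof
      assume e: "x [^] k = x [^] l"
      have "x [^] k \<otimes> x [^] (l - k) = x [^] l" using nat_pow_mult[OF xc, of k "l - k"] kl by simp
      then have "x [^] k \<otimes> x [^] (l - k) = x [^] k \<otimes> \<one>" using e xc by simp
      then have "x [^] (l - k) = \<one>" using xc by simp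
      then show False using no kl by (meson zero_less_diff)
    qed
  qed
  moreover have "range (\<lambda>k::nat. x [^] k) \<subseteq> H"
    using subgroup_int_pow_closed[OF H(1) x] by (auto simp: int_pow_int[symmetric])
  ultimately have "finite (UNIV :: nat set)" using H(2) by (meson finite_imageD finite_subset)
  then show False by simp
qed

text \<open>Multiples of \<open>m\<close> in the exponent are absorbed by \<open>H\<close>. Any
  positive \<open>m\<close> gives the covering; only the exact order of \<open>x\<close> modulo
  \<open>H\<close> makes it bijective.\<close>

lemma adjoin_eq_image:
  assumes H: "subgroup H G" and x: "x \<in> carrier G" and m: "x [^] (m::nat) \<in> H" "m > 0"
  shows "adjoin G H x = (\<lambda>(h, k). h \<otimes> x [^] k) ` (H \<times> {0..<int m})"
proof
  show "adjoin G H x \<subseteq> (\<lambda>(h, k). h \<otimes> x [^] k) ` (H \<times> {0..<int m})"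
  proof
    fix y assume "y \<in> adjoin G H x"
    then obtain h and k :: int where y: "h \<in> H" "y = h \<otimes> x [^] k" unfolding adjoin_def by blast
    let ?g = "(x [^] int m) [^] (k div int m)"
    have "x [^] int m \<in> H" using m(1) by (simp add: int_pow_int)
    then have g: "?g \<in> H" by (rule subgroup_int_pow_closed[OF H])
    have c: "h \<in> carrier G" "?g \<in> carrier G" using y(1) g H subgroup.mem_carrier by fast+
    have "x [^] k = ?g \<otimes> x [^] (k mod int m)"
      using int_pow_mult[OF x, of "int m * (k div int m)" "k mod int m"] x by (simp add: int_pow_pow)
    then have "y = (h \<otimes> ?g) \<otimes> x [^] (k mod int m)" using y(2) c x by (simp add: m_assoc)
    moreover have "h \<otimes> ?g \<in> H" using subgroup.m_closed[OF H y(1) g] .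
    moreover have "k mod int m \<in> {0..<int m}" using m(2) by simp
    ultimately show "y \<in> (\<lambda>(h, k). h \<otimes> x [^] k) ` (H \<times> {0..<int m})" by force
  qed
qed (auto simp: adjoin_def)

lemma finite_subgroup_containing_torsion:
  assumes "finite Y" "\<And>y. y \<in> Y \<Longrightarrow> y \<in> carrier G" "\<And>y. y \<in> Y \<Longrightarrow> \<exists>m>0. y [^] (m::nat) = \<one>"
  shows "\<exists>H. subgroup H G \<and> finite H \<and> Y \<subseteq> H"
  using assms
proof (induction Y rule: finite_induct)
  case empty
  show ?case using triv_subgroup by (intro exI[of _ "{\<one>}"]) simp
next
  case (insert y Y)
  then obtain H where H: "subgroup H G" "finite H" "Y \<subseteq> H" by auto
  obtain m :: nat where m: "m > 0" "y [^] m = \<one>" using insert(5)[of y] by auto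
  have y: "y \<in> carrier G" using insert(4)[of y] by simp
  note ad = subgroup_adjoin[OF H(1) y]
  have "y [^] m \<in> H" unfolding m(2) using H(1) by (rule subgroup.one_closed)
  then have fin: "finite (adjoin G H y)" using adjoin_eq_image[OF H(1) y _ m(1)] H(2) by simp
  show ?case
    using ad H(3) fin by (intro exI[of _ "adjoin G H y"]) auto
qed

text \<open>Extensionality gives each character of \<open>H\<close> a single representative, so that
  characters can be counted.\<close>

definition chars :: "'a set \<Rightarrow> ('a \<Rightarrow> complex) set"
  where "chars H = {\<psi> \<in> extensional H. char_on G H \<psi>}"

text \<open>Both cardinalities grow by the same factor \<open>n\<close>: it is the index of
  \<open>K\<close> in the new subgroup, and each character of \<open>K\<close> has one extension for
  each of the \<open>n\<close> solutions of \<open>z ^ n = \<xi> (x [^] n)\<close>.\<close>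

lemma card_chars_adjoin:
  assumes K: "subgroup K G" and fin: "finite K" and x: "x \<in> carrier G"
    and n: "\<And>k::int. x [^] k \<in> K \<longleftrightarrow> int n dvd k" and n0: "n > 0" and cK: "card (chars K) = card K"
  shows "card (chars (adjoin G K x)) = card (adjoin G K x)"
proof -
  note ad = subgroup_adjoin[OF K x]
  have Kc: "\<And>h. h \<in> K \<Longrightarrow> h \<in> carrier G" using K subgroup.mem_carrier by fast
  have "K \<noteq> {}" using K subgroup.one_closed by fast
  \<comment> \<open>The assumed equality makes \<open>card (chars K)\<close> positive, and an
    infinite set has cardinality \<open>0\<close>.\<close>
  then have finK: "finite (chars K)" using cK fin by (metis card_gt_0_iff)
  have xn: "x [^] n \<in> K" using n[of "int n"] by (simp add: int_pow_int)
  have "bij_betw (\<lambda>(h, k). h \<otimes> x [^] k) (K \<times> {0..<int n}) (adjoin G K x)"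
  proof (rule bij_betw_imageI)
    show "inj_on (\<lambda>(h, k). h \<otimes> x [^] k) (K \<times> {0..<int n})"
    proof (rule inj_onI, clarify)
      fix h h' and k k' :: int
      assume a: "h \<in> K" "h' \<in> K" "k \<in> {0..<int n}" "k' \<in> {0..<int n}" "h \<otimes> x [^] k = h' \<otimes> x [^] k'"
      have "x [^] (k - k') = x [^] k \<otimes> inv (x [^] k')" using x int_pow_diff by simp
      also have "\<dots> = inv h \<otimes> (h \<otimes> x [^] k) \<otimes> inv (x [^] k')" using x Kc[OF a(1)] by (simp add: m_assoc[symmetric])
      also have "\<dots> = inv h \<otimes> h'" using x Kc[OF a(1)] Kc[OF a(2)] unfolding a(5) by (simp add: m_assoc)
      also have "\<dots> \<in> K" using a K subgroup.m_closed[OF K] subgroup.m_inv_closed[OF K] by blast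
      finally have "int n dvd k - k'" by (rule n[THEN iffD1])
      then have "k - k' \<noteq> 0 \<Longrightarrow> \<bar>int n\<bar> \<le> \<bar>k - k'\<bar>" by (intro dvd_imp_le_int)
      moreover have "\<bar>k - k'\<bar> < \<bar>int n\<bar>" using a(3,4) by auto
      ultimately have k: "k = k'" by linarith
      then have "h = h'" using a(5) right_cancel[OF _ Kc[OF a(1)] Kc[OF a(2)], of "x [^] k"] x by simp
      with k show "h = h' \<and> k = k'" by simp
    qed
    show "(\<lambda>(h, k). h \<otimes> x [^] k) ` (K \<times> {0..<int n}) = adjoin G K x"
      using adjoin_eq_image[OF K x xn n0] by (rule sym)
  qed
  from bij_betw_same_card[OF this] have c1: "card (adjoin G K x) = card K * n" by (simp add: card_cartesian_product)
  \<comment> \<open>A character of the larger subgroup is determined by its restriction to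
    \<open>K\<close> and its value at \<open>x\<close>; the admissible values depend on the
    restriction, hence the dependent sum.\<close>
  have "bij_betw (\<lambda>\<psi>. (restrict \<psi> K, \<psi> x)) (chars (adjoin G K x)) (SIGMA \<xi>:chars K. {z. z ^ n = \<xi> (x [^] n)})"
  proof (rule bij_betw_imageI)
    show "inj_on (\<lambda>\<psi>. (restrict \<psi> K, \<psi> x)) (chars (adjoin G K x))"
    proof (rule inj_onI, clarify)
      fix \<psi> \<theta> assume a: "\<psi> \<in> chars (adjoin G K x)" "\<theta> \<in> chars (adjoin G K x)"
        "restrict \<psi> K = restrict \<theta> K" "\<psi> x = \<theta> x"
      have c: "char_on G (adjoin G K x) \<psi>" "char_on G (adjoin G K x) \<theta>" using a by (auto simp: chars_def)
      have "\<psi> y = \<theta> y" if y: "y \<in> adjoin G K x" for y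
      proof -
        obtain h and k :: int where y: "h \<in> K" "y = h \<otimes> x [^] k" using y by (auto simp: adjoin_def)
        have m: "h \<in> adjoin G K x" "x [^] k \<in> adjoin G K x"
          using y ad subgroup_int_pow_closed[OF ad(1) ad(3)] by auto
        have "\<psi> h = \<theta> h" using a(3) y(1) by (metis restrict_apply')
        moreover have "\<psi> (x [^] k) = \<theta> (x [^] k)"
          using char_on_int_pow[OF ad(1) c(1) ad(3)] char_on_int_pow[OF ad(1) c(2) ad(3)] a(4) by simp
        ultimately show ?thesis using c m unfolding y(2) char_on_def by simp
      qed
      then show "\<psi> = \<theta>" using a(1,2) by (intro extensionalityI[of _ "adjoin G K x"]) (auto simp: chars_def)
    qed
    show "(\<lambda>\<psi>. (restrict \<psi> K, \<psi> x)) ` chars (adjoin G K x) = (SIGMA \<xi>:chars K. {z. z ^ n = \<xi> (x [^] n)})"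
    proof (intro equalityI subsetI)
      fix p assume "p \<in> (\<lambda>\<psi>. (restrict \<psi> K, \<psi> x)) ` chars (adjoin G K x)"
      then obtain \<psi> where p: "\<psi> \<in> chars (adjoin G K x)" "p = (restrict \<psi> K, \<psi> x)" by blast
      have c: "char_on G (adjoin G K x) \<psi>" using p by (simp add: chars_def)
      have "char_on G K (restrict \<psi> K)"
        using char_on_subset[OF c ad(2)] char_on_cong[of K \<psi> "restrict \<psi> K", OF _ K] by simp
      moreover have "\<psi> x ^ n = restrict \<psi> K (x [^] n)"
        using char_on_nat_pow[OF ad(1) c ad(3)] xn by simp
      ultimately show "p \<in> (SIGMA \<xi>:chars K. {z. z ^ n = \<xi> (x [^] n)})" by (simp add: p chars_def)
    next
      fix p assume "p \<in> (SIGMA \<xi>:chars K. {z. z ^ n = \<xi> (x [^] n)})"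
      then obtain \<xi> z where p: "p = (\<xi>, z)" "\<xi> \<in> extensional K" "char_on G K \<xi>" "z ^ n = \<xi> (x [^] n)"
        by (auto simp: chars_def)
      have "cmod z ^ n = 1" using p(3) xn by (simp add: norm_power[symmetric] p(4) char_on_def)
      then have z: "cmod z = 1" using n0 power_eq_imp_eq_base[of "cmod z" n 1] by simp
      obtain \<psi> where \<psi>: "char_on G (adjoin G K x) \<psi>" "\<forall>h\<in>K. \<psi> h = \<xi> h" "\<psi> x = z"
        using char_on_adjoin_order[OF K p(3) x z n p(4)] by blast
      have "restrict \<psi> (adjoin G K x) \<in> chars (adjoin G K x)"
        using \<psi>(1) char_on_cong[of "adjoin G K x" \<psi> "restrict \<psi> (adjoin G K x)", OF _ ad(1)] by (simp add: chars_def)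
      moreover have "restrict (restrict \<psi> (adjoin G K x)) K = \<xi>"
        using \<psi>(2) p(2) ad(2) by (intro extensionalityI[of _ K]) auto
      moreover have "restrict \<psi> (adjoin G K x) x = z" using ad(3) \<psi>(3) by simp
      ultimately show "p \<in> (\<lambda>\<psi>. (restrict \<psi> K, \<psi> x)) ` chars (adjoin G K x)"
        unfolding p(1) by (metis (no_types, lifting) imageI)
    qed
  qed
  from bij_betw_same_card[OF this]
  have "card (chars (adjoin G K x)) = (\<Sum>\<xi>\<in>chars K. card {z. z ^ n = \<xi> (x [^] n)})"
    using finK n0 by (simp add: finite_nth_roots)
  also have "\<dots> = (\<Sum>\<xi>\<in>chars K. n)"
  proof (rule sum.cong[OF refl])
    fix \<xi> assume "\<xi> \<in> chars K"
    then have "\<xi> (x [^] n) \<noteq> 0" using xn char_on_nonzero[of G K \<xi> "x [^] n"] by (simp add: chars_def)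
    then show "card {z. z ^ n = \<xi> (x [^] n)} = n" using n0 by (rule card_nth_roots)
  qed
  finally show ?thesis using c1 cK by simp
qed

text \<open>A maximal subgroup of \<open>H\<close> with the right number of characters is all of
  \<open>H\<close>, since adjoining a further element of \<open>H\<close> preserves the
  count.\<close>

lemma card_chars:
  assumes H: "subgroup H G" and fin: "finite H"
  shows "card (chars H) = card H"
proof -
  define \<K> where "\<K> = {K. subgroup K G \<and> K \<subseteq> H \<and> card (chars K) = card K}"
  have "chars {\<one>} = {\<lambda>y\<in>{\<one>}. 1}"
  proof
    show "chars {\<one>} \<subseteq> {\<lambda>y\<in>{\<one>}. 1}"
    proof
      fix \<psi> assume p: "\<psi> \<in> chars {\<one>}"
      have "\<psi> \<one> = 1" using char_on_one[OF triv_subgroup, of \<psi>] p by (simp add: chars_def)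
      then have "\<psi> = (\<lambda>y\<in>{\<one>}. 1)" using p by (intro extensionalityI[of _ "{\<one>}"]) (auto simp: chars_def)
      then show "\<psi> \<in> {\<lambda>y\<in>{\<one>}. 1}" by simp
    qed
  qed (auto simp: chars_def char_on_def)
  then have "{\<one>} \<in> \<K>" using triv_subgroup H subgroup.one_closed by (auto simp: \<K>_def)
  moreover have "finite \<K>" by (rule finite_subset[of _ "Pow H"]) (use fin in \<open>auto simp: \<K>_def\<close>)
  ultimately obtain K where K: "K \<in> \<K>" "\<And>K'. K' \<in> \<K> \<Longrightarrow> K \<subseteq> K' \<Longrightarrow> K = K'"
    using finite_has_maximal[of \<K>] by blast
  then have Ks: "subgroup K G" "K \<subseteq> H" "card (chars K) = card K" by (auto simp: \<K>_def)
  have "H \<subseteq> K"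
  proof
    fix x assume xH: "x \<in> H"
    then have x: "x \<in> carrier G" using H subgroup.mem_carrier by fast
    obtain n :: nat where nn: "\<forall>k::int. x [^] k \<in> K \<longleftrightarrow> int n dvd k"
      using order_modulo_subgroup[OF Ks(1) x] by blast
    note n = nn[rule_format]
    obtain m :: nat where m: "m > 0" "x [^] m = \<one>"
      using finite_order_in_finite_subgroup[OF H fin xH] by blast
    have "x [^] int m \<in> K" unfolding int_pow_int m(2) using Ks(1) by (rule subgroup.one_closed)
    then have "int n dvd int m" by (rule n[THEN iffD1])
    then have "n > 0" using m(1) by (intro gr0I) simp
    then have "card (chars (adjoin G K x)) = card (adjoin G K x)"
      using card_chars_adjoin[OF Ks(1) finite_subset[OF Ks(2) fin] x n _ Ks(3)] by simp
    moreover have "adjoin G K x \<subseteq> H"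
      using Ks(2) subgroup.m_closed[OF H] subgroup_int_pow_closed[OF H xH] unfolding adjoin_def by blast
    ultimately have "adjoin G K x \<in> \<K>" using subgroup_adjoin[OF Ks(1) x] by (simp add: \<K>_def)
    then show "x \<in> K" using K(2) subgroup_adjoin[OF Ks(1) x] by blast
  qed
  then show ?thesis using Ks by (simp add: subset_antisym)
qed

end

section \<open>Separating sets of characters are dense\<close>

text \<open>A substitute for integration against Haar measure: finite means over translates suffice.\<close>

definition averaging :: "'b set \<Rightarrow> (('b \<Rightarrow> complex) \<Rightarrow> complex) \<Rightarrow> bool"
  where "averaging N \<Lambda> \<longleftrightarrow>
    (\<forall>f g. \<Lambda> (\<lambda>\<nu>. f \<nu> + g \<nu>) = \<Lambda> f + \<Lambda> g) \<and> (\<forall>c f. \<Lambda> (\<lambda>\<nu>. c * f \<nu>) = c * \<Lambda> f) \<and> \<Lambda> (\<lambda>\<nu>. 1) = 1 \<and>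
    (\<forall>f g. (\<forall>\<nu>\<in>N. f \<nu> = g \<nu>) \<longrightarrow> \<Lambda> f = \<Lambda> g) \<and> (\<forall>C f. (\<forall>\<nu>\<in>N. cmod (f \<nu>) \<le> C) \<longrightarrow> cmod (\<Lambda> f) \<le> C)"

lemma averagingD:
  assumes "averaging N \<Lambda>"
  shows "\<Lambda> (\<lambda>\<nu>. f \<nu> + g \<nu>) = \<Lambda> f + \<Lambda> g" "\<Lambda> (\<lambda>\<nu>. c * f \<nu>) = c * \<Lambda> f" "\<Lambda> (\<lambda>\<nu>. 1) = 1"
    "(\<And>\<nu>. \<nu> \<in> N \<Longrightarrow> f \<nu> = g \<nu>) \<Longrightarrow> \<Lambda> f = \<Lambda> g" "(\<And>\<nu>. \<nu> \<in> N \<Longrightarrow> cmod (f \<nu>) \<le> C) \<Longrightarrow> cmod (\<Lambda> f) \<le> C"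
  using assms unfolding averaging_def by blast+

lemma averaging_sum:
  assumes "averaging N \<Lambda>" "finite F"
  shows "\<Lambda> (\<lambda>\<nu>. \<Sum>i\<in>F. f i \<nu>) = (\<Sum>i\<in>F. \<Lambda> (f i))"
  using assms(2)
proof (induction F rule: finite_induct)
  case empty
  show ?case using averagingD(2)[OF assms(1), of 0 "\<lambda>_. 0"] by simp
next
  case (insert i F)
  then show ?case using averagingD(1)[OF assms(1), of "f i" "\<lambda>\<nu>. \<Sum>i\<in>F. f i \<nu>"] by simp
qed

text \<open>Supplies the exponent at which exponential decay beats the polynomially many products of
  \<open>n\<close> elements of a finite set.\<close>

lemma polynomial_times_geometric_lt_1:
  fixes q :: real
  assumes "0 \<le> q" "q < 1"
  shows "\<exists>n::nat. (real n + 1) ^ m * q ^ n < 1"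
proof (cases "q = 0")
  case True then show ?thesis by (intro exI[of _ 1]) simp
next
  case False
  then have q: "0 < q" "q < 1" using assms by auto
  have "((\<lambda>n::nat. (real n + 1) ^ m * q ^ n) \<longlongrightarrow> 0) at_top" using q by real_asymp
  then have "eventually (\<lambda>n::nat. (real n + 1) ^ m * q ^ n < 1) at_top" by (rule order_tendstoD) simp
  then show ?thesis by (rule eventually_happens'[rotated]) simp
qed

context comm_group
begin

lemma char_finprod:
  assumes "char_on G (carrier G) \<psi>" "finite I" "f \<in> I \<rightarrow> carrier G"
  shows "\<psi> (finprod G f I) = (\<Prod>i\<in>I. \<psi> (f i))"
  using assms(2,3)
proof (induction I rule: finite_induct)
  case empty
  then show ?case using char_on_one[OF subgroup_self assms(1)] by simp
next
  case (insert i I)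
  then have "f \<in> I \<rightarrow> carrier G" "f i \<in> carrier G" by auto
  then show ?case using insert assms(1) by (simp add: char_on_def)
qed

text \<open>By commutativity a product of \<open>n\<close> elements of \<open>A\<close> depends only
  on how often each one occurs. This is the source of the polynomial bound on the number of distinct
  products.\<close>

lemma finprod_eq_powers:
  assumes "finite A" "A \<subseteq> carrier G" "f \<in> {..<n::nat} \<rightarrow> A"
  shows "\<exists>e \<in> PiE A (\<lambda>_. {..n}). finprod G f {..<n} = finprod G (\<lambda>a. a [^] (e a :: nat)) A"
  using assms(3)
proof (induction n)
  case 0
  have "finprod G (\<lambda>a. a [^] (0::nat)) A = \<one>" by (rule finprod_one_eqI) simp
  then have "finprod G (\<lambda>a. a [^] ((\<lambda>a\<in>A. 0::nat) a)) A = \<one>"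
    using assms(1,2) by (subst finprod_cong'[where g = "\<lambda>a. a [^] (0::nat)" and B = A]) auto
  then show ?case by (intro bexI[of _ "\<lambda>a\<in>A. 0"]) auto
next
  case (Suc n)
  then have "f \<in> {..<n} \<rightarrow> A" by auto
  then obtain e where e: "e \<in> PiE A (\<lambda>_. {..n})" "finprod G f {..<n} = finprod G (\<lambda>a. a [^] (e a :: nat)) A"
    using Suc by blast
  define a where "a = f n"
  have a: "a \<in> A" "a \<in> carrier G" using Suc(2) assms(2) by (auto simp: a_def)
  define e' where "e' = e(a := Suc (e a))"
  have fin: "finite (A - {a})" using assms(1) by simp
  have A: "A = insert a (A - {a})" using a by auto
  have c: "(\<lambda>x. x [^] (g x :: nat)) \<in> (A - {a}) \<rightarrow> carrier G" for g using assms(2) by auto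
  have "finprod G f {..<Suc n} = f n \<otimes> finprod G f {..<n}"
    using Suc(2) assms(2) by (simp add: lessThan_Suc Pi_iff subset_iff)
  also have "finprod G f {..<n} = a [^] e a \<otimes> finprod G (\<lambda>a. a [^] e a) (A - {a})"
    unfolding e(2) using c a fin by (subst A, subst finprod_insert) auto
  also have "f n \<otimes> (a [^] e a \<otimes> finprod G (\<lambda>a. a [^] e a) (A - {a})) = a [^] Suc (e a) \<otimes> finprod G (\<lambda>a. a [^] e a) (A - {a})"
    using a c by (simp add: a_def[symmetric] m_ac)
  also have "finprod G (\<lambda>a. a [^] e a) (A - {a}) = finprod G (\<lambda>a. a [^] e' a) (A - {a})"
    using c by (intro finprod_cong') (auto simp: e'_def)
  also have "a [^] Suc (e a) \<otimes> finprod G (\<lambda>a. a [^] e' a) (A - {a}) = finprod G (\<lambda>a. a [^] e' a) A"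
    using c a fin by (subst (2) A, subst finprod_insert) (auto simp: e'_def)
  finally have "finprod G f {..<Suc n} = finprod G (\<lambda>a. a [^] e' a) A" .
  moreover have "e' \<in> PiE A (\<lambda>_. {..Suc n})" using e(1) a by (auto simp: e'_def PiE_def Pi_iff extensional_def le_Suc_eq)
  ultimately show ?case by blast
qed

text \<open>Induction on \<open>B\<close>, starting from evaluation at the trivial character. For a
  new \<open>b\<close>, a mean over translates by powers of some \<open>\<nu>\<close> with
  \<open>\<nu> b \<noteq> 1\<close> multiplies the value at each point by a mean of powers of
  \<open>\<nu>\<close> there. Such means have modulus at most \<open>1\<close>, so old bounds
  survive, and at \<open>b\<close> the geometric sum makes the mean small.\<close>

lemma exists_averaging:
  assumes N: "\<And>\<nu>. \<nu> \<in> N \<Longrightarrow> char_on G (carrier G) \<nu>"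
    and mult: "\<And>\<mu> \<nu>. \<mu> \<in> N \<Longrightarrow> \<nu> \<in> N \<Longrightarrow> (\<lambda>x\<in>carrier G. \<mu> x * \<nu> x) \<in> N"
    and one: "(\<lambda>x\<in>carrier G. 1) \<in> N"
    and sep: "\<And>a. a \<in> carrier G \<Longrightarrow> a \<noteq> \<one> \<Longrightarrow> \<exists>\<nu>\<in>N. \<nu> a \<noteq> 1"
    and B: "finite B" "B \<subseteq> carrier G - {\<one>}" and \<delta>: "\<delta> > 0"
  shows "\<exists>\<Lambda>. averaging N \<Lambda> \<and> (\<forall>b\<in>B. cmod (\<Lambda> (\<lambda>\<nu>. \<nu> b)) \<le> \<delta>)"
  using B
proof (induction B rule: finite_induct)
  case empty
  have "averaging N (\<lambda>f. f (\<lambda>x\<in>carrier G. 1))" using one by (auto simp: averaging_def)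
  then show ?case by blast
next
  case (insert b B)
  then obtain \<Lambda> where \<Lambda>: "averaging N \<Lambda>" and small: "\<And>b. b \<in> B \<Longrightarrow> cmod (\<Lambda> (\<lambda>\<nu>. \<nu> b)) \<le> \<delta>" by auto
  have b: "b \<in> carrier G" "b \<noteq> \<one>" using insert by auto
  then obtain \<nu> where \<nu>: "\<nu> \<in> N" "\<nu> b \<noteq> 1" using sep by blast
  have nrm: "\<mu> \<in> N \<Longrightarrow> x \<in> carrier G \<Longrightarrow> cmod (\<mu> x) = 1" for \<mu> x using N by (auto simp: char_on_def)
  have pos: "cmod (1 - \<nu> b) > 0" using \<nu> by simp
  \<comment> \<open>The geometric sum is at most \<open>2 / cmod (1 - \<nu> b)\<close>;
    \<open>L\<close> is chosen so that division by \<open>L\<close> brings this below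
    \<open>\<delta>\<close>.\<close>
  obtain L :: nat where "L > 2 / (cmod (1 - \<nu> b) * \<delta>)" using reals_Archimedean2 by blast
  then have L: "2 < real L * (cmod (1 - \<nu> b) * \<delta>)" using pos \<delta> by (simp add: field_simps)
  then have L0: "L > 0" by (intro gr0I) auto
  \<comment> \<open>Translation by the character \<open>\<nu> ^ l\<close>. The restriction to the
    carrier matters, because membership in \<open>N\<close> refers to extensional functions.\<close>
  define sh where "sh l \<mu> = (\<lambda>x\<in>carrier G. \<mu> x * \<nu> x ^ l)" for l :: nat and \<mu> :: "'a \<Rightarrow> complex"
  have shN: "sh l \<mu> \<in> N" if "\<mu> \<in> N" for l \<mu>
  proof (induction l)
    case 0
    have "(\<lambda>x\<in>carrier G. \<mu> x * (\<lambda>x\<in>carrier G. 1) x) \<in> N" using mult[OF that one] .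
    moreover have "(\<lambda>x\<in>carrier G. \<mu> x * (\<lambda>x\<in>carrier G. 1) x) = sh 0 \<mu>" by (auto simp: sh_def)
    ultimately show ?case by simp
  next
    case (Suc l)
    have "(\<lambda>x\<in>carrier G. sh l \<mu> x * \<nu> x) \<in> N" using mult[OF Suc \<nu>(1)] .
    moreover have "(\<lambda>x\<in>carrier G. sh l \<mu> x * \<nu> x) = sh (Suc l) \<mu>" by (auto simp: sh_def mult_ac)
    ultimately show ?case by simp
  qed
  define \<Lambda>' where "\<Lambda>' f = (\<Sum>l<L. \<Lambda> (\<lambda>\<mu>. f (sh l \<mu>))) / of_nat L" for f
  have "averaging N \<Lambda>'"
    unfolding averaging_def
  proof (intro conjI allI impI)
    show "\<Lambda>' (\<lambda>\<nu>. f \<nu> + g \<nu>) = \<Lambda>' f + \<Lambda>' g" for f g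
      by (simp add: \<Lambda>'_def averagingD(1)[OF \<Lambda>] sum.distrib add_divide_distrib)
    show "\<Lambda>' (\<lambda>\<nu>. c * f \<nu>) = c * \<Lambda>' f" for c f
      by (simp add: \<Lambda>'_def averagingD(2)[OF \<Lambda>] sum_distrib_left)
    show "\<Lambda>' (\<lambda>\<nu>. 1) = 1" using L0 by (simp add: \<Lambda>'_def averagingD(3)[OF \<Lambda>])
    show "\<Lambda>' f = \<Lambda>' g" if "\<forall>\<nu>\<in>N. f \<nu> = g \<nu>" for f g
    proof -
      have "\<Lambda> (\<lambda>\<mu>. f (sh l \<mu>)) = \<Lambda> (\<lambda>\<mu>. g (sh l \<mu>))" for l
        by (rule averagingD(4)[OF \<Lambda>]) (use that shN in simp)
      then show ?thesis by (simp add: \<Lambda>'_def)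
    qed
    show "cmod (\<Lambda>' f) \<le> C" if "\<forall>\<nu>\<in>N. cmod (f \<nu>) \<le> C" for C f
    proof -
      have "cmod (\<Lambda> (\<lambda>\<mu>. f (sh l \<mu>))) \<le> C" for l
        by (rule averagingD(5)[OF \<Lambda>]) (use that shN in simp)
      then have "cmod (\<Sum>l<L. \<Lambda> (\<lambda>\<mu>. f (sh l \<mu>))) \<le> of_nat (card {..<L}) * C" by (intro sum_norm_bound)
      then show ?thesis using L0 by (simp add: \<Lambda>'_def norm_divide field_simps)
    qed
  qed
  moreover have "cmod (\<Lambda>' (\<lambda>\<nu>. \<nu> b')) \<le> \<delta>" if "b' \<in> insert b B" for b'
  proof -
    have b': "b' \<in> carrier G" using that insert by auto
    have "\<Lambda> (\<lambda>\<mu>. sh l \<mu> b') = \<nu> b' ^ l * \<Lambda> (\<lambda>\<mu>. \<mu> b')" for l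
      using b' averagingD(2)[OF \<Lambda>, of "\<nu> b' ^ l" "\<lambda>\<mu>. \<mu> b'"] by (simp add: sh_def mult.commute)
    then have eq: "\<Lambda>' (\<lambda>\<nu>. \<nu> b') = (\<Sum>l<L. \<nu> b' ^ l) * \<Lambda> (\<lambda>\<mu>. \<mu> b') / of_nat L"
      by (simp add: \<Lambda>'_def sum_distrib_right)
    show ?thesis
    proof (cases "b' \<in> B")
      case True
      have "cmod (\<Sum>l<L. \<nu> b' ^ l) \<le> of_nat (card {..<L}) * 1"
        by (rule sum_norm_bound) (simp add: norm_power nrm[OF \<nu>(1) b'])
      then have "cmod (\<Sum>l<L. \<nu> b' ^ l) * cmod (\<Lambda> (\<lambda>\<mu>. \<mu> b')) \<le> L * \<delta>"
        using small[OF True] by (intro mult_mono) auto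
      then show ?thesis using L0 by (simp add: eq norm_mult norm_divide field_simps)
    next
      case False
      then have [simp]: "b' = b" using that by simp
      have 1: "cmod (\<Lambda> (\<lambda>\<mu>. \<mu> b)) \<le> 1" by (rule averagingD(5)[OF \<Lambda>]) (simp add: nrm b)
      have "(\<Sum>l<L. \<nu> b ^ l) = (1 - \<nu> b ^ L) / (1 - \<nu> b)" using \<nu> by (simp add: sum_gp_strict)
      moreover have "cmod (1 - \<nu> b ^ L) \<le> 2"
        using norm_triangle_ineq4[of 1 "\<nu> b ^ L"] by (simp add: norm_power nrm[OF \<nu>(1) b(1)])
      ultimately have "cmod (\<Sum>l<L. \<nu> b ^ l) \<le> 2 / cmod (1 - \<nu> b)"
        using pos by (simp add: norm_divide divide_right_mono)
      also have "\<dots> \<le> L * \<delta>" using L pos by (simp add: field_simps)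
      finally have "cmod (\<Sum>l<L. \<nu> b ^ l) * cmod (\<Lambda> (\<lambda>\<mu>. \<mu> b)) \<le> (L * \<delta>) * 1"
        using 1 \<delta> by (intro mult_mono) auto
      then show ?thesis using L0 eq[unfolded \<open>b' = b\<close>] unfolding \<open>b' = b\<close> by (simp add: norm_mult norm_divide pos_divide_le_eq mult_ac)
    qed
  qed
  ultimately show ?case by blast
qed

text \<open>
  If no member of \<open>N\<close> were close to \<open>\<xi>\<close> on \<open>A\<close>, then \<open>P(\<nu>) = (\<Sum>a\<in>A. cnj (\<xi> a) * \<nu> a)\<close> would be bounded on \<open>N\<close> by
  some \<open>Q < card A\<close>. Averaging isolates the coefficient in \<open>P ^ n\<close> of each of the at most \<open>(n + 1) ^ card A\<close> products
  of \<open>n\<close> elements of \<open>A\<close>, so each is at most \<open>Q ^ n\<close>; yet their sum is \<open>card A ^ n\<close>.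
\<close>

lemma separating_chars_dense:
  assumes N: "\<And>\<nu>. \<nu> \<in> N \<Longrightarrow> char_on G (carrier G) \<nu>"
    and mult: "\<And>\<mu> \<nu>. \<mu> \<in> N \<Longrightarrow> \<nu> \<in> N \<Longrightarrow> (\<lambda>x\<in>carrier G. \<mu> x * \<nu> x) \<in> N"
    and one: "(\<lambda>x\<in>carrier G. 1) \<in> N"
    and sep: "\<And>a. a \<in> carrier G \<Longrightarrow> a \<noteq> \<one> \<Longrightarrow> \<exists>\<nu>\<in>N. \<nu> a \<noteq> 1"
    and \<xi>: "char_on G (carrier G) \<xi>"
    and A0: "finite A0" "A0 \<subseteq> carrier G" and \<epsilon>: "\<epsilon> > 0"
  shows "\<exists>\<nu>\<in>N. \<forall>a\<in>A0. cmod (\<nu> a - \<xi> a) < \<epsilon>"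
proof (rule ccontr)
  assume "\<not> ?thesis"
  then have bad: "\<exists>a\<in>A0. \<epsilon> \<le> cmod (\<nu> a - \<xi> a)" if "\<nu> \<in> N" for \<nu> using that by force
  \<comment> \<open>At \<open>\<one>\<close> all characters agree, which gives the sum
    \<open>P\<close> a fixed summand \<open>1\<close>. Without such a reference point, a common
    rotation of all summands would leave \<open>cmod (P \<nu>)\<close> maximal.\<close>
  define A where "A = insert \<one> A0"
  have A: "finite A" "A \<subseteq> carrier G" "\<one> \<in> A" "card A > 0" using A0 by (auto simp: A_def card_gt_0_iff)
  have nrm: "\<mu> \<in> N \<Longrightarrow> x \<in> carrier G \<Longrightarrow> cmod (\<mu> x) = 1" for \<mu> x using N by (auto simp: char_on_def)
  have nrm\<xi>: "x \<in> carrier G \<Longrightarrow> cmod (\<xi> x) = 1" for x using \<xi> by (auto simp: char_on_def)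
  have cn: "cnj (\<xi> x) * \<xi> x = 1" if "x \<in> carrier G" for x
    using nrm\<xi>[OF that] by (simp add: complex_norm_square[symmetric] mult.commute)
  define w where "w \<nu> a = cnj (\<xi> a) * \<nu> a" for \<nu> a
  define P where "P \<nu> = (\<Sum>a\<in>A. w \<nu> a)" for \<nu>
  \<comment> \<open>The summands at \<open>\<one>\<close> and at a bad point \<open>a\<close>
    together have modulus at most \<open>sqrt (4 - \<epsilon>\<^sup>2)\<close> by the parallelogram
    law; each of the remaining \<open>card A - 2\<close> has modulus \<open>1\<close>.\<close>
  define Q where "Q = real (card A) - 2 + sqrt (4 - \<epsilon>\<^sup>2)"
  have PQ: "cmod (P \<nu>) \<le> Q" if \<nu>: "\<nu> \<in> N" for \<nu>
  proof -
    obtain a where a: "a \<in> A0" "\<epsilon> \<le> cmod (\<nu> a - \<xi> a)" using bad[OF \<nu>] by blast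
    have ac: "a \<in> carrier G" using a A0 by blast
    have \<nu>1: "\<nu> \<one> = 1" "\<xi> \<one> = 1" using char_on_one[OF subgroup_self] N[OF \<nu>] \<xi> by auto
    then have "a \<noteq> \<one>" using a \<epsilon> by auto
    have w1: "w \<nu> \<one> = 1" using \<nu>1 by (simp add: w_def)
    have wn: "cmod (w \<nu> x) = 1" if "x \<in> A" for x using that A nrm[OF \<nu>] nrm\<xi> by (auto simp: w_def norm_mult)
    have "w \<nu> a - 1 = cnj (\<xi> a) * (\<nu> a - \<xi> a)" using cn[OF ac] by (simp add: w_def algebra_simps)
    then have "\<epsilon> \<le> cmod (w \<nu> a - 1)" using a nrm\<xi>[OF ac] by (simp add: norm_mult)
    then have e2: "\<epsilon>\<^sup>2 \<le> (cmod (w \<nu> a - 1))\<^sup>2" using \<epsilon> by (intro power_mono) auto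
    have aA: "a \<in> A" using a by (simp add: A_def)
    have par: "(cmod (1 + z))\<^sup>2 + (cmod (z - 1))\<^sup>2 = 2 + 2 * (cmod z)\<^sup>2" for z
      unfolding cmod_power2 by (simp add: power2_eq_square algebra_simps)
    have "(cmod (1 + w \<nu> a))\<^sup>2 \<le> 4 - \<epsilon>\<^sup>2" using e2 par[of "w \<nu> a"] wn[OF aA] by simp
    then have s: "cmod (1 + w \<nu> a) \<le> sqrt (4 - \<epsilon>\<^sup>2)" by (rule real_le_rsqrt)
    have "P \<nu> = w \<nu> \<one> + (\<Sum>x\<in>A - {\<one>}. w \<nu> x)" unfolding P_def using A by (simp add: sum.remove)
    also have "(\<Sum>x\<in>A - {\<one>}. w \<nu> x) = w \<nu> a + (\<Sum>x\<in>A - {\<one>} - {a}. w \<nu> x)"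
      using A aA \<open>a \<noteq> \<one>\<close> by (subst sum.remove[of _ a]) auto
    finally have "P \<nu> = (1 + w \<nu> a) + (\<Sum>x\<in>A - {\<one>} - {a}. w \<nu> x)" using w1 by simp
    then have "cmod (P \<nu>) \<le> cmod (1 + w \<nu> a) + cmod (\<Sum>x\<in>A - {\<one>} - {a}. w \<nu> x)"
      using norm_triangle_ineq by simp
    also have "cmod (\<Sum>x\<in>A - {\<one>} - {a}. w \<nu> x) \<le> of_nat (card (A - {\<one>} - {a})) * 1"
      by (rule sum_norm_bound) (use wn in auto)
    also have "card (A - {\<one>} - {a}) = card A - 2" using A aA \<open>a \<noteq> \<one>\<close> by simp
    finally have "cmod (P \<nu>) \<le> sqrt (4 - \<epsilon>\<^sup>2) + real (card A - 2)" using s by simp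
    moreover have "card A \<ge> 2"
      using A aA \<open>a \<noteq> \<one>\<close> card_mono[of A "{\<one>, a}"] by simp
    ultimately show ?thesis by (simp add: Q_def of_nat_diff)
  qed
  have "Q \<ge> 0" using PQ[OF one] norm_ge_zero order_trans by blast
  have "sqrt (4 - \<epsilon>\<^sup>2) < sqrt 4" using \<epsilon> by (intro real_sqrt_less_mono) simp
  then have "Q < card A" by (simp add: Q_def)
  have main: "real (card A) ^ n \<le> (real n + 1) ^ card A * Q ^ n" for n :: nat
  proof -
    define F where "F = PiE {..<n} (\<lambda>_. A)"
    define b where "b f = finprod G f {..<n}" for f
    have finF: "finite F" unfolding F_def using A by (intro finite_PiE) auto
    have cF: "card F = card A ^ n" unfolding F_def by (simp add: card_PiE)
    have Fpi: "f \<in> {..<n} \<rightarrow> carrier G" if "f \<in> F" for f using that A by (auto simp: F_def)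
    have bc: "b f \<in> carrier G" if "f \<in> F" for f using Fpi[OF that] by (simp add: b_def)
    have Pn: "P \<nu> ^ n = (\<Sum>f\<in>F. cnj (\<xi> (b f)) * \<nu> (b f))" if \<nu>: "\<nu> \<in> N" for \<nu>
    proof -
      have "P \<nu> ^ n = (\<Prod>i<n. \<Sum>a\<in>A. w \<nu> a)" by (simp add: P_def)
      also have "\<dots> = (\<Sum>f\<in>F. \<Prod>i<n. w \<nu> (f i))" unfolding F_def using A by (intro prod_sum_PiE) auto
      also have "\<dots> = (\<Sum>f\<in>F. cnj (\<xi> (b f)) * \<nu> (b f))"
      proof (rule sum.cong[OF refl])
        fix f assume f: "f \<in> F"
        have "\<nu> (b f) = (\<Prod>i<n. \<nu> (f i))" "\<xi> (b f) = (\<Prod>i<n. \<xi> (f i))"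
          unfolding b_def using char_finprod[OF _ _ Fpi[OF f]] N[OF \<nu>] \<xi> by auto
        then show "(\<Prod>i<n. w \<nu> (f i)) = cnj (\<xi> (b f)) * \<nu> (b f)" by (simp add: w_def prod.distrib)
      qed
      finally show ?thesis .
    qed
    \<comment> \<open>A finite mean kills the other coefficients only approximately, so the bound is
      proved with an arbitrary error \<open>e\<close>, distributed over the members of
      \<open>F\<close>.\<close>
    have fibre: "real (card {f \<in> F. b f = \<beta>}) \<le> Q ^ n" if \<beta>: "\<beta> \<in> carrier G" for \<beta>
    proof (rule field_le_epsilon)
      fix e :: real assume e: "e > 0"
      define \<delta> where "\<delta> = e / (real (card F) + 1)"
      have \<delta>: "\<delta> > 0" "real (card F) * \<delta> \<le> e" using e by (auto simp: \<delta>_def field_simps)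
      define D where "D = (\<lambda>f. b f \<otimes> inv \<beta>) ` {f \<in> F. b f \<noteq> \<beta>}"
      have D1: "finite D" using finF by (simp add: D_def)
      have D2: "D \<subseteq> carrier G - {\<one>}"
      proof
        fix d assume "d \<in> D"
        then obtain f where f: "f \<in> F" "b f \<noteq> \<beta>" "d = b f \<otimes> inv \<beta>" by (auto simp: D_def)
        have "d \<noteq> \<one>" using inv_equality[of "b f" "inv \<beta>"] f bc[OF f(1)] \<beta> by auto
        then show "d \<in> carrier G - {\<one>}" using f bc[OF f(1)] \<beta> by simp
      qed
      from exists_averaging[OF N mult one sep D1 D2 \<delta>(1)]
      obtain \<Lambda> where \<Lambda>: "averaging N \<Lambda>" "\<And>d. d \<in> D \<Longrightarrow> cmod (\<Lambda> (\<lambda>\<nu>. \<nu> d)) \<le> \<delta>"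
        by blast
      \<comment> \<open>The extra factor shifts the coefficient belonging to \<open>\<beta>\<close>
        to the trivial element, where every averaging functional has value \<open>1\<close>; all
        other terms sit at points of \<open>D\<close>, where it is at most
        \<open>\<delta>\<close>.\<close>
      define g where "g \<nu> = P \<nu> ^ n * (\<nu> (inv \<beta>) * \<xi> \<beta>)" for \<nu>
      have "cmod (\<Lambda> g) \<le> Q ^ n"
      proof (rule averagingD(5)[OF \<Lambda>(1)])
        fix \<nu> assume \<nu>: "\<nu> \<in> N"
        have "cmod (P \<nu>) ^ n \<le> Q ^ n" using PQ[OF \<nu>] by (intro power_mono) auto
        then show "cmod (g \<nu>) \<le> Q ^ n" using nrm[OF \<nu>] nrm\<xi> \<beta> by (simp add: g_def norm_mult norm_power)
      qed
      define T where "T f = (cnj (\<xi> (b f)) * \<xi> \<beta>) * \<Lambda> (\<lambda>\<nu>. \<nu> (b f \<otimes> inv \<beta>))" for f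
      have "\<Lambda> g = \<Lambda> (\<lambda>\<nu>. \<Sum>f\<in>F. (cnj (\<xi> (b f)) * \<xi> \<beta>) * \<nu> (b f \<otimes> inv \<beta>))"
      proof (rule averagingD(4)[OF \<Lambda>(1)])
        fix \<nu> assume \<nu>: "\<nu> \<in> N"
        have "\<nu> (b f \<otimes> inv \<beta>) = \<nu> (b f) * \<nu> (inv \<beta>)" if "f \<in> F" for f
          using N[OF \<nu>] bc[OF that] \<beta> by (simp add: char_on_def)
        then show "g \<nu> = (\<Sum>f\<in>F. (cnj (\<xi> (b f)) * \<xi> \<beta>) * \<nu> (b f \<otimes> inv \<beta>))"
          unfolding g_def Pn[OF \<nu>] sum_distrib_right by (intro sum.cong) (simp_all add: mult_ac)
      qed
      then have "\<Lambda> g = sum T F" by (simp add: averaging_sum[OF \<Lambda>(1) finF] averagingD(2)[OF \<Lambda>(1)] T_def)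
      also have "\<dots> = sum T {f \<in> F. b f = \<beta>} + sum T {f \<in> F. b f \<noteq> \<beta>}"
        using finF by (subst sum.union_disjoint[symmetric]) (auto intro: sum.cong)
      also have "sum T {f \<in> F. b f = \<beta>} = (\<Sum>f\<in>{f \<in> F. b f = \<beta>}. 1)"
      proof (rule sum.cong[OF refl])
        fix f assume "f \<in> {f \<in> F. b f = \<beta>}"
        have "\<Lambda> (\<lambda>\<nu>. \<nu> \<one>) = \<Lambda> (\<lambda>\<nu>. 1)"
          by (rule averagingD(4)[OF \<Lambda>(1)]) (use char_on_one[OF subgroup_self] N in blast)
        then show "T f = 1" using \<open>f \<in> _\<close> \<beta> cn[OF \<beta>] averagingD(3)[OF \<Lambda>(1)] by (simp add: T_def)
      qed
      finally have Lg: "\<Lambda> g = of_nat (card {f \<in> F. b f = \<beta>}) + sum T {f \<in> F. b f \<noteq> \<beta>}" by simp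
      have "cmod (sum T {f \<in> F. b f \<noteq> \<beta>}) \<le> of_nat (card {f \<in> F. b f \<noteq> \<beta>}) * \<delta>"
      proof (rule sum_norm_bound)
        fix f assume f: "f \<in> {f \<in> F. b f \<noteq> \<beta>}"
        then have "b f \<otimes> inv \<beta> \<in> D" by (auto simp: D_def)
        then show "cmod (T f) \<le> \<delta>" using \<Lambda>(2) nrm\<xi> bc \<beta> f by (simp add: T_def norm_mult)
      qed
      also have "\<dots> \<le> real (card F) * \<delta>"
        using \<delta>(1) finF by (intro mult_right_mono) (auto intro: card_mono)
      also note \<delta>(2)
      finally have small: "cmod (sum T {f \<in> F. b f \<noteq> \<beta>}) \<le> e" .
      have "of_nat (card {f \<in> F. b f = \<beta>}) = \<Lambda> g - sum T {f \<in> F. b f \<noteq> \<beta>}" using Lg by simp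
      then have "cmod (of_nat (card {f \<in> F. b f = \<beta>})) \<le> cmod (\<Lambda> g) + cmod (sum T {f \<in> F. b f \<noteq> \<beta>})"
        using norm_triangle_ineq4[of "\<Lambda> g" "sum T {f \<in> F. b f \<noteq> \<beta>}"] by simp
      then show "real (card {f \<in> F. b f = \<beta>}) \<le> Q ^ n + e"
        using small \<open>cmod (\<Lambda> g) \<le> Q ^ n\<close> by simp
    qed
    have "card (b ` F) \<le> card ((\<lambda>e. finprod G (\<lambda>a. a [^] (e a :: nat)) A) ` PiE A (\<lambda>_. {..n}))"
    proof (rule card_mono)
      show "finite ((\<lambda>e. finprod G (\<lambda>a. a [^] (e a :: nat)) A) ` PiE A (\<lambda>_. {..n}))"
        using A by (intro finite_imageI finite_PiE) auto
      show "b ` F \<subseteq> (\<lambda>e. finprod G (\<lambda>a. a [^] (e a :: nat)) A) ` PiE A (\<lambda>_. {..n})"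
      proof (intro subsetI, elim imageE)
        fix \<beta> f assume f: "\<beta> = b f" "f \<in> F"
        then have "f \<in> {..<n} \<rightarrow> A" by (auto simp: F_def)
        from finprod_eq_powers[OF A(1,2) this] show "\<beta> \<in> (\<lambda>e. finprod G (\<lambda>a. a [^] (e a :: nat)) A) ` PiE A (\<lambda>_. {..n})"
          unfolding f(1) b_def by (elim bexE) (rule image_eqI)
      qed
    qed
    also have "\<dots> \<le> card (PiE A (\<lambda>_. {..n}))" using A by (intro card_image_le finite_PiE) auto
    also have "\<dots> = (n + 1) ^ card A" using A by (simp add: card_PiE)
    finally have cb: "card (b ` F) \<le> (n + 1) ^ card A" .
    have "real (card A) ^ n = real (card F)" by (simp add: cF)
    also have "card F = (\<Sum>\<beta>\<in>b ` F. card {f \<in> F. b f = \<beta>})"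
      using sum.group[OF finF _ subset_refl, of b "\<lambda>_. 1::nat"] finF by simp
    also have "real \<dots> \<le> (\<Sum>\<beta>\<in>b ` F. Q ^ n)"
      unfolding of_nat_sum by (rule sum_mono) (use fibre bc in auto)
    also have "\<dots> = real (card (b ` F)) * Q ^ n" by simp
    also have "\<dots> \<le> real ((n + 1) ^ card A) * Q ^ n"
      using cb \<open>Q \<ge> 0\<close> by (intro mult_right_mono) (auto simp del: of_nat_power of_nat_add)
    finally show ?thesis by (simp add: add.commute)
  qed
  obtain n :: nat where "(real n + 1) ^ card A * (Q / card A) ^ n < 1"
    using polynomial_times_geometric_lt_1[of "Q / card A" "card A"] \<open>Q \<ge> 0\<close> \<open>Q < card A\<close> A(4) by auto
  then have "(real n + 1) ^ card A * Q ^ n < real (card A) ^ n" using A(4) by (simp add: power_divide field_simps)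
  then show False using main[of n] by simp
qed

end

section \<open>Left ideals modulo the radical\<close>

(* clashes with the sum of subsets of a ring *)
no_notation Sum_Type.Plus (infixr "<+>" 65)

lemma set_add_iff: "x \<in> I <+>\<^bsub>R\<^esub> J \<longleftrightarrow> (\<exists>a\<in>I. \<exists>b\<in>J. x = a \<oplus>\<^bsub>R\<^esub> b)"
  by (auto simp: set_add_def')

context ring
begin

abbreviation principal :: "'a \<Rightarrow> 'a set"
  where "principal u \<equiv> (\<lambda>r. r \<otimes> u) ` carrier R"

lemma l_diff_distr: "a \<in> carrier R \<Longrightarrow> b \<in> carrier R \<Longrightarrow> c \<in> carrier R \<Longrightarrow> (a \<ominus> b) \<otimes> c = a \<otimes> c \<ominus> b \<otimes> c"
  by (simp add: minus_eq l_distr l_minus)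

lemma r_diff_distr: "a \<in> carrier R \<Longrightarrow> b \<in> carrier R \<Longrightarrow> c \<in> carrier R \<Longrightarrow> c \<otimes> (a \<ominus> b) = c \<otimes> a \<ominus> c \<otimes> b"
  by (simp add: minus_eq r_distr r_minus)

lemma diff_add_cancel: "a \<in> carrier R \<Longrightarrow> b \<in> carrier R \<Longrightarrow> (a \<ominus> b) \<oplus> b = a"
  by (simp add: minus_eq a_assoc l_neg)

lemma add_diff_cancel: "a \<in> carrier R \<Longrightarrow> b \<in> carrier R \<Longrightarrow> (a \<oplus> b) \<ominus> b = a"
  by (simp add: minus_eq a_assoc r_neg)

lemma left_ideal_diff: "left_ideal I R \<Longrightarrow> x \<in> I \<Longrightarrow> y \<in> I \<Longrightarrow> x \<ominus> y \<in> I"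
  unfolding minus_eq by (intro left_idealD(3)[of I] left_idealD(5)[of I])

lemma left_ideal_carrier: "left_ideal (carrier R) R"
  by (rule left_idealI) auto

lemma left_ideal_zero: "left_ideal {\<zero>} R"
  by (rule left_idealI) auto

lemma left_ideal_Int: "left_ideal I R \<Longrightarrow> left_ideal J R \<Longrightarrow> left_ideal (I \<inter> J) R"
  by (rule left_idealI) (auto dest: left_idealD)

lemma left_ideal_set_add:
  assumes I: "left_ideal I R" and J: "left_ideal J R"
  shows "left_ideal (I <+> J) R" "I \<subseteq> I <+> J" "J \<subseteq> I <+> J"
proof -
  note i = left_idealD[OF I] and j = left_idealD[OF J]
  have ic: "a \<in> I \<Longrightarrow> a \<in> carrier R" and jc: "a \<in> J \<Longrightarrow> a \<in> carrier R" for a using i(1) j(1) by auto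
  show "I \<subseteq> I <+> J"
  proof
    fix a assume "a \<in> I"
    then have "a = a \<oplus> \<zero>" using ic by simp
    then show "a \<in> I <+> J" using \<open>a \<in> I\<close> j(2) unfolding set_add_iff by blast
  qed
  show "J \<subseteq> I <+> J"
  proof
    fix a assume "a \<in> J"
    then have "a = \<zero> \<oplus> a" using jc by simp
    then show "a \<in> I <+> J" using \<open>a \<in> J\<close> i(2) unfolding set_add_iff by blast
  qed
  show "left_ideal (I <+> J) R"
  proof (rule left_idealI)
    show "I <+> J \<subseteq> carrier R" using ic jc by (auto simp: set_add_iff)
    show "\<zero> \<in> I <+> J" using \<open>I \<subseteq> I <+> J\<close> i(2) by blast
  next
    fix x y assume "x \<in> I <+> J" "y \<in> I <+> J"
    then obtain a b c d where x: "a \<in> I" "b \<in> J" "x = a \<oplus> b" and y: "c \<in> I" "d \<in> J" "y = c \<oplus> d"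
      unfolding set_add_iff by blast
    have "x \<oplus> y = (a \<oplus> c) \<oplus> (b \<oplus> d)" using x y ic jc by (simp add: a_ac)
    then show "x \<oplus> y \<in> I <+> J" using x y i(3) j(3) unfolding set_add_iff by blast
  next
    fix r x assume r: "r \<in> carrier R" and "x \<in> I <+> J"
    then obtain a b where x: "a \<in> I" "b \<in> J" "x = a \<oplus> b" unfolding set_add_iff by blast
    have "r \<otimes> x = r \<otimes> a \<oplus> r \<otimes> b" using x r ic jc by (simp add: r_distr)
    then show "r \<otimes> x \<in> I <+> J" using x r i(4) j(4) unfolding set_add_iff by blast
  qed
qed

lemma set_add_subset: "left_ideal V R \<Longrightarrow> I \<subseteq> V \<Longrightarrow> J \<subseteq> V \<Longrightarrow> I <+> J \<subseteq> V"
  unfolding set_add_iff subset_iff using left_idealD(3)[of V] by metis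

lemma finite_set_add: "finite I \<Longrightarrow> finite J \<Longrightarrow> finite (I <+> J)"
  by (simp add: set_add_def')

lemma left_ideal_image_mult:
  assumes I: "left_ideal I R" and v: "v \<in> carrier R" shows "left_ideal ((\<lambda>c. c \<otimes> v) ` I) R"
proof (rule left_idealI)
  note i = left_idealD[OF I]
  have ic: "a \<in> I \<Longrightarrow> a \<in> carrier R" for a using i(1) by auto
  show "(\<lambda>c. c \<otimes> v) ` I \<subseteq> carrier R" using ic v by auto
  show "\<zero> \<in> (\<lambda>c. c \<otimes> v) ` I" using i(2) v by (intro image_eqI[of _ _ \<zero>]) auto
  fix x y assume "x \<in> (\<lambda>c. c \<otimes> v) ` I" "y \<in> (\<lambda>c. c \<otimes> v) ` I"
  then obtain a b where "a \<in> I" "b \<in> I" "x = a \<otimes> v" "y = b \<otimes> v" by blast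
  then show "x \<oplus> y \<in> (\<lambda>c. c \<otimes> v) ` I" using ic v i(3) by (intro image_eqI[of _ _ "a \<oplus> b"]) (auto simp: l_distr)
next
  note i = left_idealD[OF I]
  fix r x assume r: "r \<in> carrier R" "x \<in> (\<lambda>c. c \<otimes> v) ` I"
  then obtain a where "a \<in> I" "x = a \<otimes> v" by blast
  then show "r \<otimes> x \<in> (\<lambda>c. c \<otimes> v) ` I" using i(1,4) v r by (intro image_eqI[of _ _ "r \<otimes> a"]) (auto simp: m_assoc)
qed

lemma left_ideal_preimage_mult:
  assumes V: "left_ideal V R" and v: "v \<in> carrier R" shows "left_ideal {r \<in> carrier R. r \<otimes> v \<in> V} R"
  using left_idealD[OF V] v by (intro left_idealI) (auto simp: l_distr m_assoc)

definition annihilator :: "'a \<Rightarrow> 'a set" where "annihilator v = {r \<in> carrier R. r \<otimes> v = \<zero>}"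

lemma left_ideal_annihilator: "v \<in> carrier R \<Longrightarrow> left_ideal (annihilator v) R"
  using left_ideal_preimage_mult[OF left_ideal_zero] by (simp add: annihilator_def)

lemma principal_left_ideal:
  assumes "v \<in> carrier R"
  shows "left_ideal (principal v) R" "v \<in> principal v"
  using left_ideal_image_mult[OF left_ideal_carrier assms] assms by (auto intro: image_eqI[of _ _ \<one>])

lemma principal_subset: "left_ideal V R \<Longrightarrow> v \<in> V \<Longrightarrow> principal v \<subseteq> V"
  using left_idealD(4) by blast

lemma left_ideal_one: "left_ideal I R \<Longrightarrow> \<one> \<in> I \<Longrightarrow> I = carrier R"
  using left_idealD(1)[of I] left_idealD(4)[of I _ \<one>] by force

section \<open>Minimal left ideals and the finitary socle\<close>

lemma min_idealD:
  assumes "minimal_left_ideal L R"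
  shows "left_ideal L R" "L \<noteq> {\<zero>}" "\<And>I. left_ideal I R \<Longrightarrow> I \<subseteq> L \<Longrightarrow> I = {\<zero>} \<or> I = L"
  using assms unfolding minimal_left_ideal_def by auto

lemma minimal_left_ideal_Int:
  assumes "minimal_left_ideal L R" "left_ideal V R" "\<not> L \<subseteq> V" shows "V \<inter> L = {\<zero>}"
  using min_idealD(3)[OF assms(1) left_ideal_Int[OF assms(2) min_idealD(1)[OF assms(1)]]] assms(3)
  by blast

lemma left_ideal_nonzero: "left_ideal V R \<Longrightarrow> V \<noteq> {\<zero>} \<Longrightarrow> \<exists>x\<in>V. x \<noteq> \<zero>"
  using left_idealD(2) by blast

lemma left_ideal_finsum:
  assumes "left_ideal V R" "finite F" "\<And>i. i \<in> F \<Longrightarrow> x i \<in> V" shows "finsum R x F \<in> V"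
  using assms(2,3)
proof (induction F rule: finite_induct)
  case empty then show ?case using left_idealD(2)[OF assms(1)] by simp
next
  case (insert i F)
  have "x \<in> F \<rightarrow> carrier R" "x i \<in> carrier R" using insert left_idealD(1)[OF assms(1)] by auto
  then show ?case using insert left_idealD(3)[OF assms(1)] by simp
qed

text \<open>For nonzero \<open>x\<close> in \<open>L\<close>, multiplication onto \<open>x\<close>
  identifies \<open>L\<close> with the quotient of \<open>R\<close> by \<open>annihilator x\<close>;
  simplicity of \<open>L\<close> makes this annihilator maximal, so it contains the radical.\<close>

lemma radical_annihilates_minimal:
  assumes L: "minimal_left_ideal L R" and r: "r \<in> jacobson_radical R" and x: "x \<in> L"
  shows "r \<otimes> x = \<zero>"
proof (cases "x = \<zero>")
  case True then show ?thesis using r by (simp add: jacobson_radical_def)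
next
  case False
  have xc: "x \<in> carrier R" using x left_idealD(1)[OF min_idealD(1)[OF L]] by blast
  have "maximal_left_ideal (annihilator x) R"
    unfolding maximal_left_ideal_def
  proof (intro conjI allI impI left_ideal_annihilator xc)
    have "\<one> \<notin> annihilator x" using False xc by (simp add: annihilator_def)
    then show "annihilator x \<noteq> carrier R" by auto
    fix I assume I: "left_ideal I R \<and> annihilator x \<subseteq> I"
    have Ic: "I \<subseteq> carrier R" using left_idealD(1) I by blast
    have "(\<lambda>c. c \<otimes> x) ` I = {\<zero>} \<or> (\<lambda>c. c \<otimes> x) ` I = L"
    proof (rule min_idealD(3)[OF L left_ideal_image_mult])
      show "(\<lambda>c. c \<otimes> x) ` I \<subseteq> L" using left_idealD(4)[OF min_idealD(1)[OF L] _ x] Ic by blast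
    qed (use I xc in auto)
    then show "I = annihilator x \<or> I = carrier R"
    proof
      assume "(\<lambda>c. c \<otimes> x) ` I = {\<zero>}"
      then have "I \<subseteq> annihilator x" using Ic by (auto simp: annihilator_def)
      then show ?thesis using I by blast
    next
      assume "(\<lambda>c. c \<otimes> x) ` I = L"
      \<comment> \<open>If \<open>I\<close> already reaches all of \<open>L\<close>, it reaches
        \<open>x\<close> itself, and then \<open>\<one> \<ominus> i\<close> annihilates
        \<open>x\<close> and so lies in \<open>I\<close>.\<close>
      then obtain i where i: "i \<in> I" "x = i \<otimes> x" using x by blast
      have ic: "i \<in> carrier R" using i Ic by blast
      have "(\<one> \<ominus> i) \<otimes> x = x \<ominus> i \<otimes> x" using ic xc by (simp add: l_diff_distr)
      also have "\<dots> = \<zero>" using i(2)[symmetric] xc by (simp add: minus_eq r_neg)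
      finally have "\<one> \<ominus> i \<in> I" using I ic by (auto simp: annihilator_def)
      then have "(\<one> \<ominus> i) \<oplus> i \<in> I" using I i left_idealD(3) by blast
      then have "\<one> \<in> I" using ic by (simp add: diff_add_cancel)
      then show ?thesis using I left_ideal_one by blast
    qed
  qed
  then have "r \<in> annihilator x" using r by (simp add: jacobson_radical_def)
  then show ?thesis by (simp add: annihilator_def)
qed

text \<open>The sum of the given ideals. Its leastness is what later places it inside the finitary
  socle.\<close>

lemma finite_left_ideal_containing:
  assumes "finite F" "\<And>L. L \<in> F \<Longrightarrow> minimal_left_ideal L R \<and> finite L"
  shows "\<exists>W. left_ideal W R \<and> finite W \<and> (\<forall>L\<in>F. L \<subseteq> W) \<and>
    (\<forall>V. left_ideal V R \<longrightarrow> (\<forall>L\<in>F. L \<subseteq> V) \<longrightarrow> W \<subseteq> V)"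
  using assms
proof (induction F rule: finite_induct)
  case empty
  show ?case by (intro exI[of _ "{\<zero>}"]) (auto simp: left_ideal_zero left_idealD(2))
next
  case (insert L F)
  then obtain W where W: "left_ideal W R" "finite W" "\<forall>L\<in>F. L \<subseteq> W"
    "\<forall>V. left_ideal V R \<longrightarrow> (\<forall>L\<in>F. L \<subseteq> V) \<longrightarrow> W \<subseteq> V" by auto
  have L: "left_ideal L R" "finite L" using insert min_idealD(1) by auto
  note s = left_ideal_set_add[OF L(1) W(1)]
  show ?case
  proof (intro exI[of _ "L <+> W"] conjI allI impI)
    show "finite (L <+> W)" using L W by (intro finite_set_add)
    show "\<forall>M\<in>insert L F. M \<subseteq> L <+> W" using s W(3) by blast
    fix V assume "left_ideal V R" "\<forall>M\<in>insert L F. M \<subseteq> V"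
    then show "L <+> W \<subseteq> V" using set_add_subset[of V L W] W(4) by simp
  qed (rule s(1))
qed

lemma minimal_subset_socle:
  assumes "minimal_left_ideal L R" "finite L" shows "L \<subseteq> finitary_left_socle R"
proof
  fix x assume x: "x \<in> L"
  then have "x \<in> carrier R" using left_idealD(1)[OF min_idealD(1)[OF assms(1)]] by blast
  then have "x = finsum R (\<lambda>_. x) {L}" by simp
  then show "x \<in> finitary_left_socle R" using assms x
    unfolding finitary_left_socle_def by (intro CollectI exI[of _ "\<lambda>_. x"] exI[of _ "{L}"]) auto
qed

lemma socle_subset:
  assumes V: "left_ideal V R" and sub: "\<And>L. minimal_left_ideal L R \<Longrightarrow> finite L \<Longrightarrow> L \<subseteq> V"
  shows "finitary_left_socle R \<subseteq> V"
proof
  fix u assume "u \<in> finitary_left_socle R"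
  then obtain x F where F: "u = finsum R x F" "finite F" "F \<subseteq> {L. minimal_left_ideal L R \<and> finite L}" "\<forall>L\<in>F. x L \<in> L"
    unfolding finitary_left_socle_def by blast
  have "x L \<in> V" if "L \<in> F" for L
  proof -
    have "L \<subseteq> V" using F(3) that sub by blast
    then show ?thesis using F(4) that by blast
  qed
  then show "u \<in> V" unfolding F(1) by (rule left_ideal_finsum[OF V F(2)])
qed

lemma radical_annihilates_socle:
  assumes r: "r \<in> jacobson_radical R" and u: "u \<in> finitary_left_socle R"
  shows "r \<otimes> u = \<zero>"
proof -
  have rc: "r \<in> carrier R" using r by (simp add: jacobson_radical_def)
  obtain x F where F: "u = finsum R x F" "finite F" "F \<subseteq> {L. minimal_left_ideal L R \<and> finite L}" "\<forall>L\<in>F. x L \<in> L"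
    using u unfolding finitary_left_socle_def by blast
  have xF: "x L \<in> carrier R" "r \<otimes> x L = \<zero>" if "L \<in> F" for L
    using radical_annihilates_minimal[of L r "x L"] left_idealD(1)[OF min_idealD(1)[of L]] F(3,4) that r by auto
  have "r \<otimes> u = finsum R (\<lambda>L. r \<otimes> x L) F"
    unfolding F(1) using rc F(2) xF by (intro finsum_rdistr) auto
  also have "\<dots> = finsum R (\<lambda>L. \<zero>) F" using xF by (intro add.finprod_cong') auto
  finally show ?thesis by simp
qed

text \<open>Local finiteness of the socle: only finitely many finite summands are involved in one
  element. It makes principal left ideals inside the socle finite.\<close>

lemma finite_left_ideal_in_socle:
  assumes "u \<in> finitary_left_socle R"
  shows "\<exists>W. left_ideal W R \<and> finite W \<and> u \<in> W"
proof -
  obtain x F where F: "u = finsum R x F" "finite F" "F \<subseteq> {L. minimal_left_ideal L R \<and> finite L}" "\<forall>L\<in>F. x L \<in> L"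
    using assms unfolding finitary_left_socle_def by blast
  obtain W where W: "left_ideal W R" "finite W" "\<forall>L\<in>F. L \<subseteq> W"
    using finite_left_ideal_containing[OF F(2)] F(3) by blast
  then have "u \<in> W" unfolding F(1) using F(2,4) by (intro left_ideal_finsum) auto
  with W show ?thesis by blast
qed

lemma coset_eq_iff:
  assumes J: "left_ideal J R" and ab: "a \<in> carrier R" "b \<in> carrier R"
  shows "J +> a = J +> b \<longleftrightarrow> a \<ominus> b \<in> J"
proof -
  interpret abelian_subgroup J R
    using J by (intro abelian_subgroupI3 abelian_group_axioms) (simp add: left_ideal_def)
  show ?thesis
  proof
    assume "J +> a = J +> b"
    then have "a \<in> J +> b" using a_rcos_self[OF ab(1)] by simp
    then obtain j where "j \<in> J" "a = j \<oplus> b" by (auto simp: a_r_coset_def')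
    then show "a \<ominus> b \<in> J" using ab left_idealD(1)[OF J] by (auto simp: add_diff_cancel)
  next
    assume j: "a \<ominus> b \<in> J"
    have "a = (a \<ominus> b) \<oplus> b" using ab by (simp add: diff_add_cancel)
    then have "a \<in> J +> b" using j by (auto simp: a_r_coset_def')
    then show "J +> a = J +> b" using a_repr_independence[OF _ ab(2) a_subgroup] by metis
  qed
qed

text \<open>A choice of coset representatives turns an embedding into a map to \<open>R\<close> that
  is additive, linear and injective up to \<open>J\<close>, so that later arguments compute with
  ring elements only.\<close>

lemma embeds_in_quotient_iff:
  assumes J: "left_ideal J R" and V: "left_ideal V R"
  shows "left_module_embeds R (left_ideal_module R V) (left_quotient_module R J) \<longleftrightarrow>
    (\<exists>g\<in>V \<rightarrow> carrier R. (\<forall>s\<in>V. \<forall>t\<in>V. g (s \<oplus> t) \<ominus> (g s \<oplus> g t) \<in> J) \<and>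
      (\<forall>r\<in>carrier R. \<forall>s\<in>V. g (r \<otimes> s) \<ominus> r \<otimes> g s \<in> J) \<and> (\<forall>s\<in>V. \<forall>t\<in>V. g s \<ominus> g t \<in> J \<longrightarrow> s = t))"
    (is "?E \<longleftrightarrow> (\<exists>g\<in>V \<rightarrow> carrier R. ?P g)")
proof -
  interpret abelian_subgroup J R
    using J by (intro abelian_subgroupI3 abelian_group_axioms) (simp add: left_ideal_def)
  let ?M = "left_ideal_module R V" and ?Q = "left_quotient_module R J"
  note v = left_idealD[OF V] and j = left_idealD[OF J]
  have Msimps: "carrier ?M = V" "(\<oplus>\<^bsub>?M\<^esub>) = (\<oplus>)" "(\<odot>\<^bsub>?M\<^esub>) = (\<otimes>)"
    by (auto simp: left_ideal_module_def left_regular_module_def)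
  have car: "carrier ?Q = {J +> a | a. a \<in> carrier R}"
    by (auto simp: left_quotient_module_def A_RCOSETS_def RCOSETS_def a_r_coset_def)
  have add: "(J +> a) \<oplus>\<^bsub>?Q\<^esub> (J +> b) = J +> (a \<oplus> b)" if "a \<in> carrier R" "b \<in> carrier R" for a b
    using that by (simp add: left_quotient_module_def a_rcos_sum)
  have smult: "r \<odot>\<^bsub>?Q\<^esub> (J +> a) = J +> (r \<otimes> a)" if r: "r \<in> carrier R" and a: "a \<in> carrier R" for r a
  proof -
    have "J +> (r \<otimes> b) = J +> (r \<otimes> a)" if b: "b \<in> J +> a" for b
    proof -
      obtain i where i: "i \<in> J" "b = i \<oplus> a" using b by (auto simp: a_r_coset_def')
      have ic: "i \<in> carrier R" using i j(1) by blast
      have "r \<otimes> b \<ominus> r \<otimes> a = r \<otimes> i" using i r a ic by (simp add: r_distr add_diff_cancel)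
      then show ?thesis using coset_eq_iff[OF J, of "r \<otimes> b" "r \<otimes> a"] j(4)[OF r i(1)] r a i ic by simp
    qed
    then have "(\<Union>b\<in>J +> a. J +> (r \<otimes> b)) = (\<Union>b\<in>J +> a. J +> (r \<otimes> a))"
      by (intro SUP_cong refl)
    moreover have "J +> a \<noteq> {}" using a_rcos_self[OF a] by blast
    ultimately show ?thesis unfolding left_quotient_module_def by simp
  qed
  have key: "f \<in> left_module_hom R ?M ?Q \<and> inj_on f V \<longleftrightarrow> ?P g"
    if f: "\<And>s. s \<in> V \<Longrightarrow> f s = J +> g s" and g: "g \<in> V \<rightarrow> carrier R" for f g
  proof -
    have gc: "\<And>s. s \<in> V \<Longrightarrow> g s \<in> carrier R" using g by blast
    have "f \<in> carrier ?M \<rightarrow> carrier ?Q" using f gc unfolding Msimps car by blast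
    moreover have "f (s \<oplus> t) = f s \<oplus>\<^bsub>?Q\<^esub> f t \<longleftrightarrow> g (s \<oplus> t) \<ominus> (g s \<oplus> g t) \<in> J" if "s \<in> V" "t \<in> V" for s t
      using that v(3)[OF that] f gc by (simp add: add coset_eq_iff[OF J])
    moreover have "f (r \<otimes> s) = r \<odot>\<^bsub>?Q\<^esub> f s \<longleftrightarrow> g (r \<otimes> s) \<ominus> r \<otimes> g s \<in> J" if "r \<in> carrier R" "s \<in> V" for r s
      using that v(4)[OF that] f gc by (simp add: smult coset_eq_iff[OF J])
    moreover have "f s = f t \<longleftrightarrow> g s \<ominus> g t \<in> J" if "s \<in> V" "t \<in> V" for s t
      using that f gc by (simp add: coset_eq_iff[OF J])
    ultimately show ?thesis unfolding left_module_hom_def inj_on_def Msimps by auto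
  qed
  show ?thesis
  proof
    assume ?E
    then obtain f where f: "f \<in> left_module_hom R ?M ?Q" "inj_on f V"
      by (auto simp: left_module_embeds_def Msimps)
    then have "\<forall>s\<in>V. \<exists>a. a \<in> carrier R \<and> f s = J +> a" unfolding left_module_hom_def Msimps car by blast
    then obtain g where g: "\<And>s. s \<in> V \<Longrightarrow> g s \<in> carrier R" "\<And>s. s \<in> V \<Longrightarrow> f s = J +> g s" by metis
    then have gV: "g \<in> V \<rightarrow> carrier R" by blast
    have "?P g" by (rule key[OF g(2) gV, THEN iffD1]) (use f in simp_all)
    then show "\<exists>g\<in>V \<rightarrow> carrier R. ?P g" using gV by (rule bexI)
  next
    assume "\<exists>g\<in>V \<rightarrow> carrier R. ?P g"
    then obtain g where g: "?P g" "g \<in> V \<rightarrow> carrier R" by (rule bexE)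
    have "(\<lambda>s. J +> g s) \<in> left_module_hom R ?M ?Q \<and> inj_on (\<lambda>s. J +> g s) V"
      using key[of "\<lambda>s. J +> g s" g, OF refl g(2)] g(1) by (rule iffD2)
    then show ?E unfolding left_module_embeds_def Msimps by (elim conjE) (rule bexI)
  qed
qed

end

section \<open>Semisimplicity modulo the radical\<close>

locale left_artinian_ring = ring R for R (structure) +
  assumes artinian: "left_artinian R"
begin

text \<open>The chain condition in its minimum form: in a family without minimal member, dependent
  choice would build a strictly descending sequence.\<close>

lemma exists_minimal_in_family:
  assumes "I0 \<in> \<F>" "\<And>I. I \<in> \<F> \<Longrightarrow> left_ideal I R"
  shows "\<exists>I\<in>\<F>. \<forall>J\<in>\<F>. J \<subseteq> I \<longrightarrow> J = I"
proof (rule ccontr)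
  assume "\<not> ?thesis"
  then have step: "\<exists>J. J \<in> \<F> \<and> J \<subset> I" if "I \<in> \<F>" for I using that by blast
  have "\<exists>f. \<forall>n. f n \<in> \<F> \<and> f (Suc n) \<subset> f n"
    by (rule dependent_nat_choice[of "\<lambda>_ I. I \<in> \<F>" "\<lambda>_ I J. J \<subset> I"]) (use assms(1) step in auto)
  then obtain f :: "nat \<Rightarrow> 'a set" where f0: "\<forall>n. f n \<in> \<F> \<and> f (Suc n) \<subset> f n" by (rule exE)
  then have f: "\<And>n. f n \<in> \<F>" "\<And>n. f (Suc n) \<subset> f n" by simp_all
  have "\<forall>n. left_ideal (f n) R \<and> f (Suc n) \<subseteq> f n" using f assms(2) by (simp add: psubset_imp_subset)
  with artinian have "\<exists>m. \<forall>n\<ge>m. f n = f m" unfolding left_artinian_def by simp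
  then obtain m where m: "\<forall>n\<ge>m. f n = f m" by (rule exE)
  have "f (Suc m) = f m" by (rule m[rule_format]) simp
  then show False using f(2)[of m] by blast
qed

lemma contains_minimal_left_ideal:
  assumes "left_ideal V R" "V \<noteq> {\<zero>}"
  shows "\<exists>L. minimal_left_ideal L R \<and> L \<subseteq> V"
proof -
  define \<F> where "\<F> = {L. left_ideal L R \<and> L \<subseteq> V \<and> L \<noteq> {\<zero>}}"
  have "V \<in> \<F>" using assms by (simp add: \<F>_def)
  then have "\<exists>L\<in>\<F>. \<forall>J\<in>\<F>. J \<subseteq> L \<longrightarrow> J = L" by (rule exists_minimal_in_family) (simp add: \<F>_def)
  then obtain L where min: "\<forall>J\<in>\<F>. J \<subseteq> L \<longrightarrow> J = L" and "L \<in> \<F>" by (rule bexE)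
  then have L: "left_ideal L R" "L \<subseteq> V" "L \<noteq> {\<zero>}" by (simp_all add: \<F>_def)
  have "J = {\<zero>} \<or> J = L" if J: "left_ideal J R" "J \<subseteq> L" for J
  proof (cases "J = {\<zero>}")
    case False
    then have "J \<in> \<F>" using J L(2) by (simp add: \<F>_def)
    then show ?thesis using min J(2) by simp
  qed simp
  then have "minimal_left_ideal L R" using L by (simp add: minimal_left_ideal_def)
  then show ?thesis using L(2) by blast
qed

abbreviation "Rad \<equiv> jacobson_radical R"

abbreviation "embeds_mod_rad V \<equiv> left_module_embeds R (left_ideal_module R V) (left_quotient_module R Rad)"

text \<open>A supplement \<open>C\<close> of \<open>K\<close> that is minimal among those above the
  radical is a complement: an element of \<open>C \<inter> K\<close> outside the radical is missed
  by some maximal \<open>M\<close>, and \<open>C \<inter> M\<close> would be a smaller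
  supplement.\<close>

lemma exists_complement_mod_radical:
  assumes K: "left_ideal K R" "Rad \<subseteq> K"
  shows "\<exists>C. left_ideal C R \<and> Rad \<subseteq> C \<and> C <+> K = carrier R \<and> C \<inter> K = Rad"
proof -
  have Kc: "K \<subseteq> carrier R" using left_idealD(1)[OF K(1)] .
  have radc: "Rad \<subseteq> carrier R" by (auto simp: jacobson_radical_def)
  define \<F> where "\<F> = {C. left_ideal C R \<and> Rad \<subseteq> C \<and> carrier R \<subseteq> C <+> K}"
  have "carrier R \<in> \<F>"
    using left_ideal_carrier radc left_ideal_set_add(2)[OF left_ideal_carrier K(1)] by (simp add: \<F>_def)
  then have "\<exists>C\<in>\<F>. \<forall>J\<in>\<F>. J \<subseteq> C \<longrightarrow> J = C" by (rule exists_minimal_in_family) (simp add: \<F>_def)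
  then obtain C where min0: "\<forall>J\<in>\<F>. J \<subseteq> C \<longrightarrow> J = C" and "C \<in> \<F>" by (rule bexE)
  then have C: "left_ideal C R" "Rad \<subseteq> C" "carrier R \<subseteq> C <+> K" by (simp_all add: \<F>_def)
  have min: "\<And>J. left_ideal J R \<Longrightarrow> Rad \<subseteq> J \<Longrightarrow> carrier R \<subseteq> J <+> K \<Longrightarrow> J \<subseteq> C \<Longrightarrow> J = C"
    using min0 by (simp add: \<F>_def)
  have Cc: "C \<subseteq> carrier R" using left_idealD(1)[OF C(1)] .
  have "C \<inter> K \<subseteq> Rad"
  proof (rule ccontr)
    assume "\<not> C \<inter> K \<subseteq> Rad"
    then obtain y where y: "y \<in> C" "y \<in> K" "y \<notin> Rad" by blast
    have yc: "y \<in> carrier R" using y Cc by blast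
    obtain M where M: "maximal_left_ideal M R" "y \<notin> M" using y yc by (auto simp: jacobson_radical_def)
    have Mi: "left_ideal M R" using M by (simp add: maximal_left_ideal_def)
    have Mc: "M \<subseteq> carrier R" using left_idealD(1)[OF Mi] .
    let ?Y = "principal y"
    note Y = principal_left_ideal[OF yc]
    have "left_ideal (M <+> ?Y) R" "M \<subseteq> M <+> ?Y" "?Y \<subseteq> M <+> ?Y" using left_ideal_set_add[OF Mi Y(1)] by auto
    moreover have "M <+> ?Y \<noteq> M" using calculation(3) Y(2) M(2) by blast
    ultimately have MY: "M <+> ?Y = carrier R" using M(1) unfolding maximal_left_ideal_def by blast
    have "C \<inter> M = C"
    proof (rule min)
      show "left_ideal (C \<inter> M) R" using C(1) Mi by (rule left_ideal_Int)
      show "Rad \<subseteq> C \<inter> M" using C(2) M(1) by (auto simp: jacobson_radical_def)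
      show "carrier R \<subseteq> (C \<inter> M) <+> K"
      proof
        fix r assume "r \<in> carrier R"
        then have "r \<in> C <+> K" using C(3) by (rule rev_subsetD)
        then obtain c k where ck: "c \<in> C" "k \<in> K" "r = c \<oplus> k" unfolding set_add_iff by (elim bexE)
        have "c \<in> M <+> ?Y" unfolding MY using ck(1) Cc by (rule rev_subsetD)
        \<comment> \<open>The modular law by elements: as \<open>y\<close> lies in \<open>C\<close>,
          so does \<open>m = c \<ominus> s \<otimes> y\<close>; as \<open>y\<close> lies in
          \<open>K\<close> too, the removed part \<open>s \<otimes> y\<close> can be moved to the
          summand from \<open>K\<close>.\<close>
        then obtain m s where ms: "m \<in> M" "s \<in> carrier R" "c = m \<oplus> s \<otimes> y" unfolding set_add_iff by (elim bexE imageE) simp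
        have mc: "m \<in> carrier R" "k \<in> carrier R" using ms Mc ck Kc by auto
        have "m = c \<ominus> s \<otimes> y" using mc ms yc by (simp add: add_diff_cancel)
        then have "m \<in> C" using left_ideal_diff[OF C(1) ck(1) left_idealD(4)[OF C(1) ms(2) y(1)]] by simp
        moreover have "s \<otimes> y \<oplus> k \<in> K" using left_idealD(3)[OF K(1) left_idealD(4)[OF K(1) ms(2) y(2)] ck(2)] .
        moreover have "r = m \<oplus> (s \<otimes> y \<oplus> k)" using ck ms mc yc by (simp add: a_assoc)
        ultimately show "r \<in> (C \<inter> M) <+> K" using ms(1) unfolding set_add_iff by (intro bexI IntI)
      qed
    qed auto
    then show False using y(1) M(2) by blast
  qed
  moreover have "Rad \<subseteq> C \<inter> K" using C(2) K(2) by blast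
  moreover have "C <+> K = carrier R"
    using C(3) set_add_subset[OF left_ideal_carrier Cc Kc] by blast
  ultimately show ?thesis using C(1,2) by blast
qed

text \<open>Being killed by the radical makes \<open>V\<close> semisimple. A complement in
  \<open>R\<close> is carried into \<open>V\<close> by multiplication with an element outside
  \<open>V'\<close>, and a minimal left ideal is taken in its image.\<close>

lemma exists_minimal_disjoint:
  assumes V: "left_ideal V R" "\<And>r v. r \<in> Rad \<Longrightarrow> v \<in> V \<Longrightarrow> r \<otimes> v = \<zero>"
    and V': "left_ideal V' R" "V' \<subset> V"
  shows "\<exists>L. minimal_left_ideal L R \<and> L \<subseteq> V \<and> V' \<inter> L = {\<zero>}"
proof -
  obtain v where v: "v \<in> V" "v \<notin> V'" using V'(2) by blast
  have vc: "v \<in> carrier R" using v left_idealD(1)[OF V(1)] by blast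
  \<comment> \<open>With \<open>C\<close> a complement of \<open>K\<close>, the left ideal
    \<open>C \<otimes> v\<close> meets \<open>V'\<close> in zero since \<open>C \<inter> K\<close>
    is the radical, and it is nonzero: writing \<open>\<one> = c \<oplus> k\<close>, otherwise
    \<open>v = k \<otimes> v\<close> would lie in \<open>V'\<close>.\<close>
  define K where "K = {r \<in> carrier R. r \<otimes> v \<in> V'}"
  have K: "left_ideal K R" unfolding K_def by (rule left_ideal_preimage_mult[OF V'(1) vc])
  have "Rad \<subseteq> K" using V(2)[OF _ v(1)] left_idealD(2)[OF V'(1)] by (auto simp: K_def jacobson_radical_def)
  then obtain C where C: "left_ideal C R" "C <+> K = carrier R" "C \<inter> K = Rad"
    using exists_complement_mod_radical[OF K] by blast
  have Cc: "C \<subseteq> carrier R" using left_idealD(1)[OF C(1)] .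
  let ?W = "(\<lambda>c. c \<otimes> v) ` C"
  have W: "left_ideal ?W R" by (rule left_ideal_image_mult[OF C(1) vc])
  have WV: "?W \<subseteq> V" using left_idealD(4)[OF V(1) _ v(1)] Cc by blast
  have disj: "?W \<inter> V' \<subseteq> {\<zero>}"
  proof
    fix x assume "x \<in> ?W \<inter> V'"
    then obtain c where c: "c \<in> C" "x = c \<otimes> v" "x \<in> V'" by blast
    then have "c \<in> C \<inter> K" using Cc by (auto simp: K_def)
    then show "x \<in> {\<zero>}" using C(3) V(2)[OF _ v(1)] c by auto
  qed
  have "?W \<noteq> {\<zero>}"
  proof
    assume W0: "?W = {\<zero>}"
    have "\<one> \<in> C <+> K" using C(2) by simp
    then obtain c k where ck: "c \<in> C" "k \<in> K" "\<one> = c \<oplus> k" unfolding set_add_iff by blast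
    have "c \<otimes> v = \<zero>" using W0 ck(1) by blast
    moreover have "c \<in> carrier R" "k \<in> carrier R" "k \<otimes> v \<in> V'" using ck Cc by (auto simp: K_def)
    moreover have "v = (c \<oplus> k) \<otimes> v" using vc by (simp add: ck(3)[symmetric])
    ultimately have "v = k \<otimes> v" using vc by (simp add: l_distr)
    then show False using v(2) \<open>k \<otimes> v \<in> V'\<close> by simp
  qed
  then obtain L where L: "minimal_left_ideal L R" "L \<subseteq> ?W" using contains_minimal_left_ideal[OF W] by blast
  moreover have "\<zero> \<in> V' \<inter> L" using left_idealD(2)[OF V'(1)] left_idealD(2)[OF min_idealD(1)[OF L(1)]] by blast
  ultimately show ?thesis using WV disj by blast
qed

text \<open>A cyclic \<open>S\<close> is the quotient of \<open>R\<close> by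
  \<open>annihilator u\<close>, and a complement \<open>C\<close> of this annihilator modulo the
  radical satisfies \<open>C / Rad \<cong> S\<close>. The embedding sends \<open>s\<close> to an
  element of \<open>C\<close> that carries \<open>u\<close> to \<open>s\<close>.\<close>

lemma cyclic_imp_embeds:
  assumes S: "left_ideal S R" and u: "u \<in> S" "S = principal u"
    and rad: "\<And>r. r \<in> Rad \<Longrightarrow> r \<otimes> u = \<zero>"
  shows "embeds_mod_rad S"
proof -
  have uc: "u \<in> carrier R" using u(1) left_idealD(1)[OF S] by blast
  let ?K = "annihilator u"
  have K: "left_ideal ?K R" by (rule left_ideal_annihilator[OF uc])
  have "Rad \<subseteq> ?K" using rad by (auto simp: annihilator_def jacobson_radical_def)
  then obtain C where C: "left_ideal C R" "C <+> ?K = carrier R" "C \<inter> ?K = Rad"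
    using exists_complement_mod_radical[OF K] by blast
  have Cc: "C \<subseteq> carrier R" using left_idealD(1)[OF C(1)] .
  have "\<exists>c. c \<in> C \<and> c \<otimes> u = s" if "s \<in> S" for s
  proof -
    obtain r where r: "r \<in> carrier R" "s = r \<otimes> u" using \<open>s \<in> S\<close> u(2) by blast
    then have "r \<in> C <+> ?K" using C(2) by simp
    then obtain c k where ck: "c \<in> C" "k \<in> ?K" "r = c \<oplus> k" unfolding set_add_iff by blast
    then have "c \<otimes> u = s" using r Cc uc by (auto simp: annihilator_def l_distr)
    then show ?thesis using ck(1) by blast
  qed
  then obtain g where g: "\<And>s. s \<in> S \<Longrightarrow> g s \<in> C" "\<And>s. s \<in> S \<Longrightarrow> g s \<otimes> u = s" by metis
  have gc: "\<And>s. s \<in> S \<Longrightarrow> g s \<in> carrier R" using g(1) Cc by blast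
  have Sc: "\<And>s. s \<in> S \<Longrightarrow> s \<in> carrier R" using left_idealD(1)[OF S] by blast
  show ?thesis
    unfolding embeds_in_quotient_iff[OF left_ideal_jacobson_radical S]
  proof (intro bexI[of _ g] conjI ballI impI)
    show "g \<in> S \<rightarrow> carrier R" using gc by blast
    fix s assume s: "s \<in> S"
    show "g (r \<otimes> s) \<ominus> r \<otimes> g s \<in> Rad" if r: "r \<in> carrier R" for r
    proof -
      have rs: "r \<otimes> s \<in> S" using left_idealD(4)[OF S r s] .
      \<comment> \<open>A defect of linearity stays in \<open>C\<close> and annihilates
        \<open>u\<close>, so it falls into \<open>C \<inter> ?K\<close>, the radical. Additivity is
        handled likewise.\<close>
      have "g (r \<otimes> s) \<ominus> r \<otimes> g s \<in> C"
        using left_ideal_diff[OF C(1) g(1)[OF rs] left_idealD(4)[OF C(1) r g(1)[OF s]]] .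
      moreover have "(g (r \<otimes> s) \<ominus> r \<otimes> g s) \<otimes> u = \<zero>"
        using gc[OF rs] gc[OF s] r uc g(2)[OF rs] g(2)[OF s] Sc[OF s] by (simp add: l_diff_distr m_assoc)
      ultimately show ?thesis unfolding C(3)[symmetric] annihilator_def using gc[OF rs] gc[OF s] r by simp
    qed
    fix t assume t: "t \<in> S"
    have st: "s \<oplus> t \<in> S" using left_idealD(3)[OF S s t] .
    have "g (s \<oplus> t) \<ominus> (g s \<oplus> g t) \<in> C"
      using left_ideal_diff[OF C(1) g(1)[OF st] left_idealD(3)[OF C(1) g(1)[OF s] g(1)[OF t]]] .
    moreover have "(g (s \<oplus> t) \<ominus> (g s \<oplus> g t)) \<otimes> u = \<zero>"
      using gc[OF st] gc[OF s] gc[OF t] uc g(2)[OF st] g(2)[OF s] g(2)[OF t] Sc[OF s] Sc[OF t]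
      by (simp add: l_diff_distr l_distr)
    ultimately show "g (s \<oplus> t) \<ominus> (g s \<oplus> g t) \<in> Rad"
      unfolding C(3)[symmetric] annihilator_def using gc[OF st] gc[OF s] gc[OF t] by simp
    assume "g s \<ominus> g t \<in> Rad"
    then have "(g s \<ominus> g t) \<otimes> u = \<zero>" by (rule rad)
    then show "s = t" using gc[OF s] gc[OF t] uc g(2)[OF s] g(2)[OF t] Sc[OF s] Sc[OF t] by (simp add: l_diff_distr)
  qed
qed

text \<open>The copy of \<open>V\<close> in the quotient is a direct summand, hence generated by the
  component of \<open>\<one>\<close> in it. Every \<open>V\<close> inside \<open>S\<close> is
  covered because the generators used later are those of finite subideals of the socle.\<close>

lemma embeds_imp_cyclic:
  assumes S: "left_ideal S R" and emb: "embeds_mod_rad S"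
    and V: "left_ideal V R" "V \<subseteq> S"
  shows "\<exists>u\<in>V. V = principal u"
proof -
  note J = left_ideal_jacobson_radical
  obtain g where gS: "g \<in> S \<rightarrow> carrier R" "\<forall>s\<in>S. \<forall>t\<in>S. g (s \<oplus> t) \<ominus> (g s \<oplus> g t) \<in> Rad"
     "\<forall>r\<in>carrier R. \<forall>s\<in>S. g (r \<otimes> s) \<ominus> r \<otimes> g s \<in> Rad" "\<forall>s\<in>S. \<forall>t\<in>S. g s \<ominus> g t \<in> Rad \<longrightarrow> s = t"
    using emb unfolding embeds_in_quotient_iff[OF J S] by (elim bexE conjE)
  have gc: "\<And>s. s \<in> V \<Longrightarrow> g s \<in> carrier R" using gS(1) V(2) by blast
  have g: "\<And>s t. s \<in> V \<Longrightarrow> t \<in> V \<Longrightarrow> g (s \<oplus> t) \<ominus> (g s \<oplus> g t) \<in> Rad"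
     "\<And>r s. r \<in> carrier R \<Longrightarrow> s \<in> V \<Longrightarrow> g (r \<otimes> s) \<ominus> r \<otimes> g s \<in> Rad" "\<And>s t. s \<in> V \<Longrightarrow> t \<in> V \<Longrightarrow> g s \<ominus> g t \<in> Rad \<Longrightarrow> s = t"
    using gS(2-4) V(2)[THEN subsetD] by simp_all
  note v = left_idealD[OF V(1)] and jr = left_idealD[OF J]
  have Vc: "\<And>s. s \<in> V \<Longrightarrow> s \<in> carrier R" and Jc: "\<And>s. s \<in> Rad \<Longrightarrow> s \<in> carrier R" using v(1) jr(1) by auto
  have tr: "a \<ominus> c \<in> Rad" if "a \<ominus> b \<in> Rad" "b \<ominus> c \<in> Rad" "a \<in> carrier R" "b \<in> carrier R" "c \<in> carrier R" for a b c
  proof -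
    have "a \<ominus> c = (a \<ominus> b) \<oplus> (b \<ominus> c)" using that(3-5) by (simp add: minus_eq a_assoc r_neg1)
    then show ?thesis using jr(3)[OF that(1,2)] by simp
  qed
  have sy: "b \<ominus> a \<in> Rad" if "a \<ominus> b \<in> Rad" "a \<in> carrier R" "b \<in> carrier R" for a b
  proof -
    have "b \<ominus> a = \<ominus> (a \<ominus> b)" using that(2,3) by (simp add: minus_eq minus_add a_comm)
    then show ?thesis using jr(5)[OF that(1)] by simp
  qed
  \<comment> \<open>The preimage in \<open>R\<close> of the embedded copy of
    \<open>V\<close>.\<close>
  define K where "K = {r \<in> carrier R. \<exists>s\<in>V. r \<ominus> g s \<in> Rad}"
  have gK: "g s \<in> K" if "s \<in> V" for s using that gc[OF that] jr(2) by (auto simp: K_def minus_eq r_neg intro!: bexI[of _ s])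
  have radK: "Rad \<subseteq> K"
  proof
    fix j assume j: "j \<in> Rad"
    \<comment> \<open>Additivity holds only modulo the radical, so \<open>g \<zero>\<close> need not
      vanish; this shows that it lies in the radical.\<close>
    have "g \<zero> \<ominus> (g \<zero> \<oplus> g \<zero>) \<in> Rad" using g(1)[OF v(2) v(2)] by simp
    moreover have "g \<zero> \<ominus> (g \<zero> \<oplus> g \<zero>) = \<ominus> g \<zero>" using gc[OF v(2)] by (simp add: minus_eq minus_add r_neg2)
    ultimately have "j \<ominus> g \<zero> \<in> Rad" using jr(3)[OF j] by (simp add: minus_eq)
    then show "j \<in> K" using v(2) Jc[OF j] by (auto simp: K_def)
  qed
  have K: "left_ideal K R"
  proof (rule left_idealI)
    show "\<zero> \<in> K" using radK jr(2) by blast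
    fix a b assume "a \<in> K" "b \<in> K"
    then obtain s t where st: "s \<in> V" "t \<in> V" "a \<ominus> g s \<in> Rad" "b \<ominus> g t \<in> Rad" "a \<in> carrier R" "b \<in> carrier R"
      by (auto simp: K_def)
    have "(a \<oplus> b) \<ominus> (g s \<oplus> g t) = (a \<ominus> g s) \<oplus> (b \<ominus> g t)"
      using st gc by (simp add: minus_eq minus_add a_ac)
    then have "(a \<oplus> b) \<ominus> (g s \<oplus> g t) \<in> Rad" using jr(3) st by simp
    then have "(a \<oplus> b) \<ominus> g (s \<oplus> t) \<in> Rad"
      by (rule tr) (use sy[OF g(1)] st gc v(3) in auto)
    then show "a \<oplus> b \<in> K" using st v(3) by (auto simp: K_def)
  next
    fix r a assume r: "r \<in> carrier R" and "a \<in> K"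
    then obtain s where s: "s \<in> V" "a \<ominus> g s \<in> Rad" "a \<in> carrier R" by (auto simp: K_def)
    have "r \<otimes> a \<ominus> r \<otimes> g s \<in> Rad" using jr(4)[OF r s(2)] s gc[OF s(1)] r by (simp add: r_diff_distr)
    then have "r \<otimes> a \<ominus> g (r \<otimes> s) \<in> Rad"
      by (rule tr) (use sy[OF g(2)] s r gc v(4) in auto)
    then show "r \<otimes> a \<in> K" using s r v(4) by (auto simp: K_def)
  qed (auto simp: K_def)
  obtain C where C: "left_ideal C R" "C <+> K = carrier R" "C \<inter> K = Rad"
    using exists_complement_mod_radical[OF K radK] by blast
  have "\<one> \<in> C <+> K" using C(2) by simp
  then obtain c k where ck: "c \<in> C" "k \<in> K" "\<one> = c \<oplus> k" unfolding set_add_iff by blast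
  obtain u where u: "u \<in> V" "k \<ominus> g u \<in> Rad" and kc: "k \<in> carrier R" using ck(2) by (auto simp: K_def)
  have cc: "c \<in> carrier R" using ck(1) left_idealD(1)[OF C(1)] by blast
  have "s \<in> principal u" if s: "s \<in> V" for s
  proof -
    let ?w = "g s"
    have w: "?w \<in> carrier R" using gc[OF s] .
    have wk: "?w \<otimes> k \<in> K" "?w \<otimes> c \<in> C" using left_idealD(4)[OF K w ck(2)] left_idealD(4)[OF C(1) w ck(1)] .
    have "?w = ?w \<otimes> (c \<oplus> k)" using w by (simp add: ck(3)[symmetric])
    then have e: "?w = ?w \<otimes> c \<oplus> ?w \<otimes> k" using w cc kc by (simp add: r_distr)
    then have e': "?w \<ominus> ?w \<otimes> k = ?w \<otimes> c" using w cc kc add_diff_cancel[of "?w \<otimes> c" "?w \<otimes> k"] by simp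
    \<comment> \<open>Both \<open>?w\<close> and \<open>?w \<otimes> k\<close> lie in
      \<open>K\<close>, so \<open>?w \<otimes> c\<close> is in \<open>C \<inter> K\<close>, the
      radical: right multiplication by \<open>k\<close> is the identity on \<open>K\<close> modulo
      the radical.\<close>
    then have "?w \<otimes> c \<in> K" using left_ideal_diff[OF K gK[OF s] wk(1)] by simp
    then have "?w \<ominus> ?w \<otimes> k \<in> Rad" using wk(2) C(3) e' by auto
    then have "?w \<ominus> ?w \<otimes> g u \<in> Rad"
    proof (rule tr)
      show "?w \<otimes> k \<ominus> ?w \<otimes> g u \<in> Rad" using jr(4)[OF w u(2)] w kc gc[OF u(1)] by (simp add: r_diff_distr)
    qed (use w kc gc u in auto)
    then have "?w \<ominus> g (?w \<otimes> u) \<in> Rad"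
      by (rule tr) (use sy[OF g(2)] w u gc v(4) in auto)
    then have "s = ?w \<otimes> u" using g(3)[OF s v(4)[OF w u(1)]] by blast
    then show ?thesis using w by blast
  qed
  then show ?thesis using u(1) principal_subset[OF V(1) u(1)] by blast
qed

end

section \<open>Counting homomorphisms\<close>

context ring
begin

text \<open>Homomorphisms of left modules, extensional so that each has one representative and Hom
  sets can be counted.\<close>

definition lhom :: "'a set \<Rightarrow> 'a set \<Rightarrow> ('a \<Rightarrow> 'a) set"
  where "lhom V W = {\<phi> \<in> extensional V. (\<forall>x\<in>V. \<phi> x \<in> W) \<and> (\<forall>x\<in>V. \<forall>y\<in>V. \<phi> (x \<oplus> y) = \<phi> x \<oplus> \<phi> y) \<and>
    (\<forall>r\<in>carrier R. \<forall>x\<in>V. \<phi> (r \<otimes> x) = r \<otimes> \<phi> x)}"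

lemma lhomD:
  assumes "\<phi> \<in> lhom V W"
  shows "\<phi> \<in> extensional V" "\<And>x. x \<in> V \<Longrightarrow> \<phi> x \<in> W" "\<And>x y. x \<in> V \<Longrightarrow> y \<in> V \<Longrightarrow> \<phi> (x \<oplus> y) = \<phi> x \<oplus> \<phi> y"
    "\<And>r x. r \<in> carrier R \<Longrightarrow> x \<in> V \<Longrightarrow> \<phi> (r \<otimes> x) = r \<otimes> \<phi> x"
  using assms by (simp_all add: lhom_def)

lemma lhom_restrictI:
  assumes V: "left_ideal V R" and "\<And>x. x \<in> V \<Longrightarrow> f x \<in> W"
    "\<And>x y. x \<in> V \<Longrightarrow> y \<in> V \<Longrightarrow> f (x \<oplus> y) = f x \<oplus> f y"
    "\<And>r x. r \<in> carrier R \<Longrightarrow> x \<in> V \<Longrightarrow> f (r \<otimes> x) = r \<otimes> f x"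
  shows "restrict f V \<in> lhom V W"
  using assms(2-) left_idealD(3,4)[OF V] by (simp add: lhom_def)

lemma lhom_zero:
  assumes "left_ideal V R" "left_ideal W R" "\<phi> \<in> lhom V W" shows "\<phi> \<zero> = \<zero>"
proof -
  have z: "\<zero> \<in> V" using left_idealD(2)[OF assms(1)] .
  have "\<phi> \<zero> \<in> carrier R" using lhomD(2)[OF assms(3) z] left_idealD(1)[OF assms(2)] by blast
  then show ?thesis using lhomD(4)[OF assms(3), of \<zero> \<zero>] z by simp
qed

lemma lhom_diff:
  assumes "left_ideal V R" "left_ideal W R" "\<phi> \<in> lhom V W" "x \<in> V" "y \<in> V"
  shows "\<phi> (x \<ominus> y) = \<phi> x \<ominus> \<phi> y"
proof -
  have c: "x \<in> carrier R" "y \<in> carrier R" "\<phi> x \<in> carrier R" "\<phi> y \<in> carrier R"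
    using assms(4,5) lhomD(2)[OF assms(3)] left_idealD(1)[OF assms(1)] left_idealD(1)[OF assms(2)] by auto
  have d: "x \<ominus> y \<in> V" using left_ideal_diff[OF assms(1,4,5)] .
  then have dc: "\<phi> (x \<ominus> y) \<in> carrier R" using lhomD(2)[OF assms(3)] left_idealD(1)[OF assms(2)] by blast
  have "\<phi> x = \<phi> ((x \<ominus> y) \<oplus> y)" using c by (simp add: diff_add_cancel)
  also have "\<dots> = \<phi> (x \<ominus> y) \<oplus> \<phi> y" using lhomD(3)[OF assms(3) d assms(5)] .
  finally show ?thesis using dc c by (simp add: add_diff_cancel)
qed

lemma finite_lhom:
  assumes "finite V" "finite W" shows "finite (lhom V W)"
proof (rule finite_subset)
  show "lhom V W \<subseteq> PiE V (\<lambda>_. W)" by (auto simp: lhom_def PiE_def)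
qed (use assms in \<open>simp add: finite_PiE\<close>)

lemma zero_in_lhom: "left_ideal V R \<Longrightarrow> left_ideal W R \<Longrightarrow> (\<lambda>_\<in>V. \<zero>) \<in> lhom V W"
  by (rule lhom_restrictI) (auto dest: left_idealD(2))

lemma compose_in_lhom:
  assumes "left_ideal U R" "\<phi> \<in> lhom U V" "\<psi> \<in> lhom V W"
  shows "compose U \<psi> \<phi> \<in> lhom U W"
  unfolding compose_def
  by (rule lhom_restrictI[OF assms(1)]) (simp_all add: lhomD[OF assms(2)] lhomD[OF assms(3)])

lemma restrict_in_lhom:
  assumes "left_ideal U R" "U \<subseteq> V" "\<phi> \<in> lhom V W"
  shows "restrict \<phi> U \<in> lhom U W"
  by (rule lhom_restrictI[OF assms(1)]) (simp_all add: lhomD[OF assms(3)] subsetD[OF assms(2)])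

lemma left_ideal_kernel:
  assumes "left_ideal V R" "left_ideal W R" "\<phi> \<in> lhom V W"
  shows "left_ideal {x \<in> V. \<phi> x = \<zero>} R"
proof (rule left_idealI)
  show "{x \<in> V. \<phi> x = \<zero>} \<subseteq> carrier R" using left_idealD(1)[OF assms(1)] by blast
qed (use left_idealD[OF assms(1)] lhom_zero[OF assms] lhomD[OF assms(3)] in auto)

lemma left_ideal_image_lhom:
  assumes V: "left_ideal V R" "left_ideal W R" "\<phi> \<in> lhom V W"
  shows "left_ideal (\<phi> ` V) R"
proof (rule left_idealI)
  show "\<phi> ` V \<subseteq> carrier R" using lhomD(2)[OF V(3)] left_idealD(1)[OF V(2)] by blast
  show "\<zero> \<in> \<phi> ` V" using lhom_zero[OF V] left_idealD(2)[OF V(1)] by (metis image_eqI)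
  fix x y assume "x \<in> \<phi> ` V" "y \<in> \<phi> ` V"
  then obtain a b where "a \<in> V" "b \<in> V" "x = \<phi> a" "y = \<phi> b" by blast
  then show "x \<oplus> y \<in> \<phi> ` V"
    using left_idealD(3)[OF V(1)] by (intro image_eqI[of _ _ "a \<oplus> b"]) (simp_all add: lhomD(3)[OF V(3)])
next
  fix r x assume "r \<in> carrier R" "x \<in> \<phi> ` V"
  then obtain a where "r \<in> carrier R" "a \<in> V" "x = \<phi> a" by blast
  then show "r \<otimes> x \<in> \<phi> ` V"
    using left_idealD(4)[OF V(1)] by (intro image_eqI[of _ _ "r \<otimes> a"]) (simp_all add: lhomD(4)[OF V(3)])
qed

lemma lhom_eqI:
  assumes "\<phi> \<in> lhom V W" "\<psi> \<in> lhom V W'" "\<And>x. x \<in> V \<Longrightarrow> \<phi> x = \<psi> x" shows "\<phi> = \<psi>"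
  using lhomD(1)[OF assms(1)] lhomD(1)[OF assms(2)] assms(3) by (rule extensionalityI)

text \<open>Kernel and image are left ideals, hence trivial or everything. The inverse is provided
  as a homomorphism, for conjugating Hom sets and for inverting projections.\<close>

lemma schur:
  assumes L: "minimal_left_ideal L R" "minimal_left_ideal L' R" and \<phi>: "\<phi> \<in> lhom L L'"
    and nz: "x \<in> L" "\<phi> x \<noteq> \<zero>"
  shows "\<exists>\<sigma>\<in>lhom L' L. (\<forall>x\<in>L. \<sigma> (\<phi> x) = x) \<and> (\<forall>y\<in>L'. \<phi> (\<sigma> y) = y)"
proof -
  note l = min_idealD[OF L(1)] and l' = min_idealD[OF L(2)]
  have "{x \<in> L. \<phi> x = \<zero>} = {\<zero>} \<or> {x \<in> L. \<phi> x = \<zero>} = L"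
    by (rule l(3)[OF left_ideal_kernel[OF l(1) l'(1) \<phi>]]) blast
  then have ker: "{x \<in> L. \<phi> x = \<zero>} = {\<zero>}" using nz by blast
  have "\<phi> ` L = {\<zero>} \<or> \<phi> ` L = L'"
    by (rule l'(3)[OF left_ideal_image_lhom[OF l(1) l'(1) \<phi>]]) (use lhomD(2)[OF \<phi>] in blast)
  then have surj: "\<phi> ` L = L'" using nz by blast
  have Lc: "\<And>x. x \<in> L \<Longrightarrow> x \<in> carrier R" using left_idealD(1)[OF l(1)] by blast
  have inj: "inj_on \<phi> L"
  proof (rule inj_onI)
    fix x y assume xy: "x \<in> L" "y \<in> L" "\<phi> x = \<phi> y"
    have "\<phi> y \<in> carrier R" using lhomD(2)[OF \<phi> xy(2)] left_idealD(1)[OF l'(1)] by blast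
    then have "\<phi> (x \<ominus> y) = \<zero>" using lhom_diff[OF l(1) l'(1) \<phi> xy(1,2)] xy(3) by simp
    then have "x \<ominus> y \<in> {x \<in> L. \<phi> x = \<zero>}" using left_ideal_diff[OF l(1) xy(1,2)] by simp
    then have "x \<ominus> y = \<zero>" unfolding ker by simp
    then show "x = y" using Lc xy by simp
  qed
  define \<sigma> where "\<sigma> = restrict (inv_into L \<phi>) L'"
  have s1: "\<sigma> (\<phi> x) = x" if "x \<in> L" for x using that inj lhomD(2)[OF \<phi> that] by (simp add: \<sigma>_def)
  have s2: "\<sigma> y \<in> L" "\<phi> (\<sigma> y) = y" if "y \<in> L'" for y
    using that inv_into_into[of y \<phi> L] f_inv_into_f[of y \<phi> L] surj by (simp_all add: \<sigma>_def)
  have "\<sigma> \<in> lhom L' L"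
    unfolding \<sigma>_def
  proof (rule lhom_restrictI[OF l'(1)])
    have eq: "\<And>y. y \<in> L' \<Longrightarrow> inv_into L \<phi> y = \<sigma> y" by (simp add: \<sigma>_def)
    show "inv_into L \<phi> x \<in> L" if "x \<in> L'" for x using s2(1)[OF that] eq[OF that] by simp
    fix x assume x: "x \<in> L'"
    show "inv_into L \<phi> (r \<otimes> x) = r \<otimes> inv_into L \<phi> x" if r: "r \<in> carrier R" for r
    proof -
      have rx: "r \<otimes> x \<in> L'" using left_idealD(4)[OF l'(1) r x] .
      have rs: "r \<otimes> \<sigma> x \<in> L" using left_idealD(4)[OF l(1) r s2(1)[OF x]] .
      have "\<phi> (r \<otimes> \<sigma> x) = r \<otimes> x" using lhomD(4)[OF \<phi> r s2(1)[OF x]] s2(2)[OF x] by simp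
      then show ?thesis using s1[OF rs] eq[OF x] eq[OF rx] by simp
    qed
    fix y assume y: "y \<in> L'"
    have xy: "x \<oplus> y \<in> L'" using left_idealD(3)[OF l'(1) x y] .
    have rs: "\<sigma> x \<oplus> \<sigma> y \<in> L" using left_idealD(3)[OF l(1) s2(1)[OF x] s2(1)[OF y]] .
    have "\<phi> (\<sigma> x \<oplus> \<sigma> y) = x \<oplus> y" using lhomD(3)[OF \<phi> s2(1)[OF x] s2(1)[OF y]] s2(2)[OF x] s2(2)[OF y] by simp
    then show "inv_into L \<phi> (x \<oplus> y) = inv_into L \<phi> x \<oplus> inv_into L \<phi> y"
      using s1[OF rs] eq[OF x] eq[OF y] eq[OF xy] by simp
  qed
  then show ?thesis using s1 s2(2) by (intro bexI conjI ballI)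
qed

text \<open>Either only the zero map exists from \<open>L\<close> to \<open>L'\<close>, or the two
  ideals are isomorphic and an isomorphism transports one Hom set into the other.\<close>

lemma card_lhom_minimal_le:
  assumes L: "minimal_left_ideal L R" "minimal_left_ideal L' R" and fin: "finite L" "finite L'"
  shows "card (lhom L L') \<le> card (lhom L' L)"
proof (cases "\<exists>\<phi>\<in>lhom L L'. \<exists>x\<in>L. \<phi> x \<noteq> \<zero>")
  case True
  note l = min_idealD(1)[OF L(1)] and l' = min_idealD(1)[OF L(2)]
  obtain \<phi> x where "\<phi> \<in> lhom L L'" "x \<in> L" "\<phi> x \<noteq> \<zero>" using True by blast
  then obtain \<sigma> where "\<sigma> \<in> lhom L' L" "\<forall>x\<in>L. \<sigma> (\<phi> x) = x" "\<forall>y\<in>L'. \<phi> (\<sigma> y) = y"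
    using schur[OF L] by blast
  note s = this(1) this(2,3)[rule_format]
  show ?thesis
  proof (rule card_inj_on_le)
    \<comment> \<open>The composite runs
      \<open>L' \<rightarrow> L \<rightarrow> L' \<rightarrow> L\<close> along
      \<open>\<sigma>\<close>, \<open>\<psi>\<close>, \<open>\<sigma>\<close>.\<close>
    show "(\<lambda>\<psi>. compose L' \<sigma> (compose L' \<psi> \<sigma>)) ` lhom L L' \<subseteq> lhom L' L"
      using compose_in_lhom[OF l' compose_in_lhom[OF l' s(1)] s(1)] by blast
    show "inj_on (\<lambda>\<psi>. compose L' \<sigma> (compose L' \<psi> \<sigma>)) (lhom L L')"
    proof (rule inj_onI)
      fix \<psi> \<theta> assume a: "\<psi> \<in> lhom L L'" "\<theta> \<in> lhom L L'" "compose L' \<sigma> (compose L' \<psi> \<sigma>) = compose L' \<sigma> (compose L' \<theta> \<sigma>)"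
      show "\<psi> = \<theta>"
      proof (rule lhom_eqI[OF a(1,2)])
        fix x assume x: "x \<in> L"
        have px: "\<phi> x \<in> L'" using lhomD(2)[OF \<open>\<phi> \<in> lhom L L'\<close> x] .
        have "compose L' \<sigma> (compose L' \<psi> \<sigma>) (\<phi> x) = compose L' \<sigma> (compose L' \<theta> \<sigma>) (\<phi> x)" using a(3) by simp
        then have "\<sigma> (\<psi> x) = \<sigma> (\<theta> x)" using px s(2)[OF x] by (simp add: compose_def)
        then have "\<phi> (\<sigma> (\<psi> x)) = \<phi> (\<sigma> (\<theta> x))" by (rule arg_cong)
        then show "\<psi> x = \<theta> x" unfolding s(3)[OF lhomD(2)[OF a(1) x]] s(3)[OF lhomD(2)[OF a(2) x]] .
      qed
    qed
    show "finite (lhom L' L)" using fin by (rule_tac finite_lhom)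
  qed
next
  case False
  note l = min_idealD(1)[OF L(1)] and l' = min_idealD(1)[OF L(2)]
  have "lhom L L' \<subseteq> {\<lambda>_\<in>L. \<zero>}"
  proof
    fix \<phi> assume p: "\<phi> \<in> lhom L L'"
    have "\<phi> = (\<lambda>_\<in>L. \<zero>)" by (rule lhom_eqI[OF p zero_in_lhom[OF l l']]) (use False p in auto)
    then show "\<phi> \<in> {\<lambda>_\<in>L. \<zero>}" by simp
  qed
  then have "card (lhom L L') \<le> 1" using card_mono[of "{\<lambda>_\<in>L. \<zero>}"] by fastforce
  moreover have "card (lhom L' L) > 0"
    using finite_lhom[OF fin(2,1)] zero_in_lhom[OF l' l] by (auto simp: card_gt_0_iff)
  ultimately show ?thesis by simp
qed

lemma card_lhom_minimal:
  assumes "minimal_left_ideal L R" "minimal_left_ideal L' R" "finite L" "finite L'"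
  shows "card (lhom L L') = card (lhom L' L)"
  using card_lhom_minimal_le[OF assms] card_lhom_minimal_le[OF assms(2,1,4,3)] by simp

section \<open>Homomorphisms from and into direct sums\<close>

lemma exists_projection:
  assumes V: "left_ideal V R" and W: "left_ideal W R" and disj: "V \<inter> W = {\<zero>}"
  shows "\<exists>p\<in>lhom (V <+> W) V. \<forall>x\<in>V. \<forall>y\<in>W. p (x \<oplus> y) = x"
proof -
  note v = left_idealD[OF V] and w = left_idealD[OF W]
  have vc: "\<And>x. x \<in> V \<Longrightarrow> x \<in> carrier R" and wc: "\<And>x. x \<in> W \<Longrightarrow> x \<in> carrier R" using v(1) w(1) by auto
  have uniq: "x = x'" if "x \<in> V" "x' \<in> V" "y \<in> W" "y' \<in> W" "x \<oplus> y = x' \<oplus> y'" for x x' y y'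
  proof -
    note c = vc[OF that(1)] vc[OF that(2)] wc[OF that(3)] wc[OF that(4)]
    have "x \<ominus> x' = ((x \<oplus> y) \<ominus> y) \<ominus> x'" using c by (simp add: add_diff_cancel)
    also have "(x \<oplus> y) \<ominus> y = (y' \<ominus> y) \<oplus> x'" unfolding that(5) using c by (simp add: minus_eq a_ac)
    also have "((y' \<ominus> y) \<oplus> x') \<ominus> x' = y' \<ominus> y" using c by (simp add: add_diff_cancel)
    finally have "x \<ominus> x' \<in> V \<inter> W"
      using left_ideal_diff[OF V that(1,2)] left_ideal_diff[OF W that(4,3)] by simp
    then have "x \<ominus> x' = \<zero>" unfolding disj by simp
    then show ?thesis using c by simp
  qed
  define p where "p = (\<lambda>z. THE x. x \<in> V \<and> (\<exists>y\<in>W. z = x \<oplus> y))"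
  have p: "p (x \<oplus> y) = x" if xy: "x \<in> V" "y \<in> W" for x y
    unfolding p_def by (rule the_equality) (use xy uniq in blast)+
  have dec: "\<exists>x\<in>V. \<exists>y\<in>W. z = x \<oplus> y" if "z \<in> V <+> W" for z using that unfolding set_add_iff .
  have "restrict p (V <+> W) \<in> lhom (V <+> W) V"
  proof (rule lhom_restrictI[OF left_ideal_set_add(1)[OF V W]])
    fix z assume z: "z \<in> V <+> W"
    obtain x y where xy: "x \<in> V" "y \<in> W" "z = x \<oplus> y" using dec[OF z] by (elim bexE)
    note c = vc[OF xy(1)] wc[OF xy(2)]
    show "p z \<in> V" using xy p by simp
    show "p (r \<otimes> z) = r \<otimes> p z" if r: "r \<in> carrier R" for r
      using xy(1,2) r c v(4)[OF r xy(1)] w(4)[OF r xy(2)] unfolding xy(3) by (simp add: r_distr p)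
    fix z' assume z': "z' \<in> V <+> W"
    obtain x' y' where xy': "x' \<in> V" "y' \<in> W" "z' = x' \<oplus> y'" using dec[OF z'] by (elim bexE)
    have "z \<oplus> z' = (x \<oplus> x') \<oplus> (y \<oplus> y')"
      unfolding xy(3) xy'(3) using c vc[OF xy'(1)] wc[OF xy'(2)] by (simp add: a_ac)
    then show "p (z \<oplus> z') = p z \<oplus> p z'"
      using p[OF v(3)[OF xy(1) xy'(1)] w(3)[OF xy(2) xy'(2)]] p[OF xy(1,2)] p[OF xy'(1,2)] xy(3) xy'(3) by simp
  qed
  moreover have "restrict p (V <+> W) (x \<oplus> y) = x" if "x \<in> V" "y \<in> W" for x y
  proof -
    have "x \<oplus> y \<in> V <+> W" using that unfolding set_add_iff by blast
    then show ?thesis using p[OF that] by simp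
  qed
  ultimately show ?thesis by (intro bexI ballI)
qed

lemma direct_sum_projections:
  assumes V: "left_ideal V R" and W: "left_ideal W R" and disj: "V \<inter> W = {\<zero>}"
  shows "\<exists>p\<in>lhom (V <+> W) V. \<exists>q\<in>lhom (V <+> W) W.
    (\<forall>x\<in>V. \<forall>y\<in>W. p (x \<oplus> y) = x) \<and> (\<forall>x\<in>V. \<forall>y\<in>W. q (x \<oplus> y) = y) \<and>
    (\<forall>x\<in>V <+> W. p x \<oplus> q x = x) \<and> (\<forall>x\<in>V. p x = x \<and> q x = \<zero>) \<and> (\<forall>x\<in>W. p x = \<zero> \<and> q x = x)"
proof -
  have vc: "\<And>x. x \<in> V \<Longrightarrow> x \<in> carrier R" and wc: "\<And>x. x \<in> W \<Longrightarrow> x \<in> carrier R"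
    using left_idealD(1)[OF V] left_idealD(1)[OF W] by auto
  have z: "\<zero> \<in> V" "\<zero> \<in> W" using left_idealD(2)[OF V] left_idealD(2)[OF W] .
  have comm: "y \<oplus> x = x \<oplus> y" if "x \<in> V" "y \<in> W" for x y using a_comm[OF wc[OF that(2)] vc[OF that(1)]] .
  have swap: "W <+> V = V <+> W"
  proof (rule Set.set_eqI)
    show "x \<in> W <+> V \<longleftrightarrow> x \<in> V <+> W" for x unfolding set_add_iff using comm by metis
  qed
  obtain p where p: "p \<in> lhom (V <+> W) V" "\<forall>x\<in>V. \<forall>y\<in>W. p (x \<oplus> y) = x"
    using exists_projection[OF V W disj] by blast
  obtain q where q0: "q \<in> lhom (W <+> V) W" "\<forall>y\<in>W. \<forall>x\<in>V. q (y \<oplus> x) = y"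
    using exists_projection[OF W V] disj by blast
  have q: "\<forall>x\<in>V. \<forall>y\<in>W. q (x \<oplus> y) = y" using q0(2) comm by metis
  have "\<forall>x\<in>V <+> W. p x \<oplus> q x = x" using p(2) q by (auto simp: set_add_iff)
  moreover have "p x = x \<and> q x = \<zero>" if "x \<in> V" for x
    using p(2)[rule_format, OF that z(2)] q[rule_format, OF that z(2)] vc[OF that] by simp
  moreover have "p x = \<zero> \<and> q x = x" if "x \<in> W" for x
    using p(2)[rule_format, OF z(1) that] q[rule_format, OF z(1) that] wc[OF that] by simp
  ultimately show ?thesis using p q q0(1)[unfolded swap] by (intro bexI[of _ p] bexI[of _ q]) simp_all
qed

text \<open>A direct sum is a coproduct: restriction to the summands is inverted by gluing along the
  projections.\<close>

lemma card_lhom_from_sum: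
  assumes V: "left_ideal V R" and W: "left_ideal W R" and disj: "V \<inter> W = {\<zero>}" and L: "left_ideal L R"
  shows "card (lhom (V <+> W) L) = card (lhom V L) * card (lhom W L)"
proof -
  let ?S = "V <+> W"
  note S = left_ideal_set_add[OF V W]
  obtain p q where "p \<in> lhom ?S V" "q \<in> lhom ?S W"
    "\<forall>x\<in>?S. p x \<oplus> q x = x" "\<forall>x\<in>V. p x = x \<and> q x = \<zero>" "\<forall>x\<in>W. p x = \<zero> \<and> q x = x"
    using direct_sum_projections[OF V W disj] by blast
  note pq = this(1,2) this(3)[rule_format] and pV = this(4)[rule_format] and pW = this(5)[rule_format]
  note v = left_idealD[OF V] and w = left_idealD[OF W] and l = left_idealD[OF L]
  have Lc: "\<And>x. x \<in> L \<Longrightarrow> x \<in> carrier R" using l(1) by blast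
  let ?f = "\<lambda>\<phi>. (restrict \<phi> V, restrict \<phi> W)"
  let ?g = "\<lambda>(\<alpha>, \<beta>). (\<lambda>x\<in>?S. \<alpha> (p x) \<oplus> \<beta> (q x))"
  have g: "(\<lambda>x\<in>?S. \<alpha> (p x) \<oplus> \<beta> (q x)) \<in> lhom ?S L" if a: "\<alpha> \<in> lhom V L" and b: "\<beta> \<in> lhom W L" for \<alpha> \<beta>
  proof (rule lhom_restrictI[OF S(1)])
    note A = lhomD[OF a] and B = lhomD[OF b] and P = lhomD[OF pq(1)] and Q = lhomD[OF pq(2)]
    fix x assume x: "x \<in> ?S"
    show "\<alpha> (p x) \<oplus> \<beta> (q x) \<in> L" using l(3) A(2)[OF P(2)[OF x]] B(2)[OF Q(2)[OF x]] by blast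
    show "\<alpha> (p (r \<otimes> x)) \<oplus> \<beta> (q (r \<otimes> x)) = r \<otimes> (\<alpha> (p x) \<oplus> \<beta> (q x))" if r: "r \<in> carrier R" for r
      using r x Lc[OF A(2)[OF P(2)[OF x]]] Lc[OF B(2)[OF Q(2)[OF x]]]
      by (simp add: P(2,4) Q(2,4) A(4) B(4) r_distr)
    fix y assume y: "y \<in> ?S"
    show "\<alpha> (p (x \<oplus> y)) \<oplus> \<beta> (q (x \<oplus> y)) = (\<alpha> (p x) \<oplus> \<beta> (q x)) \<oplus> (\<alpha> (p y) \<oplus> \<beta> (q y))"
      using x y Lc[OF A(2)[OF P(2)[OF x]]] Lc[OF B(2)[OF Q(2)[OF x]]] Lc[OF A(2)[OF P(2)[OF y]]] Lc[OF B(2)[OF Q(2)[OF y]]]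
      by (simp add: P(2,3) Q(2,3) A(3) B(3) a_ac)
  qed
  have "bij_betw ?f (lhom ?S L) (lhom V L \<times> lhom W L)"
  proof (rule bij_betw_byWitness[where f' = ?g])
    show "\<forall>\<phi>\<in>lhom ?S L. ?g (?f \<phi>) = \<phi>"
    proof
      fix \<phi> assume f: "\<phi> \<in> lhom ?S L"
      have r: "restrict \<phi> V \<in> lhom V L" "restrict \<phi> W \<in> lhom W L"
        using restrict_in_lhom[OF V S(2) f] restrict_in_lhom[OF W S(3) f] .
      have "(\<lambda>x\<in>?S. restrict \<phi> V (p x) \<oplus> restrict \<phi> W (q x)) = \<phi>"
      proof (rule lhom_eqI[OF g[OF r] f])
        fix x assume x: "x \<in> ?S"
        have px: "p x \<in> V" "q x \<in> W" using lhomD(2)[OF pq(1) x] lhomD(2)[OF pq(2) x] .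
        have "\<phi> (p x) \<oplus> \<phi> (q x) = \<phi> (p x \<oplus> q x)" using lhomD(3)[OF f] px S(2,3) by (simp add: subset_iff)
        then show "(\<lambda>x\<in>?S. restrict \<phi> V (p x) \<oplus> restrict \<phi> W (q x)) x = \<phi> x"
          using px x pq(3)[OF x] by simp
      qed
      then show "?g (?f \<phi>) = \<phi>" by simp
    qed
    show "\<forall>ab\<in>lhom V L \<times> lhom W L. ?f (?g ab) = ab"
    proof
      fix ab assume "ab \<in> lhom V L \<times> lhom W L"
      then obtain \<alpha> \<beta> where ab: "ab = (\<alpha>, \<beta>)" and a: "\<alpha> \<in> lhom V L" and b: "\<beta> \<in> lhom W L" by blast
      have z: "\<alpha> \<zero> = \<zero>" "\<beta> \<zero> = \<zero>" using lhom_zero[OF V L a] lhom_zero[OF W L b] .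
      have "restrict (\<lambda>x\<in>?S. \<alpha> (p x) \<oplus> \<beta> (q x)) V = \<alpha>"
        by (rule lhom_eqI[OF restrict_in_lhom[OF V S(2) g[OF a b]] a])
          (use S(2) pV z Lc lhomD(2)[OF a] in \<open>simp add: subset_iff\<close>)
      moreover have "restrict (\<lambda>x\<in>?S. \<alpha> (p x) \<oplus> \<beta> (q x)) W = \<beta>"
        by (rule lhom_eqI[OF restrict_in_lhom[OF W S(3) g[OF a b]] b])
          (use S(3) pW z Lc lhomD(2)[OF b] in \<open>simp add: subset_iff\<close>)
      ultimately show "?f (?g ab) = ab" unfolding ab by simp
    qed
    show "?f ` lhom ?S L \<subseteq> lhom V L \<times> lhom W L"
      using restrict_in_lhom[OF V S(2)] restrict_in_lhom[OF W S(3)] by blast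
    show "?g ` (lhom V L \<times> lhom W L) \<subseteq> lhom ?S L" using g by auto
  qed
  from bij_betw_same_card[OF this] show ?thesis by (simp add: card_cartesian_product)
qed

text \<open>A finite direct sum is also a product: composition with the projections is inverted by
  pointwise addition.\<close>

lemma card_lhom_into_sum:
  assumes V: "left_ideal V R" and W: "left_ideal W R" and disj: "V \<inter> W = {\<zero>}" and L: "left_ideal L R"
  shows "card (lhom L (V <+> W)) = card (lhom L V) * card (lhom L W)"
proof -
  let ?S = "V <+> W"
  note S = left_ideal_set_add[OF V W]
  obtain p q where "p \<in> lhom ?S V" "q \<in> lhom ?S W"
    "\<forall>x\<in>V. \<forall>y\<in>W. p (x \<oplus> y) = x" "\<forall>x\<in>V. \<forall>y\<in>W. q (x \<oplus> y) = y" "\<forall>x\<in>?S. p x \<oplus> q x = x"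
    using direct_sum_projections[OF V W disj] by blast
  note pq = this(1,2) this(3-5)[rule_format]
  have Vc: "\<And>x. x \<in> V \<Longrightarrow> x \<in> carrier R" and Wc: "\<And>x. x \<in> W \<Longrightarrow> x \<in> carrier R"
    using left_idealD(1)[OF V] left_idealD(1)[OF W] by auto
  have Smem: "\<And>x y. x \<in> V \<Longrightarrow> y \<in> W \<Longrightarrow> x \<oplus> y \<in> ?S" unfolding set_add_iff by blast
  let ?f = "\<lambda>\<phi>. (compose L p \<phi>, compose L q \<phi>)"
  let ?g = "\<lambda>(\<alpha>, \<beta>). (\<lambda>x\<in>L. \<alpha> x \<oplus> \<beta> x)"
  have g: "(\<lambda>x\<in>L. \<alpha> x \<oplus> \<beta> x) \<in> lhom L ?S" if a: "\<alpha> \<in> lhom L V" and b: "\<beta> \<in> lhom L W" for \<alpha> \<beta>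
  proof (rule lhom_restrictI[OF L])
    note A = lhomD[OF a] and B = lhomD[OF b]
    fix x assume x: "x \<in> L"
    show "\<alpha> x \<oplus> \<beta> x \<in> ?S" using Smem[OF A(2)[OF x] B(2)[OF x]] .
    show "\<alpha> (r \<otimes> x) \<oplus> \<beta> (r \<otimes> x) = r \<otimes> (\<alpha> x \<oplus> \<beta> x)" if r: "r \<in> carrier R" for r
      using r x Vc[OF A(2)[OF x]] Wc[OF B(2)[OF x]] by (simp add: A(4) B(4) r_distr)
    fix y assume y: "y \<in> L"
    show "\<alpha> (x \<oplus> y) \<oplus> \<beta> (x \<oplus> y) = (\<alpha> x \<oplus> \<beta> x) \<oplus> (\<alpha> y \<oplus> \<beta> y)"
      using x y Vc[OF A(2)[OF x]] Wc[OF B(2)[OF x]] Vc[OF A(2)[OF y]] Wc[OF B(2)[OF y]]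
      by (simp add: A(3) B(3) a_ac)
  qed
  have "bij_betw ?f (lhom L ?S) (lhom L V \<times> lhom L W)"
  proof (rule bij_betw_byWitness[where f' = ?g])
    show "\<forall>\<phi>\<in>lhom L ?S. ?g (?f \<phi>) = \<phi>"
    proof
      fix \<phi> assume f: "\<phi> \<in> lhom L ?S"
      note c = compose_in_lhom[OF L f pq(1)] compose_in_lhom[OF L f pq(2)]
      have "(\<lambda>x\<in>L. compose L p \<phi> x \<oplus> compose L q \<phi> x) = \<phi>"
        by (rule lhom_eqI[OF g[OF c] f]) (use pq(5) lhomD(2)[OF f] in \<open>simp add: compose_def\<close>)
      then show "?g (?f \<phi>) = \<phi>" by simp
    qed
    show "\<forall>ab\<in>lhom L V \<times> lhom L W. ?f (?g ab) = ab"
    proof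
      fix ab assume "ab \<in> lhom L V \<times> lhom L W"
      then obtain \<alpha> \<beta> where ab: "ab = (\<alpha>, \<beta>)" and a: "\<alpha> \<in> lhom L V" and b: "\<beta> \<in> lhom L W" by blast
      have "compose L p (\<lambda>x\<in>L. \<alpha> x \<oplus> \<beta> x) = \<alpha>"
        by (rule lhom_eqI[OF compose_in_lhom[OF L g[OF a b] pq(1)] a])
          (use pq(3) lhomD(2)[OF a] lhomD(2)[OF b] in \<open>simp add: compose_def\<close>)
      moreover have "compose L q (\<lambda>x\<in>L. \<alpha> x \<oplus> \<beta> x) = \<beta>"
        by (rule lhom_eqI[OF compose_in_lhom[OF L g[OF a b] pq(2)] b])
          (use pq(4) lhomD(2)[OF a] lhomD(2)[OF b] in \<open>simp add: compose_def\<close>)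
      ultimately show "?f (?g ab) = ab" unfolding ab by simp
    qed
    show "?f ` lhom L ?S \<subseteq> lhom L V \<times> lhom L W"
      using compose_in_lhom[OF L _ pq(1)] compose_in_lhom[OF L _ pq(2)] by blast
    show "?g ` (lhom L V \<times> lhom L W) \<subseteq> lhom L ?S" using g by auto
  qed
  from bij_betw_same_card[OF this] show ?thesis by (simp add: card_cartesian_product)
qed

lemma lhom_trivial:
  assumes L: "left_ideal L R" shows "card (lhom {\<zero>} L) = 1" "card (lhom L {\<zero>}) = 1"
proof -
  have "lhom {\<zero>} L = {\<lambda>_\<in>{\<zero>}. \<zero>}"
  proof (intro equalityI subsetI)
    fix \<phi> assume p: "\<phi> \<in> lhom {\<zero>} L"
    have "\<phi> = (\<lambda>_\<in>{\<zero>}. \<zero>)"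
      by (rule lhom_eqI[OF p zero_in_lhom[OF left_ideal_zero L]]) (use lhom_zero[OF left_ideal_zero L p] in simp)
    then show "\<phi> \<in> {\<lambda>_\<in>{\<zero>}. \<zero>}" by simp
  qed (use zero_in_lhom[OF left_ideal_zero L] in simp)
  then show "card (lhom {\<zero>} L) = 1" by simp
  have "lhom L {\<zero>} = {\<lambda>_\<in>L. \<zero>}"
  proof (intro equalityI subsetI)
    fix \<phi> assume p: "\<phi> \<in> lhom L {\<zero>}"
    have "\<phi> = (\<lambda>_\<in>L. \<zero>)"
      by (rule lhom_eqI[OF p zero_in_lhom[OF L left_ideal_zero]]) (use lhomD(2)[OF p] in simp)
    then show "\<phi> \<in> {\<lambda>_\<in>L. \<zero>}" by simp
  qed (use zero_in_lhom[OF L left_ideal_zero] in simp)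
  then show "card (lhom L {\<zero>}) = 1" by simp
qed

end

context left_artinian_ring
begin

text \<open>Both counts are multiplicative over direct sums, so equality spreads from minimal ideals
  to all of \<open>V\<close>: a maximal subideal for which it holds could otherwise be enlarged by a
  disjoint minimal summand.\<close>

lemma card_lhom_swap:
  assumes V: "left_ideal V R" "finite V" "\<And>r v. r \<in> Rad \<Longrightarrow> v \<in> V \<Longrightarrow> r \<otimes> v = \<zero>"
    and L: "minimal_left_ideal L R" "finite L"
  shows "card (lhom V L) = card (lhom L V)"
proof -
  note l = min_idealD(1)[OF L(1)]
  define \<F> where "\<F> = {U. left_ideal U R \<and> U \<subseteq> V \<and> card (lhom U L) = card (lhom L U)}"
  have "{\<zero>} \<in> \<F>" using left_ideal_zero left_idealD(2)[OF V(1)] lhom_trivial[OF l] by (simp add: \<F>_def)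
  moreover have "finite \<F>" by (rule finite_subset[of _ "Pow V"]) (use V(2) in \<open>auto simp: \<F>_def\<close>)
  ultimately obtain U where U: "U \<in> \<F>" and max: "\<And>U'. U' \<in> \<F> \<Longrightarrow> U \<subseteq> U' \<Longrightarrow> U = U'"
    using finite_has_maximal[of \<F>] by blast
  have Us: "left_ideal U R" "U \<subseteq> V" "card (lhom U L) = card (lhom L U)" using U by (simp_all add: \<F>_def)
  have "U = V"
  proof (rule ccontr)
    assume "U \<noteq> V"
    then have "U \<subset> V" using Us(2) by blast
    then obtain L' where L': "minimal_left_ideal L' R" "L' \<subseteq> V" "U \<inter> L' = {\<zero>}"
      using exists_minimal_disjoint[OF V(1,3) Us(1)] by blast
    note l' = min_idealD[OF L'(1)]
    have fin: "finite L'" using L'(2) V(2) by (rule finite_subset)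
    have "card (lhom (U <+> L') L) = card (lhom L (U <+> L'))"
      by (simp add: card_lhom_from_sum[OF Us(1) l'(1) L'(3) l] card_lhom_into_sum[OF Us(1) l'(1) L'(3) l]
          Us(3) card_lhom_minimal[OF L'(1) L(1) fin L(2)])
    then have "U <+> L' \<in> \<F>"
      using left_ideal_set_add(1)[OF Us(1) l'(1)] set_add_subset[OF V(1) Us(2) L'(2)] by (simp add: \<F>_def)
    then have "U = U <+> L'" using left_ideal_set_add(2)[OF Us(1) l'(1)] by (rule max)
    then have "L' \<subseteq> U" using left_ideal_set_add(3)[OF Us(1) l'(1)] by simp
    then show False using L'(3) l'(2) by blast
  qed
  then show ?thesis using Us(3) by simp
qed

end

section \<open>Characters and homomorphisms\<close>

context ring
begin

abbreviation additive_char :: "'a set \<Rightarrow> ('a \<Rightarrow> complex) \<Rightarrow> bool"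
  where "additive_char H \<xi> \<equiv> char_on (add_monoid R) H \<xi>"

lemma additive_char_iff:
  "additive_char H \<xi> \<longleftrightarrow> (\<forall>x\<in>H. cmod (\<xi> x) = 1) \<and> (\<forall>x\<in>H. \<forall>y\<in>H. \<xi> (x \<oplus> y) = \<xi> x * \<xi> y)"
  by (simp add: char_on_def)

lemma left_ideal_subgroup: "left_ideal I R \<Longrightarrow> subgroup I (add_monoid R)"
  by (simp add: left_ideal_def additive_subgroup.a_subgroup)

lemma additive_charD:
  assumes "additive_char (carrier R) \<xi>" "x \<in> carrier R"
  shows "cmod (\<xi> x) = 1" "\<xi> x \<noteq> 0" "y \<in> carrier R \<Longrightarrow> \<xi> (x \<oplus> y) = \<xi> x * \<xi> y"
    "\<xi> (\<ominus> x) = inverse (\<xi> x)" "y \<in> carrier R \<Longrightarrow> \<xi> (x \<ominus> y) = \<xi> x / \<xi> y" "\<xi> (add_pow R (n::nat) x) = \<xi> x ^ n"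
proof -
  show "cmod (\<xi> x) = 1" "y \<in> carrier R \<Longrightarrow> \<xi> (x \<oplus> y) = \<xi> x * \<xi> y" for y
    using assms by (simp_all add: additive_char_iff)
  have inv: "\<xi> (\<ominus> y) = inverse (\<xi> y)" if "y \<in> carrier R" for y
    using add.char_on_inv[OF add.subgroup_self assms(1) that] .
  show "\<xi> (\<ominus> x) = inverse (\<xi> x)" by (rule inv[OF assms(2)])
  show "\<xi> (x \<ominus> y) = \<xi> x / \<xi> y" if "y \<in> carrier R"
    using that assms inv by (simp add: minus_eq additive_char_iff divide_inverse)
  show "\<xi> (add_pow R (n::nat) x) = \<xi> x ^ n" by (rule add.char_on_nat_pow[OF add.subgroup_self assms])
  show "\<xi> x \<noteq> 0" using assms by (auto simp: additive_char_iff)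
qed

text \<open>Over an Artinian ring this says that the kernel of \<open>\<xi>\<close> contains no
  nonzero left ideal inside \<open>V\<close>: a generating character, as in the theory of Frobenius
  rings.\<close>

definition nontrivial_on_minimal :: "('a \<Rightarrow> complex) \<Rightarrow> 'a set \<Rightarrow> bool"
  where "nontrivial_on_minimal \<xi> V \<longleftrightarrow> additive_char (carrier R) \<xi> \<and>
    (\<forall>L. minimal_left_ideal L R \<and> L \<subseteq> V \<longrightarrow> (\<exists>x\<in>L. \<xi> x \<noteq> 1))"

lemma nontrivial_on_minimalD:
  assumes "nontrivial_on_minimal \<xi> V"
  shows "additive_char (carrier R) \<xi>" "\<And>L. minimal_left_ideal L R \<Longrightarrow> L \<subseteq> V \<Longrightarrow> \<exists>x\<in>L. \<xi> x \<noteq> 1"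
  using assms unfolding nontrivial_on_minimal_def by auto

text \<open>Each \<open>t\<close> in \<open>L\<close> gives the homomorphism
  \<open>r \<otimes> u \<mapsto> r \<otimes> t\<close>, well defined by the inclusion of
  annihilators and determined by its value \<open>t\<close> at \<open>u\<close>.\<close>

lemma card_lhom_annihilator:
  assumes L: "left_ideal L R" "finite L" and u: "u \<in> carrier R"
    and fin: "finite (principal u)" and ann: "\<And>t. t \<in> L \<Longrightarrow> annihilator u \<subseteq> annihilator t"
  shows "card L \<le> card (lhom (principal u) L)"
proof -
  let ?U = "principal u"
  note U = principal_left_ideal[OF u]
  have Lc: "\<And>t. t \<in> L \<Longrightarrow> t \<in> carrier R" using left_idealD(1)[OF L(1)] by blast
  \<comment> \<open>An arbitrary coefficient for each element of the principal ideal;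
    \<open>eq\<close> below shows that its action on \<open>L\<close> does not depend on the
    choice.\<close>
  define rep where "rep x = (SOME r. r \<in> carrier R \<and> x = r \<otimes> u)" for x
  have rep: "rep x \<in> carrier R" "x = rep x \<otimes> u" if "x \<in> ?U" for x
  proof -
    have "\<exists>r. r \<in> carrier R \<and> x = r \<otimes> u" using that by blast
    then have "rep x \<in> carrier R \<and> x = rep x \<otimes> u" unfolding rep_def by (rule someI_ex)
    then show "rep x \<in> carrier R" "x = rep x \<otimes> u" by auto
  qed
  have eq: "rep (r \<otimes> u) \<otimes> t = r \<otimes> t" if t: "t \<in> L" and r: "r \<in> carrier R" for r t
  proof -
    have m: "r \<otimes> u \<in> ?U" using r by blast
    have "(rep (r \<otimes> u) \<ominus> r) \<otimes> u = rep (r \<otimes> u) \<otimes> u \<ominus> r \<otimes> u" using rep(1)[OF m] r u by (simp add: l_diff_distr)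
    also have "\<dots> = \<zero>" using rep(2)[OF m, symmetric] r u by simp
    finally have "rep (r \<otimes> u) \<ominus> r \<in> annihilator t" using ann[OF t] rep(1)[OF m] r by (auto simp: annihilator_def)
    then have "rep (r \<otimes> u) \<otimes> t \<ominus> r \<otimes> t = \<zero>"
      using rep(1)[OF m] r Lc[OF t] by (simp add: annihilator_def l_diff_distr)
    then show ?thesis using rep(1)[OF m] r Lc[OF t] by simp
  qed
  let ?h = "\<lambda>t. \<lambda>x\<in>?U. rep x \<otimes> t"
  have hom: "?h t \<in> lhom ?U L" if t: "t \<in> L" for t
  proof (rule lhom_restrictI[OF U(1)])
    fix x assume x: "x \<in> ?U"
    show "rep x \<otimes> t \<in> L" using left_idealD(4)[OF L(1) rep(1)[OF x] t] .
    obtain a where a: "a \<in> carrier R" "x = a \<otimes> u" using x by blast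
    show "rep (r \<otimes> x) \<otimes> t = r \<otimes> (rep x \<otimes> t)" if r: "r \<in> carrier R" for r
    proof -
      have "r \<otimes> x = (r \<otimes> a) \<otimes> u" using r a u by (simp add: m_assoc)
      then have "rep (r \<otimes> x) \<otimes> t = (r \<otimes> a) \<otimes> t" using eq[OF t, of "r \<otimes> a"] r a(1) by simp
      also have "\<dots> = r \<otimes> (rep x \<otimes> t)" using eq[OF t a(1)] a r Lc[OF t] by (simp add: m_assoc)
      finally show ?thesis .
    qed
    fix y assume y: "y \<in> ?U"
    obtain b where b: "b \<in> carrier R" "y = b \<otimes> u" using y by blast
    have "x \<oplus> y = (a \<oplus> b) \<otimes> u" using a b u by (simp add: l_distr)
    then have "rep (x \<oplus> y) \<otimes> t = (a \<oplus> b) \<otimes> t" using eq[OF t, of "a \<oplus> b"] a(1) b(1) by simp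
    also have "\<dots> = rep x \<otimes> t \<oplus> rep y \<otimes> t" using eq[OF t a(1)] eq[OF t b(1)] a b Lc[OF t] by (simp add: l_distr)
    finally show "rep (x \<oplus> y) \<otimes> t = rep x \<otimes> t \<oplus> rep y \<otimes> t" .
  qed
  show ?thesis
  proof (rule card_inj_on_le)
    show "?h ` L \<subseteq> lhom ?U L" using hom by blast
    show "finite (lhom ?U L)" using fin L(2) by (rule finite_lhom)
    show "inj_on ?h L"
    proof (rule inj_onI)
      fix s t assume st: "s \<in> L" "t \<in> L" "?h s = ?h t"
      have "?h s u = ?h t u" using st(3) by (rule fun_cong)
      then have "rep (\<one> \<otimes> u) \<otimes> s = rep (\<one> \<otimes> u) \<otimes> t" using U(2) u by simp
      then show "s = t" using eq[OF st(1), of \<one>] eq[OF st(2), of \<one>] Lc st by simp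
    qed
  qed
qed

text \<open>Let \<open>v\<close> and \<open>t\<close> be the components of the generator. Evaluation
  at \<open>v\<close> is injective on \<open>Hom(V, L)\<close> because \<open>v\<close> generates
  \<open>V\<close>, and it misses \<open>t\<close>: some \<open>r\<close> kills \<open>v\<close> but
  not \<open>t\<close>.\<close>

lemma card_lhom_less_of_cyclic_sum:
  assumes V: "left_ideal V R" "finite V" and L: "left_ideal L R" "finite L" "L \<noteq> {\<zero>}" and disj: "V \<inter> L = {\<zero>}"
    and w: "w \<in> V <+> L" "V <+> L = principal w"
  shows "card (lhom V L) < card L"
proof -
  have Vc: "\<And>x. x \<in> V \<Longrightarrow> x \<in> carrier R" and Lc: "\<And>x. x \<in> L \<Longrightarrow> x \<in> carrier R"
    using left_idealD(1)[OF V(1)] left_idealD(1)[OF L(1)] by auto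
  obtain p q where "p \<in> lhom (V <+> L) V" "q \<in> lhom (V <+> L) L"
    "\<forall>x\<in>V. \<forall>y\<in>L. p (x \<oplus> y) = x" "\<forall>x\<in>V. \<forall>y\<in>L. q (x \<oplus> y) = y"
    using direct_sum_projections[OF V(1) L(1) disj] by blast
  note pq = this(1,2) this(3,4)[rule_format]
  define v t where "v = p w" and "t = q w"
  have vt: "v \<in> V" "t \<in> L" using lhomD(2)[OF pq(1) w(1)] lhomD(2)[OF pq(2) w(1)] by (simp_all add: v_def t_def)
  have gen: "\<exists>r\<in>carrier R. r \<otimes> v = x \<and> r \<otimes> t = y" if xy: "x \<in> V" "y \<in> L" for x y
  proof -
    have "x \<oplus> y \<in> V <+> L" using xy unfolding set_add_iff by blast
    then obtain r where r: "r \<in> carrier R" "x \<oplus> y = r \<otimes> w" unfolding w(2) by blast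
    have "r \<otimes> v = p (r \<otimes> w)" "r \<otimes> t = q (r \<otimes> w)"
      using lhomD(4)[OF pq(1) r(1) w(1)] lhomD(4)[OF pq(2) r(1) w(1)] by (simp_all add: v_def t_def)
    then show ?thesis using pq(3)[OF xy] pq(4)[OF xy] r by (intro bexI[of _ r]) simp_all
  qed
  have zV: "\<zero> \<in> V" and zL: "\<zero> \<in> L" using left_idealD(2)[OF V(1)] left_idealD(2)[OF L(1)] .
  have "card (lhom V L) \<le> card (L - {t})"
  proof (rule card_inj_on_le)
    show "finite (L - {t})" using L(2) by simp
    show "inj_on (\<lambda>\<phi>. \<phi> v) (lhom V L)"
    proof (rule inj_onI)
      fix \<phi> \<psi> assume a: "\<phi> \<in> lhom V L" "\<psi> \<in> lhom V L" "\<phi> v = \<psi> v"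
      show "\<phi> = \<psi>"
      proof (rule lhom_eqI[OF a(1,2)])
        fix x assume "x \<in> V"
        then obtain r where r: "r \<in> carrier R" "r \<otimes> v = x" using gen[OF _ zL] by blast
        show "\<phi> x = \<psi> x" using lhomD(4)[OF a(1) r(1) vt(1)] lhomD(4)[OF a(2) r(1) vt(1)] a(3) r(2) by simp
      qed
    qed
    show "(\<lambda>\<phi>. \<phi> v) ` lhom V L \<subseteq> L - {t}"
    proof (rule image_subsetI)
      fix \<phi> assume f: "\<phi> \<in> lhom V L"
      obtain y where y: "y \<in> L" "y \<noteq> \<zero>" using left_ideal_nonzero[OF L(1,3)] by blast
      obtain r where r: "r \<in> carrier R" "r \<otimes> v = \<zero>" "r \<otimes> t = y" using gen[OF zV y(1)] by blast
      have "\<phi> v \<noteq> t"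
      proof
        assume "\<phi> v = t"
        then have "y = \<phi> (r \<otimes> v)" using lhomD(4)[OF f r(1) vt(1)] r(3) by simp
        then show False using r(2) lhom_zero[OF V(1) L(1) f] y(2) by simp
      qed
      then show "\<phi> v \<in> L - {t}" using lhomD(2)[OF f vt(1)] by simp
    qed
  qed
  also have "\<dots> < card L" using L(2) vt(2) by (rule card_Diff1_less)
  finally show ?thesis .
qed

end

context left_artinian_ring
begin

lemma nontrivial_on_minimal_imp:
  assumes "nontrivial_on_minimal \<xi> V" "left_ideal I R" "I \<subseteq> V" "\<And>x. x \<in> I \<Longrightarrow> \<xi> x = 1"
  shows "I = {\<zero>}"
proof (rule ccontr)
  assume "I \<noteq> {\<zero>}"
  then obtain L where L: "minimal_left_ideal L R" "L \<subseteq> I" using contains_minimal_left_ideal[OF assms(2)] by blast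
  then obtain x where "x \<in> L" "\<xi> x \<noteq> 1" using nontrivial_on_minimalD(2)[OF assms(1) L(1)] assms(3) by blast
  then show False using assms(4) L(2) by blast
qed

text \<open>Composition with \<open>\<xi>\<close> maps \<open>Hom(L, V)\<close> injectively to the
  characters of \<open>L\<close> and misses the inverse of \<open>\<xi>\<close> on \<open>L\<close>.
  A violation of either claim would produce a nonzero left ideal in the kernel of
  \<open>\<xi>\<close>.\<close>

lemma card_lhom_less_of_char:
  assumes V: "left_ideal V R" "finite V" and L: "left_ideal L R" "finite L" "L \<noteq> {\<zero>}" and disj: "V \<inter> L = {\<zero>}"
    and \<xi>: "nontrivial_on_minimal \<xi> (V <+> L)"
  shows "card (lhom L V) < card L"
proof -
  note S = left_ideal_set_add[OF V(1) L(1)]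
  have Vc: "\<And>x. x \<in> V \<Longrightarrow> x \<in> carrier R" and Lc: "\<And>x. x \<in> L \<Longrightarrow> x \<in> carrier R"
    using left_idealD(1)[OF V(1)] left_idealD(1)[OF L(1)] by auto
  note ch = additive_charD[OF nontrivial_on_minimalD(1)[OF \<xi>]]
  have sg: "subgroup L (add_monoid R)" by (rule left_ideal_subgroup[OF L(1)])
  let ?inv = "\<lambda>x\<in>L. inverse (\<xi> x)"
  have cL: "card (add.chars L) = card L" by (rule add.card_chars[OF sg L(2)])
  have "card L > 0" using L(2) left_idealD(2)[OF L(1)] by (auto simp: card_gt_0_iff)
  then have finC: "finite (add.chars L)" using cL by (simp add: card_ge_0_finite)
  have charI: "restrict f L \<in> add.chars L"
    if "\<And>x. x \<in> L \<Longrightarrow> cmod (f x) = 1" "\<And>x y. x \<in> L \<Longrightarrow> y \<in> L \<Longrightarrow> f (x \<oplus> y) = f x * f y" for f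
    unfolding add.chars_def using that left_idealD(3)[OF L(1)] by (simp add: additive_char_iff)
  have iC: "?inv \<in> add.chars L"
    by (rule charI) (use ch Lc in \<open>simp_all add: norm_inverse\<close>)
  have "card (lhom L V) \<le> card (add.chars L - {?inv})"
  proof (rule card_inj_on_le)
    show "finite (add.chars L - {?inv})" using finC by simp
    show "inj_on (\<lambda>\<phi>. \<lambda>x\<in>L. \<xi> (\<phi> x)) (lhom L V)"
    proof (rule inj_onI)
      fix \<phi> \<psi> assume a: "\<phi> \<in> lhom L V" "\<psi> \<in> lhom L V" "(\<lambda>x\<in>L. \<xi> (\<phi> x)) = (\<lambda>x\<in>L. \<xi> (\<psi> x))"
      note A = lhomD[OF a(1)] and B = lhomD[OF a(2)]
      \<comment> \<open>Equal composites with \<open>\<xi>\<close> put the image of the difference,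
        a left ideal, into the kernel of \<open>\<xi>\<close>.\<close>
      have d: "(\<lambda>x\<in>L. \<phi> x \<ominus> \<psi> x) \<in> lhom L V"
      proof (rule lhom_restrictI[OF L(1)])
        fix x assume x: "x \<in> L"
        note c = Vc[OF A(2)[OF x]] Vc[OF B(2)[OF x]]
        show "\<phi> x \<ominus> \<psi> x \<in> V" using left_ideal_diff[OF V(1) A(2)[OF x] B(2)[OF x]] .
        show "\<phi> (r \<otimes> x) \<ominus> \<psi> (r \<otimes> x) = r \<otimes> (\<phi> x \<ominus> \<psi> x)" if r: "r \<in> carrier R" for r
          using A(4)[OF r x] B(4)[OF r x] r c by (simp add: r_diff_distr)
        fix y assume y: "y \<in> L"
        note c' = Vc[OF A(2)[OF y]] Vc[OF B(2)[OF y]]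
        show "\<phi> (x \<oplus> y) \<ominus> \<psi> (x \<oplus> y) = (\<phi> x \<ominus> \<psi> x) \<oplus> (\<phi> y \<ominus> \<psi> y)"
          using A(3)[OF x y] B(3)[OF x y] c c' by (simp add: minus_eq minus_add a_ac)
      qed
      have "(\<lambda>x\<in>L. \<phi> x \<ominus> \<psi> x) ` L = {\<zero>}"
      proof (rule nontrivial_on_minimal_imp[OF \<xi> left_ideal_image_lhom[OF L(1) V(1) d]])
        show "(\<lambda>x\<in>L. \<phi> x \<ominus> \<psi> x) ` L \<subseteq> V <+> L" using lhomD(2)[OF d] S(2) by blast
        fix z assume "z \<in> (\<lambda>x\<in>L. \<phi> x \<ominus> \<psi> x) ` L"
        then obtain x where x: "x \<in> L" "z = \<phi> x \<ominus> \<psi> x" by auto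
        note c = Vc[OF A(2)[OF x(1)]] Vc[OF B(2)[OF x(1)]]
        have "\<xi> (\<phi> x) = \<xi> (\<psi> x)" using fun_cong[OF a(3), of x] x(1) by simp
        then show "\<xi> z = 1" using x(2) ch(5)[OF c] ch(2)[OF c(2)] by simp
      qed
      then have z: "\<phi> x \<ominus> \<psi> x = \<zero>" if "x \<in> L" for x using that by force
      show "\<phi> = \<psi>" by (rule lhom_eqI[OF a(1,2)]) (use z Vc A(2) B(2) in simp)
    qed
    show "(\<lambda>\<phi>. \<lambda>x\<in>L. \<xi> (\<phi> x)) ` lhom L V \<subseteq> add.chars L - {?inv}"
    proof (rule image_subsetI)
      fix \<phi> assume f: "\<phi> \<in> lhom L V"
      note A = lhomD[OF f]
      have "(\<lambda>x\<in>L. \<xi> (\<phi> x)) \<in> add.chars L"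
      proof (rule charI)
        fix x assume x: "x \<in> L"
        show "cmod (\<xi> (\<phi> x)) = 1" using ch(1)[OF Vc[OF A(2)[OF x]]] .
        fix y assume y: "y \<in> L"
        show "\<xi> (\<phi> (x \<oplus> y)) = \<xi> (\<phi> x) * \<xi> (\<phi> y)"
          using A(3)[OF x y] ch(3)[OF Vc[OF A(2)[OF x]] Vc[OF A(2)[OF y]]] by simp
      qed
      moreover have "(\<lambda>x\<in>L. \<xi> (\<phi> x)) \<noteq> ?inv"
      proof
        assume e: "(\<lambda>x\<in>L. \<xi> (\<phi> x)) = ?inv"
        \<comment> \<open>If the inverse were hit, \<open>\<xi>\<close> would be trivial on the
          graph of \<open>\<phi>\<close>, forcing that graph to be zero and every \<open>x\<close>
          in \<open>L\<close> to lie in \<open>V\<close>.\<close>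
        have d: "(\<lambda>x\<in>L. \<phi> x \<oplus> x) \<in> lhom L (V <+> L)"
        proof (rule lhom_restrictI[OF L(1)])
          fix x assume x: "x \<in> L"
          note c = Vc[OF A(2)[OF x]] Lc[OF x]
          show "\<phi> x \<oplus> x \<in> V <+> L" unfolding set_add_iff using A(2)[OF x] x by blast
          show "\<phi> (r \<otimes> x) \<oplus> r \<otimes> x = r \<otimes> (\<phi> x \<oplus> x)" if r: "r \<in> carrier R" for r
            using A(4)[OF r x] r c by (simp add: r_distr)
          fix y assume y: "y \<in> L"
          note c' = Vc[OF A(2)[OF y]] Lc[OF y]
          show "\<phi> (x \<oplus> y) \<oplus> (x \<oplus> y) = (\<phi> x \<oplus> x) \<oplus> (\<phi> y \<oplus> y)"
            using A(3)[OF x y] c c' by (simp add: a_ac)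
        qed
        have im: "(\<lambda>x\<in>L. \<phi> x \<oplus> x) ` L = {\<zero>}"
        proof (rule nontrivial_on_minimal_imp[OF \<xi> left_ideal_image_lhom[OF L(1) S(1) d]])
          show "(\<lambda>x\<in>L. \<phi> x \<oplus> x) ` L \<subseteq> V <+> L" using lhomD(2)[OF d] by blast
          fix z assume "z \<in> (\<lambda>x\<in>L. \<phi> x \<oplus> x) ` L"
          then obtain x where x: "x \<in> L" "z = \<phi> x \<oplus> x" by auto
          have "\<xi> (\<phi> x) = inverse (\<xi> x)" using fun_cong[OF e, of x] x(1) by simp
          then show "\<xi> z = 1" using x(2) ch(3)[OF Vc[OF A(2)[OF x(1)]] Lc[OF x(1)]] ch(2)[OF Lc[OF x(1)]] by simp
        qed
        obtain x where x: "x \<in> L" "x \<noteq> \<zero>" using left_ideal_nonzero[OF L(1,3)] by blast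
        have "(\<lambda>x\<in>L. \<phi> x \<oplus> x) x \<in> {\<zero>}" unfolding im[symmetric] using x(1) by (rule imageI)
        then have "\<phi> x \<oplus> x = \<zero>" using x(1) by simp
        then have "x = \<ominus> \<phi> x" using Vc[OF A(2)[OF x(1)]] Lc[OF x(1)] by (metis add.inv_equality add.inv_inv)
        then have "x \<in> V \<inter> L" using left_idealD(5)[OF V(1) A(2)[OF x(1)]] x(1) by simp
        then show False unfolding disj using x(2) by simp
      qed
      ultimately show "(\<lambda>x\<in>L. \<xi> (\<phi> x)) \<in> add.chars L - {?inv}" by simp
    qed
  qed
  also have "\<dots> < card (add.chars L)" using finC iC by (rule card_Diff1_less)
  finally show ?thesis unfolding cL .
qed

text \<open>Every character of \<open>L\<close> fails to extend \<open>\<xi>\<close> well, and each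
  failure is caused by a minimal ideal that is the graph of a homomorphism
  \<open>L \<rightarrow> V\<close>. That homomorphism recovers the character, so there are at least
  \<open>|L|\<close> of them.\<close>

lemma card_le_lhom_of_no_char:
  assumes V: "left_ideal V R" "finite V" and L: "minimal_left_ideal L R" "finite L" and disj: "V \<inter> L = {\<zero>}"
    and \<xi>: "nontrivial_on_minimal \<xi> V" and max: "\<And>\<theta>. \<not> nontrivial_on_minimal \<theta> (V <+> L)"
  shows "card L \<le> card (lhom L V)"
proof -
  note l = min_idealD[OF L(1)]
  note S = left_ideal_set_add[OF V(1) l(1)]
  let ?S = "V <+> L"
  have Vc: "\<And>x. x \<in> V \<Longrightarrow> x \<in> carrier R" and Lc: "\<And>x. x \<in> L \<Longrightarrow> x \<in> carrier R"
    using left_idealD(1)[OF V(1)] left_idealD(1)[OF l(1)] by auto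
  note ch = additive_charD[OF nontrivial_on_minimalD(1)[OF \<xi>]]
  obtain p q where "p \<in> lhom ?S V" "q \<in> lhom ?S L"
    "\<forall>x\<in>?S. p x \<oplus> q x = x" "\<forall>x\<in>V. p x = x \<and> q x = \<zero>"
    using direct_sum_projections[OF V(1) l(1) disj] by blast
  note pq = this(1,2) this(3)[rule_format] and pV = this(4)[rule_format]
  note P = lhomD[OF pq(1)] and Q = lhomD[OF pq(2)]
  have "add.chars L \<subseteq> (\<lambda>\<phi>. \<lambda>x\<in>L. inverse (\<xi> (\<phi> x))) ` lhom L V"
  proof
    fix \<psi> assume p: "\<psi> \<in> add.chars L"
    then have \<psi>: "\<psi> \<in> extensional L" "additive_char L \<psi>" by (simp_all add: add.chars_def)
    \<comment> \<open>The candidate glued from \<open>\<xi>\<close> on \<open>V\<close> and an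
      arbitrary \<open>\<psi>\<close> on \<open>L\<close>; after extension to \<open>R\<close>,
      \<open>max\<close> yields a minimal \<open>M\<close> on which it is trivial.\<close>
    have "additive_char ?S (\<lambda>x. \<xi> (p x) * \<psi> (q x))"
      unfolding additive_char_iff
    proof (intro conjI ballI)
      fix x assume x: "x \<in> ?S"
      show "cmod (\<xi> (p x) * \<psi> (q x)) = 1"
        using ch(1)[OF Vc[OF P(2)[OF x]]] \<psi>(2) Q(2)[OF x] by (simp add: norm_mult additive_char_iff)
      fix y assume y: "y \<in> ?S"
      show "\<xi> (p (x \<oplus> y)) * \<psi> (q (x \<oplus> y)) = \<xi> (p x) * \<psi> (q x) * (\<xi> (p y) * \<psi> (q y))"
        using P(3)[OF x y] Q(3)[OF x y] ch(3)[OF Vc[OF P(2)[OF x]] Vc[OF P(2)[OF y]]] \<psi>(2) Q(2)[OF x] Q(2)[OF y]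
        by (simp add: additive_char_iff)
    qed
    then obtain \<theta> where \<theta>: "additive_char (carrier R) \<theta>" "\<forall>x\<in>?S. \<theta> x = \<xi> (p x) * \<psi> (q x)"
      using add.char_on_extend[OF left_ideal_subgroup[OF S(1)]] by blast
    obtain M where M: "minimal_left_ideal M R" "M \<subseteq> ?S" "\<forall>x\<in>M. \<theta> x = 1"
      using max[of \<theta>] \<theta>(1) unfolding nontrivial_on_minimal_def by blast
    note m = min_idealD[OF M(1)]
    have \<psi>0: "\<psi> \<zero> = 1" using add.char_on_one[OF left_ideal_subgroup[OF l(1)] \<psi>(2)] .
    have "\<not> M \<subseteq> V"
    proof
      assume MV: "M \<subseteq> V"
      obtain x where x: "x \<in> M" "\<xi> x \<noteq> 1" using nontrivial_on_minimalD(2)[OF \<xi> M(1) MV] by blast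
      have "\<theta> x = \<xi> x" using \<theta>(2) M(2) x(1) pV MV \<psi>0 by (simp add: subset_iff)
      then show False using x M(3) by simp
    qed
    then obtain x0 where x0: "x0 \<in> M" "x0 \<notin> V" by blast
    \<comment> \<open>As \<open>M\<close> is not inside \<open>V\<close>, its projection to
      \<open>L\<close> is nonzero, hence an isomorphism by \<open>schur\<close>; following its
      inverse by \<open>p\<close> exhibits \<open>M\<close> as a graph over
      \<open>L\<close>.\<close>
    have qM: "restrict q M \<in> lhom M L" by (rule restrict_in_lhom[OF m(1) M(2) pq(2)])
    have "q x0 \<noteq> \<zero>"
    proof
      assume q0: "q x0 = \<zero>"
      have x0S: "x0 \<in> ?S" using x0 M(2) by blast
      have "x0 = p x0" using pq(3)[OF x0S] Vc[OF P(2)[OF x0S]] unfolding q0 by simp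
      then show False using P(2)[OF x0S] x0(2) by simp
    qed
    then obtain \<sigma> where "\<sigma> \<in> lhom L M" "\<forall>y\<in>L. restrict q M (\<sigma> y) = y"
      using schur[OF M(1) L(1) qM x0(1)] x0(1) by auto
    note \<sigma> = lhomD[OF this(1)] this
    have \<phi>: "compose L (restrict p M) \<sigma> \<in> lhom L V"
      by (rule compose_in_lhom[OF l(1) \<sigma>(5) restrict_in_lhom[OF m(1) M(2) pq(1)]])
    have "(\<lambda>y\<in>L. inverse (\<xi> (compose L (restrict p M) \<sigma> y))) = \<psi>"
    proof (rule extensionalityI[OF restrict_extensional \<psi>(1)])
      fix y assume y: "y \<in> L"
      have sy: "\<sigma> y \<in> M" "\<sigma> y \<in> ?S" using \<sigma>(2)[OF y] M(2) by auto
      have qs: "q (\<sigma> y) = y" using \<sigma>(6)[rule_format, OF y] sy(1) by simp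
      have "\<theta> (\<sigma> y) = 1" using M(3) sy(1) by blast
      then have "\<xi> (p (\<sigma> y)) * \<psi> y = 1" using \<theta>(2) sy(2) qs by simp
      then have "inverse (\<xi> (p (\<sigma> y))) = \<psi> y" by (rule inverse_unique)
      then show "(\<lambda>y\<in>L. inverse (\<xi> (compose L (restrict p M) \<sigma> y))) y = \<psi> y" using y sy(1) by (simp add: compose_def)
    qed
    then show "\<psi> \<in> (\<lambda>\<phi>. \<lambda>x\<in>L. inverse (\<xi> (\<phi> x))) ` lhom L V"
      using \<phi> by (intro image_eqI[of _ _ "compose L (restrict p M) \<sigma>"]) simp_all
  qed
  then have "card (add.chars L) \<le> card (lhom L V)"
    using finite_lhom[OF L(2) V(2)] by (rule surj_card_le[rotated])
  then show ?thesis using add.card_chars[OF left_ideal_subgroup[OF l(1)] L(2)] by simp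
qed

end

section \<open>Cyclic socles and simultaneous characters\<close>

context left_artinian_ring
begin

definition simultaneous_char :: "'a set set \<Rightarrow> bool"
  where "simultaneous_char \<L> \<longleftrightarrow> (\<exists>\<xi>. additive_char (carrier R) \<xi> \<and> (\<forall>L\<in>\<L>. \<exists>x\<in>L. \<xi> x \<noteq> 1))"

lemma socle_annihilated: "r \<in> Rad \<Longrightarrow> v \<in> V \<Longrightarrow> V \<subseteq> finitary_left_socle R \<Longrightarrow> r \<otimes> v = \<zero>"
  using radical_annihilates_socle by blast

text \<open>The conditions imposed by \<open>\<L>\<close> are met by a single character that is good
  on a finite left ideal \<open>W\<close> containing all members; such a character is built up one
  minimal summand at a time.\<close>

lemma embeds_imp_simultaneous_char:
  assumes emb: "embeds_mod_rad (finitary_left_socle R)"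
    and \<L>: "finite \<L>" "\<And>L. L \<in> \<L> \<Longrightarrow> minimal_left_ideal L R \<and> finite L"
  shows "simultaneous_char \<L>"
proof -
  note S = left_ideal_finitary_left_socle
  obtain W where W: "left_ideal W R" "finite W" "\<forall>L\<in>\<L>. L \<subseteq> W"
    and least: "\<forall>V. left_ideal V R \<longrightarrow> (\<forall>L\<in>\<L>. L \<subseteq> V) \<longrightarrow> W \<subseteq> V"
    using finite_left_ideal_containing[OF \<L>] by blast
  have WS: "W \<subseteq> finitary_left_socle R" using least S minimal_subset_socle \<L>(2) by blast
  define \<F> where "\<F> = {V. left_ideal V R \<and> V \<subseteq> W \<and> (\<exists>\<xi>. nontrivial_on_minimal \<xi> V)}"
  have "nontrivial_on_minimal (\<lambda>_. 1) {\<zero>}"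
    unfolding nontrivial_on_minimal_def
  proof (intro conjI allI impI)
    show "additive_char (carrier R) (\<lambda>_. 1)" by (simp add: additive_char_iff)
    fix L assume L: "minimal_left_ideal L R \<and> L \<subseteq> {\<zero>}"
    then have "L = {\<zero>}" using left_idealD(2)[OF min_idealD(1)] by blast
    then show "\<exists>x\<in>L. (1::complex) \<noteq> 1" using L min_idealD(2) by blast
  qed
  then have "{\<zero>} \<in> \<F>" using left_ideal_zero left_idealD(2)[OF W(1)] by (auto simp: \<F>_def)
  moreover have "finite \<F>" by (rule finite_subset[of _ "Pow W"]) (use W(2) in \<open>auto simp: \<F>_def\<close>)
  ultimately obtain V where V: "V \<in> \<F>" and max: "\<And>V'. V' \<in> \<F> \<Longrightarrow> V \<subseteq> V' \<Longrightarrow> V = V'"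
    using finite_has_maximal[of \<F>] by blast
  obtain \<xi> where Vs: "left_ideal V R" "V \<subseteq> W" and \<xi>: "nontrivial_on_minimal \<xi> V" using V by (auto simp: \<F>_def)
  \<comment> \<open>At a maximal \<open>V\<close> that is too small, the lack of a good character on
    \<open>V <+> L\<close> and the cyclicity of \<open>V <+> L\<close> put \<open>|L|\<close> on
    opposite sides of the two equal Hom counts.\<close>
  have "V = W"
  proof (rule ccontr)
    assume "V \<noteq> W"
    then have "V \<subset> W" using Vs(2) by blast
    then obtain L where L: "minimal_left_ideal L R" "L \<subseteq> W" "V \<inter> L = {\<zero>}"
      using exists_minimal_disjoint[OF W(1) _ Vs(1)] socle_annihilated[OF _ _ WS] by blast
    note l = min_idealD[OF L(1)]
    have fin: "finite V" "finite L" using Vs(2) L(2) W(2) finite_subset by auto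
    have SW: "V <+> L \<subseteq> W" by (rule set_add_subset[OF W(1) Vs(2) L(2)])
    note VL = left_ideal_set_add[OF Vs(1) l(1)]
    have "\<not> nontrivial_on_minimal \<theta> (V <+> L)" for \<theta>
    proof
      assume "nontrivial_on_minimal \<theta> (V <+> L)"
      then have "V <+> L \<in> \<F>" using VL(1) SW by (auto simp: \<F>_def)
      then have "V = V <+> L" using VL(2) by (rule max)
      then have "L \<subseteq> V" using VL(3) by simp
      then show False using L(3) l(2) by blast
    qed
    then have 1: "card L \<le> card (lhom L V)" by (rule card_le_lhom_of_no_char[OF Vs(1) fin(1) L(1) fin(2) L(3) \<xi>])
    have "V <+> L \<subseteq> finitary_left_socle R" using SW WS by (rule order_trans)
    then obtain w where w: "w \<in> V <+> L" "V <+> L = principal w"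
      using embeds_imp_cyclic[OF S emb VL(1)] by blast
    have 2: "card (lhom V L) < card L" by (rule card_lhom_less_of_cyclic_sum[OF Vs(1) fin(1) l(1) fin(2) l(2) L(3) w])
    have "V \<subseteq> finitary_left_socle R" using Vs(2) WS by (rule order_trans)
    then have "card (lhom V L) = card (lhom L V)"
      using card_lhom_swap[OF Vs(1) fin(1) _ L(1) fin(2)] socle_annihilated by blast
    then show False using 1 2 by simp
  qed
  then have "\<exists>x\<in>L. \<xi> x \<noteq> 1" if "L \<in> \<L>" for L
    using nontrivial_on_minimalD(2)[OF \<xi>] \<L>(2)[OF that] W(3) that by blast
  then show ?thesis unfolding simultaneous_char_def using nontrivial_on_minimalD(1)[OF \<xi>] by blast
qed

text \<open>An element \<open>u\<close> of the socle with minimal annihilator generates it: a finite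
  minimal \<open>L\<close> outside \<open>principal u\<close> would violate the inequality forced by
  a good character on the sum.\<close>

lemma simultaneous_char_imp_embeds:
  assumes char: "\<And>\<L>. finite \<L> \<Longrightarrow> (\<And>L. L \<in> \<L> \<Longrightarrow> minimal_left_ideal L R \<and> finite L) \<Longrightarrow> simultaneous_char \<L>"
  shows "embeds_mod_rad (finitary_left_socle R)"
proof -
  let ?S = "finitary_left_socle R"
  note S = left_ideal_finitary_left_socle
  have Sc: "\<And>x. x \<in> ?S \<Longrightarrow> x \<in> carrier R" using left_idealD(1)[OF S] by blast
  have "\<exists>I\<in>annihilator ` ?S. \<forall>J\<in>annihilator ` ?S. J \<subseteq> I \<longrightarrow> J = I"
  proof (rule exists_minimal_in_family)
    show "annihilator \<zero> \<in> annihilator ` ?S" using left_idealD(2)[OF S] by (rule imageI)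
    show "left_ideal I R" if "I \<in> annihilator ` ?S" for I using that left_ideal_annihilator Sc by blast
  qed
  then obtain u where u: "u \<in> ?S" and "\<forall>J\<in>annihilator ` ?S. J \<subseteq> annihilator u \<longrightarrow> J = annihilator u" by blast
  then have min: "annihilator v = annihilator u" if "v \<in> ?S" "annihilator v \<subseteq> annihilator u" for v using that by blast
  have uc: "u \<in> carrier R" using Sc u .
  let ?U = "principal u"
  note U = principal_left_ideal[OF uc]
  have US: "?U \<subseteq> ?S" by (rule principal_subset[OF S u])
  obtain W where W: "left_ideal W R" "finite W" "u \<in> W" using finite_left_ideal_in_socle[OF u] by blast
  have finU: "finite ?U" using principal_subset[OF W(1,3)] W(2) by (rule finite_subset)
  have "?S \<subseteq> ?U"
  proof (rule socle_subset[OF U(1)], rule ccontr)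
    fix L assume L: "minimal_left_ideal L R" "finite L" and "\<not> L \<subseteq> ?U"
    then have disj: "?U \<inter> L = {\<zero>}" by (intro minimal_left_ideal_Int[OF L(1) U(1)])
    note l = min_idealD[OF L(1)]
    have LS: "L \<subseteq> ?S" by (rule minimal_subset_socle[OF L])
    note UL = left_ideal_set_add[OF U(1) l(1)]
    \<comment> \<open>The sum is direct, so \<open>annihilator (u \<oplus> t)\<close> is the
      intersection of the two annihilators; minimality at \<open>u\<close> forces it to equal
      \<open>annihilator u\<close>.\<close>
    have ann: "annihilator u \<subseteq> annihilator t" if t: "t \<in> L" for t
    proof -
      have tc: "t \<in> carrier R" using Sc LS t by blast
      have sub: "r \<otimes> u = \<zero> \<and> r \<otimes> t = \<zero>" if r: "r \<in> annihilator (u \<oplus> t)" for r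
      proof -
        have rc: "r \<in> carrier R" and e: "r \<otimes> u \<oplus> r \<otimes> t = \<zero>" using r uc tc by (auto simp: annihilator_def r_distr)
        have rt: "r \<otimes> t \<in> L" "r \<otimes> u \<in> ?U" using left_idealD(4)[OF l(1) rc t] rc by auto
        have "r \<otimes> u = \<ominus> (r \<otimes> t)" using e rc uc tc by (simp add: add.inv_equality[symmetric])
        then have "r \<otimes> u \<in> ?U \<inter> L" using rt left_idealD(5)[OF l(1) rt(1)] by simp
        then have "r \<otimes> u = \<zero>" unfolding disj by simp
        then show ?thesis using e rc tc by simp
      qed
      have "annihilator (u \<oplus> t) \<subseteq> annihilator u" using sub by (auto simp: annihilator_def)
      then have "annihilator (u \<oplus> t) = annihilator u" using min left_idealD(3)[OF S u] LS t by blast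
      then show ?thesis using sub by (auto simp: annihilator_def)
    qed
    have 1: "card L \<le> card (lhom ?U L)" by (rule card_lhom_annihilator[OF l(1) L(2) uc finU ann])
    have finUL: "finite (?U <+> L)" using finU L(2) by (rule finite_set_add)
    \<comment> \<open>All minimal ideals inside the finite sum: finitely many finite ideals, so the
      hypothesis provides one character good on the whole sum.\<close>
    define \<L> where "\<L> = {M. minimal_left_ideal M R \<and> M \<subseteq> ?U <+> L}"
    have "finite \<L>" by (rule finite_subset[of _ "Pow (?U <+> L)"]) (use finUL in \<open>auto simp: \<L>_def\<close>)
    moreover have "minimal_left_ideal M R \<and> finite M" if "M \<in> \<L>" for M
      using that finite_subset[OF _ finUL] by (auto simp: \<L>_def)
    ultimately have "simultaneous_char \<L>" by (rule char)
    then obtain \<xi> where "nontrivial_on_minimal \<xi> (?U <+> L)"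
      unfolding simultaneous_char_def nontrivial_on_minimal_def \<L>_def by blast
    then have 2: "card (lhom L ?U) < card L" by (rule card_lhom_less_of_char[OF U(1) finU l(1) L(2) l(2) disj])
    have "card (lhom ?U L) = card (lhom L ?U)"
      using card_lhom_swap[OF U(1) finU _ L] socle_annihilated[OF _ _ US] by blast
    then show False using 1 2 by simp
  qed
  then have "?S = ?U" using US by blast
  then show ?thesis using radical_annihilates_socle[OF _ u] by (intro cyclic_imp_embeds[OF S u]) 
qed

text \<open>Multiplication by \<open>m\<close> is an endomorphism of \<open>L\<close>, so its image
  is zero or \<open>L\<close>.\<close>

lemma multiples_of_minimal:
  assumes L: "minimal_left_ideal L R"
  shows "(\<forall>x\<in>L. add_pow R (m::nat) x = \<zero>) \<or> (\<forall>y\<in>L. \<exists>x\<in>L. add_pow R m x = y)"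
proof -
  note l = min_idealD[OF L]
  have Lc: "\<And>x. x \<in> L \<Longrightarrow> x \<in> carrier R" using left_idealD(1)[OF l(1)] by blast
  have hom: "(\<lambda>x\<in>L. add_pow R m x) \<in> lhom L L"
  proof (rule lhom_restrictI[OF l(1)])
    fix x assume x: "x \<in> L"
    show "add_pow R m x \<in> L"
      using add.subgroup_int_pow_closed[OF left_ideal_subgroup[OF l(1)] x, of "int m"]
      by (simp add: add_pow_def int_pow_int)
    show "add_pow R m (r \<otimes> x) = r \<otimes> add_pow R m x" if "r \<in> carrier R" for r
      using add_pow_rdistr[OF that Lc[OF x]] by simp
    show "add_pow R m (x \<oplus> y) = add_pow R m x \<oplus> add_pow R m y" if "y \<in> L" for y
      using add.nat_pow_distrib[OF Lc[OF x] Lc[OF that]] .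
  qed
  have "(\<lambda>x\<in>L. add_pow R m x) ` L = {\<zero>} \<or> (\<lambda>x\<in>L. add_pow R m x) ` L = L"
    by (rule l(3)[OF left_ideal_image_lhom[OF l(1) l(1) hom]]) (use lhomD(2)[OF hom] in blast)
  then show ?thesis
  proof
    assume "(\<lambda>x\<in>L. add_pow R m x) ` L = {\<zero>}"
    then show ?thesis by force
  next
    assume "(\<lambda>x\<in>L. add_pow R m x) ` L = L"
    then have "\<exists>x\<in>L. add_pow R m x = y" if "y \<in> L" for y using that by (metis (no_types, lifting) imageE restrict_apply')
    then show ?thesis by blast
  qed
qed

end

section \<open>Infinite minimal left ideals\<close>

context left_artinian_ring
begin

definition torsion_ideal :: "'a set \<Rightarrow> bool"
  where "torsion_ideal L \<longleftrightarrow> (\<forall>x\<in>L. \<exists>m>0. add_pow R (m::nat) x = \<zero>)"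

definition divisible_ideal :: "'a set \<Rightarrow> bool"
  where "divisible_ideal L \<longleftrightarrow> (\<forall>m>0. \<forall>y\<in>L. \<exists>x\<in>L. add_pow R (m::nat) x = y)"

text \<open>If \<open>L\<close> is not divisible, some positive \<open>m\<close> fails to map
  \<open>L\<close> onto itself and therefore annihilates \<open>L\<close>.\<close>

lemma minimal_torsion_or_divisible: "minimal_left_ideal L R \<Longrightarrow> torsion_ideal L \<or> divisible_ideal L"
  using multiples_of_minimal[of L] unfolding torsion_ideal_def divisible_ideal_def by blast

lemma finite_torsion_ideal:
  assumes "minimal_left_ideal L R" "finite L" shows "torsion_ideal L"
  unfolding torsion_ideal_def
  using add.finite_order_in_finite_subgroup[OF left_ideal_subgroup[OF min_idealD(1)[OF assms(1)]] assms(2)]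
  by blast

lemma additive_char_mult_power:
  assumes "additive_char (carrier R) \<xi>" "additive_char (carrier R) \<eta>"
  shows "additive_char (carrier R) (\<lambda>x. \<xi> x * \<eta> x ^ k)"
  using assms by (simp add: additive_char_iff norm_mult norm_power power_mult_distrib)

text \<open>Torsion witnesses generate a finite subgroup \<open>H\<close>, which cannot contain the
  infinite \<open>L\<close>. Multiplying by a character trivial on \<open>H\<close> keeps all
  witnesses and can make the product nontrivial on \<open>L\<close>.\<close>

lemma simultaneous_char_insert_infinite:
  assumes \<L>: "finite \<L>" "\<And>K. K \<in> \<L> \<Longrightarrow> minimal_left_ideal K R \<and> torsion_ideal K" "simultaneous_char \<L>"
    and L: "minimal_left_ideal L R" "infinite L"
  shows "simultaneous_char (insert L \<L>)"
proof -
  obtain \<xi> where \<xi>: "additive_char (carrier R) \<xi>" "\<forall>K\<in>\<L>. \<exists>x\<in>K. \<xi> x \<noteq> 1"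
    using \<L>(3) unfolding simultaneous_char_def by blast
  obtain w where w: "\<And>K. K \<in> \<L> \<Longrightarrow> w K \<in> K" "\<And>K. K \<in> \<L> \<Longrightarrow> \<xi> (w K) \<noteq> 1" using \<xi>(2) by metis
  have mc: "\<And>K x. minimal_left_ideal K R \<Longrightarrow> x \<in> K \<Longrightarrow> x \<in> carrier R"
    using left_idealD(1)[OF min_idealD(1)] by blast
  have "\<exists>H. subgroup H (add_monoid R) \<and> finite H \<and> w ` \<L> \<subseteq> H"
  proof (rule add.finite_subgroup_containing_torsion)
    show "finite (w ` \<L>)" using \<L>(1) by simp
    fix y assume "y \<in> w ` \<L>"
    then obtain K where K: "K \<in> \<L>" "y \<in> K" using w(1) by blast
    show "y \<in> carrier R" using mc K \<L>(2) by blast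
    show "\<exists>m>0. add_pow R (m::nat) y = \<zero>" using K \<L>(2) unfolding torsion_ideal_def by blast
  qed
  then obtain H where H: "subgroup H (add_monoid R)" "finite H" "w ` \<L> \<subseteq> H" by blast
  have "\<not> L \<subseteq> H" using H(2) L(2) finite_subset by blast
  then obtain y where y: "y \<in> L" "y \<notin> H" by blast
  obtain \<eta> where \<eta>: "additive_char (carrier R) \<eta>" "\<forall>h\<in>H. \<eta> h = 1" "\<eta> y \<noteq> 1"
    using add.char_separates[OF H(1) mc[OF L(1) y(1)] y(2)] by blast
  show ?thesis
  proof (cases "\<exists>x\<in>L. \<xi> x \<noteq> 1")
    case True
    then show ?thesis using \<xi> unfolding simultaneous_char_def by blast
  next
    case False
    have "\<xi> y * \<eta> y ^ 1 \<noteq> 1" using False y(1) \<eta>(3) by simp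
    moreover have "\<xi> (w K) * \<eta> (w K) ^ 1 \<noteq> 1" if "K \<in> \<L>" for K
    proof -
      have "w K \<in> H" using H(3) that by blast
      then show ?thesis using \<eta>(2) w(2)[OF that] by simp
    qed
    ultimately have "\<forall>K\<in>insert L \<L>. \<exists>x\<in>K. \<xi> x * \<eta> x ^ 1 \<noteq> 1" using y(1) w(1) by blast
    then show ?thesis
      unfolding simultaneous_char_def using additive_char_mult_power[OF \<xi>(1) \<eta>(1)] by blast
  qed
qed

lemma common_exponent:
  assumes "finite Y" "\<And>y. y \<in> Y \<Longrightarrow> y \<in> carrier R \<and> (\<exists>m>0. add_pow R (m::nat) y = \<zero>)"
  shows "\<exists>M>0. \<forall>y\<in>Y. add_pow R (M::nat) y = \<zero>"
  using assms
proof (induction Y rule: finite_induct)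
  case empty
  show ?case by (intro exI[of _ 1]) simp
next
  case (insert y Y)
  then obtain M :: nat where M: "M > 0" "\<forall>y\<in>Y. add_pow R M y = \<zero>" by auto
  obtain m :: nat where m: "m > 0" "add_pow R m y = \<zero>" "y \<in> carrier R" using insert(4)[of y] by auto
  have "add_pow R (M * m) z = \<zero>" if z: "z \<in> insert y Y" for z
  proof (cases "z = y")
    case True
    then show ?thesis using add.nat_pow_pow[OF m(3), of M m] m(2) by (simp add: add.nat_pow_pow[symmetric] mult.commute)
  next
    case False
    then have "add_pow R M z = \<zero>" "z \<in> carrier R" using M(2) z insert(4) by auto
    then show ?thesis using add.nat_pow_pow[of z m M] by simp
  qed
  then show ?case using M(1) m(1) by (intro exI[of _ "M * m"]) simp
qed

text \<open>The new character has the form \<open>\<xi> * \<eta> ^ (M * t)\<close> with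
  \<open>\<eta>\<close> nontrivial on \<open>L\<close>. The factor \<open>M\<close> protects the
  torsion members for every \<open>t\<close>; divisible members and \<open>L\<close> each rule out
  at most one \<open>t\<close>.\<close>

lemma simultaneous_char_insert_divisible:
  assumes \<L>: "finite \<L>" "\<And>K. K \<in> \<L> \<Longrightarrow> minimal_left_ideal K R" "simultaneous_char \<L>"
    and L: "minimal_left_ideal L R" "divisible_ideal L"
  shows "simultaneous_char (insert L \<L>)"
proof -
  obtain \<xi> where \<xi>: "additive_char (carrier R) \<xi>" "\<forall>K\<in>\<L>. \<exists>x\<in>K. \<xi> x \<noteq> 1"
    using \<L>(3) unfolding simultaneous_char_def by blast
  obtain w where w: "\<And>K. K \<in> \<L> \<Longrightarrow> w K \<in> K" "\<And>K. K \<in> \<L> \<Longrightarrow> \<xi> (w K) \<noteq> 1" using \<xi>(2) by metis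
  have mc: "\<And>K x. minimal_left_ideal K R \<Longrightarrow> x \<in> K \<Longrightarrow> x \<in> carrier R"
    using left_idealD(1)[OF min_idealD(1)] by blast
  let ?T = "{K \<in> \<L>. torsion_ideal K}"
  \<comment> \<open>With \<open>M\<close> killing the torsion witnesses, \<open>\<eta> ^ M\<close>
    is \<open>1\<close> there, so the value of \<open>\<xi>\<close> at them is unchanged.\<close>
  have "\<exists>M>0. \<forall>y\<in>w ` ?T. add_pow R (M::nat) y = \<zero>"
  proof (rule common_exponent)
    show "finite (w ` ?T)" using \<L>(1) by simp
    fix y assume "y \<in> w ` ?T"
    then obtain K where K: "K \<in> \<L>" "torsion_ideal K" "y \<in> K" using w(1) by blast
    then show "y \<in> carrier R \<and> (\<exists>m>0. add_pow R (m::nat) y = \<zero>)"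
      using mc[OF \<L>(2)[OF K(1)]] unfolding torsion_ideal_def by blast
  qed
  then obtain M :: nat where M: "M > 0" "\<And>K. K \<in> \<L> \<Longrightarrow> torsion_ideal K \<Longrightarrow> add_pow R M (w K) = \<zero>" by blast
  obtain y where y: "y \<in> L" "y \<noteq> \<zero>"
    using left_ideal_nonzero[OF min_idealD(1,2)[OF L(1)]] by blast
  obtain \<eta> where \<eta>: "additive_char (carrier R) \<eta>" "\<eta> y \<noteq> 1"
    using add.char_separates[OF left_ideal_subgroup[OF left_ideal_zero] mc[OF L(1) y(1)]] y(2) by blast
  note xc = additive_charD[OF \<xi>(1)] and ec = additive_charD[OF \<eta>(1)]
  define bad where "bad K = {t::nat. \<forall>x\<in>K. \<xi> x * \<eta> x ^ (M * t) = 1}" for K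
  \<comment> \<open>Two bad exponents make a positive power of \<open>\<eta>\<close> trivial on
    \<open>K\<close>. By divisibility every element of \<open>K\<close> is the corresponding
    multiple, so \<open>\<eta>\<close> itself is trivial on \<open>K\<close>, and then so is
    \<open>\<xi>\<close>.\<close>
  have collapse: "(\<forall>z\<in>K. \<eta> z = 1) \<and> (\<forall>z\<in>K. \<xi> z = 1)"
    if K: "minimal_left_ideal K R" "divisible_ideal K" and t: "t \<in> bad K" "t' \<in> bad K" "t < t'" for K t t'
  proof -
    have e1: "\<eta> z = 1" if z: "z \<in> K" for z
    proof -
      have "M * (t' - t) > 0" using M(1) t(3) by simp
      then obtain x where x: "x \<in> K" "add_pow R (M * (t' - t)) x = z"
        using K(2) z unfolding divisible_ideal_def by blast
      have c: "x \<in> carrier R" using mc[OF K(1) x(1)] .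
      have "\<xi> x * \<eta> x ^ (M * t) * \<eta> x ^ (M * (t' - t)) = \<xi> x * \<eta> x ^ (M * t')"
        using t(3) by (simp add: mult.assoc power_add[symmetric] distrib_left[symmetric])
      moreover have "\<xi> x * \<eta> x ^ (M * t) = 1" "\<xi> x * \<eta> x ^ (M * t') = 1" using t(1,2) x(1) by (simp_all add: bad_def)
      ultimately have "\<eta> x ^ (M * (t' - t)) = 1" by simp
      then show ?thesis using ec(6)[OF c, of "M * (t' - t)"] x(2) by simp
    qed
    moreover have "\<xi> z = 1" if "z \<in> K" for z using t(1) that e1[OF that] by (auto simp: bad_def)
    ultimately show ?thesis by blast
  qed
  have fin: "finite (bad K)" if K: "K \<in> insert L \<L>" for K
  proof (cases "K \<in> \<L> \<and> torsion_ideal K")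
    case True
    have c: "w K \<in> carrier R" using mc[OF \<L>(2) w(1)] True by blast
    have "\<eta> (w K) ^ M = 1"
      using ec(6)[OF c, of M] M(2)[of K] True add.char_on_one[OF add.subgroup_self \<eta>(1)] by simp
    then have "\<xi> (w K) * \<eta> (w K) ^ (M * t) \<noteq> 1" for t using w(2)[of K] True by (simp add: power_mult)
    then have "bad K = {}" using w(1)[of K] True by (auto simp: bad_def)
    then show ?thesis by simp
  next
    case False
    have Km: "minimal_left_ideal K R" using K \<L>(2) L(1) by auto
    have Kd: "divisible_ideal K" using False K L(2) minimal_torsion_or_divisible[OF Km] by auto
    \<comment> \<open>For a member of \<open>\<L>\<close> its witness shows that
      \<open>\<xi>\<close> is nontrivial; for \<open>L\<close> the element \<open>y\<close> shows
      that \<open>\<eta>\<close> is.\<close>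
    have nt: "\<not> ((\<forall>z\<in>K. \<eta> z = 1) \<and> (\<forall>z\<in>K. \<xi> z = 1))"
      using K y(1) \<eta>(2) w by blast
    have uniq: "t = t'" if "t \<in> bad K" "t' \<in> bad K" for t t'
      using collapse[OF Km Kd that] collapse[OF Km Kd that(2,1)] nt by (cases t t' rule: linorder_cases) auto
    have "bad K \<subseteq> {THE t. t \<in> bad K}"
    proof
      fix t assume "t \<in> bad K"
      then have "(THE t. t \<in> bad K) = t" using uniq by blast
      then show "t \<in> {THE t. t \<in> bad K}" by simp
    qed
    then show ?thesis by (rule finite_subset) simp
  qed
  have "finite (\<Union>K\<in>insert L \<L>. bad K)" using \<L>(1) fin by (intro finite_UN_I) auto
  then obtain t where "t \<notin> (\<Union>K\<in>insert L \<L>. bad K)" using ex_new_if_finite[OF infinite_UNIV_nat] by blast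
  then have "\<forall>K\<in>insert L \<L>. \<exists>x\<in>K. \<xi> x * \<eta> x ^ (M * t) \<noteq> 1" by (auto simp: bad_def)
  then show ?thesis
    unfolding simultaneous_char_def using additive_char_mult_power[OF \<xi>(1) \<eta>(1)] by blast
qed

text \<open>The order of insertion matters: infinite torsion ideals can be added only while all
  earlier ideals are torsion, whereas divisible ones can be added to anything and come last.\<close>

lemma simultaneous_char_of_finite:
  assumes char: "\<And>\<L>. finite \<L> \<Longrightarrow> (\<And>L. L \<in> \<L> \<Longrightarrow> minimal_left_ideal L R \<and> finite L) \<Longrightarrow> simultaneous_char \<L>"
    and \<L>: "finite \<L>" "\<And>L. L \<in> \<L> \<Longrightarrow> minimal_left_ideal L R"
  shows "simultaneous_char \<L>"
proof -
  let ?F = "{L \<in> \<L>. finite L}" and ?I = "{L \<in> \<L>. infinite L \<and> torsion_ideal L}" and ?D = "{L \<in> \<L>. \<not> torsion_ideal L}"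
  have F: "simultaneous_char ?F" by (rule char) (use \<L> in auto)
  have I: "simultaneous_char (\<J> \<union> ?F)" if "finite \<J>" "\<J> \<subseteq> ?I" for \<J>
    using that
  proof (induction \<J> rule: finite_induct)
    case empty
    then show ?case using F by simp
  next
    case (insert L \<J>)
    have "simultaneous_char (insert L (\<J> \<union> ?F))"
    proof (rule simultaneous_char_insert_infinite)
      show "finite (\<J> \<union> ?F)" using insert(1) \<L>(1) by simp
      show "minimal_left_ideal K R \<and> torsion_ideal K" if "K \<in> \<J> \<union> ?F" for K
        using that insert(4) \<L>(2) finite_torsion_ideal by auto
    qed (use insert \<L>(2) in auto)
    then show ?case by simp
  qed
  have "simultaneous_char (\<J> \<union> (?I \<union> ?F))" if "finite \<J>" "\<J> \<subseteq> ?D" for \<J>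
    using that
  proof (induction \<J> rule: finite_induct)
    case empty
    then show ?case using I[of ?I] \<L>(1) by simp
  next
    case (insert L \<J>)
    have "simultaneous_char (insert L (\<J> \<union> (?I \<union> ?F)))"
    proof (rule simultaneous_char_insert_divisible)
      show "finite (\<J> \<union> (?I \<union> ?F))" using insert(1) \<L>(1) by simp
      show "minimal_left_ideal K R" if "K \<in> \<J> \<union> (?I \<union> ?F)" for K using that insert(4) \<L>(2) by auto
      show "minimal_left_ideal L R" "divisible_ideal L"
        using insert(4) \<L>(2) minimal_torsion_or_divisible by auto
    qed (use insert in auto)
    then show ?case by simp
  qed
  from this[of ?D] have "simultaneous_char (?D \<union> (?I \<union> ?F))" using \<L>(1) by simp
  moreover have "?D \<union> (?I \<union> ?F) = \<L>" using \<L>(2) finite_torsion_ideal by blast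
  ultimately show ?thesis by simp
qed

end

section \<open>Closed submodules of the dual\<close>

context ring
begin

lemma mem_dual: "f \<in> carrier (dual_module R) \<longleftrightarrow> f \<in> extensional (carrier R) \<and> additive_char (carrier R) f"
  by (auto simp: dual_module_def hom_def circle_group_def additive_char_iff)

lemma dual_simps:
  "f \<oplus>\<^bsub>dual_module R\<^esub> g = (\<lambda>x\<in>carrier R. f x * g x)"
  "\<zero>\<^bsub>dual_module R\<^esub> = (\<lambda>x\<in>carrier R. 1)"
  "r \<odot>\<^bsub>dual_module R\<^esub> f = (\<lambda>x\<in>carrier R. f (r \<otimes> x))"
  by (simp_all add: dual_module_def)

lemma restrict_mem_dual: "additive_char (carrier R) f \<Longrightarrow> restrict f (carrier R) \<in> carrier (dual_module R)"
  by (simp add: mem_dual additive_char_iff)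

definition perp :: "'a set \<Rightarrow> ('a \<Rightarrow> complex) set"
  where "perp I = {f \<in> carrier (dual_module R). \<forall>x\<in>I. f x = 1}"

lemma closed_submodule_perp:
  assumes I: "left_ideal I R"
  shows "closed_submodule R (dual_module R) (dual_topology R) (perp I)"
proof -
  let ?X = "dual_module R"
  interpret X: compact_right_module R ?X "dual_topology R" by (rule compact_right_module_dual)
  have Ic: "\<And>x. x \<in> I \<Longrightarrow> x \<in> carrier R" using left_idealD(1)[OF I] by blast
  have sm: "r \<odot>\<^bsub>?X\<^esub> f \<in> perp I" if r: "r \<in> carrier R" and f: "f \<in> perp I" for r f
  proof -
    have "r \<odot>\<^bsub>?X\<^esub> f \<in> carrier ?X" using X.rsmult_closed[OF r] f by (simp add: perp_def)
    moreover have "(r \<odot>\<^bsub>?X\<^esub> f) x = 1" if "x \<in> I" for x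
      using that f left_idealD(4)[OF I r that] Ic[OF that] by (simp add: perp_def dual_simps)
    ultimately show ?thesis by (simp add: perp_def)
  qed
  have "subgroup (perp I) (add_monoid ?X)"
  proof (rule X.X.add.subgroupI)
    show "perp I \<subseteq> carrier ?X" by (auto simp: perp_def)
    have "\<zero>\<^bsub>?X\<^esub> \<in> perp I" using X.X.zero_closed Ic by (simp add: perp_def dual_simps)
    then show "perp I \<noteq> {}" by blast
    fix f assume f: "f \<in> perp I"
    then have fX: "f \<in> carrier ?X" by (simp add: perp_def)
    have "(\<ominus>\<^bsub>?X\<^esub> f) \<oplus>\<^bsub>?X\<^esub> f = \<zero>\<^bsub>?X\<^esub>" using fX by (rule X.X.l_neg)
    then have e0: "(\<lambda>x\<in>carrier R. (\<ominus>\<^bsub>?X\<^esub> f) x * f x) = (\<lambda>x\<in>carrier R. 1)" unfolding dual_simps .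
    have e: "(\<ominus>\<^bsub>?X\<^esub> f) x * f x = 1" if "x \<in> carrier R" for x
      using fun_cong[OF e0, of x] that by simp
    then have "(\<ominus>\<^bsub>?X\<^esub> f) x = 1" if "x \<in> I" for x using e[OF Ic[OF that]] that f by (simp add: perp_def)
    then show "\<ominus>\<^bsub>?X\<^esub> f \<in> perp I" using fX by (simp add: perp_def)
    fix g assume g: "g \<in> perp I"
    then have "f \<oplus>\<^bsub>?X\<^esub> g \<in> carrier ?X" using fX by (simp add: perp_def)
    then show "f \<oplus>\<^bsub>?X\<^esub> g \<in> perp I" using f g Ic by (simp add: perp_def dual_simps)
  qed
  moreover have "closedin (dual_topology R) (perp I)"
  proof -
    have cl: "closedin (dual_topology R) {f \<in> topspace (dual_topology R). f x \<in> {1}}" if x: "x \<in> I" for x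
    proof (rule closedin_continuous_map_preimage)
      have "continuous_map (product_topology (\<lambda>_. top_of_set (sphere (0::complex) 1)) (carrier R)) (top_of_set (sphere 0 1)) (\<lambda>f. f x)"
        using Ic[OF x] by (rule continuous_map_product_projection)
      then show "continuous_map (dual_topology R) euclidean (\<lambda>f. f x)"
        unfolding dual_topology_def
        by (intro continuous_map_from_subtopology) (rule continuous_map_into_fulltopology)
    qed simp
    have z: "\<zero> \<in> I" using left_idealD(2)[OF I] .
    have "perp I = (\<Inter>x\<in>I. {f \<in> topspace (dual_topology R). f x \<in> {1}})"
      using z unfolding X.topspace_eq perp_def by blast
    also have "closedin (dual_topology R) \<dots>" using z cl by (intro closedin_INT) auto
    finally show ?thesis .
  qed
  ultimately show ?thesis using sm by (simp add: closed_submodule_def additive_subgroup_def)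
qed

text \<open>The common kernel of \<open>N\<close> does it. Were it zero, \<open>N\<close> would
  separate points and so be dense in the dual; being closed, it would be everything.\<close>

lemma proper_closed_submodule_annihilates:
  assumes N: "closed_submodule R (dual_module R) (dual_topology R) N" and ne: "N \<noteq> carrier (dual_module R)"
  shows "\<exists>I. left_ideal I R \<and> I \<noteq> {\<zero>} \<and> (\<forall>\<nu>\<in>N. \<forall>x\<in>I. \<nu> x = 1)"
proof -
  let ?X = "dual_module R"
  interpret X: compact_right_module R ?X "dual_topology R" by (rule compact_right_module_dual)
  interpret N: additive_subgroup N ?X using N by (simp add: closed_submodule_def)
  have NX: "N \<subseteq> carrier ?X" by (rule N.a_subset)
  have Nc: "additive_char (carrier R) \<nu>" if "\<nu> \<in> N" for \<nu> using NX that mem_dual by blast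
  \<comment> \<open>Because \<open>r \<odot> \<nu>\<close> evaluated at \<open>x\<close> is
    \<open>\<nu> (r \<otimes> x)\<close>, closure of \<open>N\<close> under the right action makes
    its common kernel a left ideal.\<close>
  define I where "I = {x \<in> carrier R. \<forall>\<nu>\<in>N. \<nu> x = 1}"
  have "left_ideal I R"
  proof (rule left_idealI)
    show "\<zero> \<in> I" using add.char_on_one[OF add.subgroup_self Nc] by (simp add: I_def)
    show "x \<oplus> y \<in> I" if xy: "x \<in> I" "y \<in> I" for x y
    proof -
      have "\<nu> (x \<oplus> y) = 1" if "\<nu> \<in> N" for \<nu>
      proof -
        have "\<nu> x = 1" "\<nu> y = 1" "x \<in> carrier R" "y \<in> carrier R" using xy that unfolding I_def by blast+
        then show ?thesis using additive_charD(3)[OF Nc[OF that], of x y] by simp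
      qed
      then show ?thesis using xy by (simp add: I_def)
    qed
    fix r x assume r: "r \<in> carrier R" and x: "x \<in> I"
    have "\<nu> (r \<otimes> x) = 1" if \<nu>: "\<nu> \<in> N" for \<nu>
    proof -
      have "r \<odot>\<^bsub>?X\<^esub> \<nu> \<in> N" using N r \<nu> by (simp add: closed_submodule_def)
      then have "(r \<odot>\<^bsub>?X\<^esub> \<nu>) x = 1" using x unfolding I_def by blast
      then show ?thesis using x by (simp add: dual_simps I_def)
    qed
    then show "r \<otimes> x \<in> I" using r x by (simp add: I_def)
  qed (auto simp: I_def)
  moreover have "I \<noteq> {\<zero>}"
  proof
    assume I0: "I = {\<zero>}"
    have sep: "\<exists>\<nu>\<in>N. \<nu> a \<noteq> 1" if a: "a \<in> carrier R" "a \<noteq> \<zero>" for a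
    proof (rule ccontr)
      assume "\<not> ?thesis"
      then have "a \<in> I" using a(1) by (simp add: I_def)
      then show False using a(2) unfolding I0 by simp
    qed
    have mult: "(\<lambda>x\<in>carrier R. \<mu> x * \<nu> x) \<in> N" if "\<mu> \<in> N" "\<nu> \<in> N" for \<mu> \<nu>
      using N.a_closed[OF that] unfolding dual_simps .
    have one: "(\<lambda>x\<in>carrier R. 1) \<in> N" using N.zero_closed unfolding dual_simps .
    obtain \<xi> where \<xi>: "\<xi> \<in> carrier ?X" "\<xi> \<notin> N" using NX ne by blast
    have \<xi>c: "additive_char (carrier R) \<xi>" using \<xi>(1) mem_dual by blast
    let ?P = "product_topology (\<lambda>_. top_of_set (sphere (0::complex) 1)) (carrier R)"
    have "closedin (dual_topology R) N" using N by (simp add: closed_submodule_def)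
    then have "openin (dual_topology R) (carrier ?X - N)" unfolding closedin_def X.topspace_eq by simp
    then obtain U where U: "openin ?P U" "carrier ?X - N = U \<inter> carrier ?X"
      unfolding dual_topology_def openin_subtopology by blast
    have "\<xi> \<in> U" using U(2) \<xi> by blast
    then obtain B where B: "finite {i \<in> carrier R. B i \<noteq> topspace (top_of_set (sphere (0::complex) 1))}"
      "\<forall>i\<in>carrier R. openin (top_of_set (sphere 0 1)) (B i)" "\<xi> \<in> PiE (carrier R) B" "PiE (carrier R) B \<subseteq> U"
      using U(1) unfolding openin_product_topology_alt by blast
    \<comment> \<open>The finitely many coordinates that a basic neighbourhood of
      \<open>\<xi>\<close> outside \<open>N\<close> constrains; a member of \<open>N\<close> close
      to \<open>\<xi>\<close> on them would enter it.\<close>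
    define A where "A = {i \<in> carrier R. B i \<noteq> sphere (0::complex) 1}"
    have A: "finite A" "A \<subseteq> carrier R" using B(1) by (simp_all add: A_def)
    have "\<forall>i\<in>A. \<exists>e>0. \<forall>z. cmod z = 1 \<longrightarrow> cmod (z - \<xi> i) < e \<longrightarrow> z \<in> B i"
    proof
      fix i assume i: "i \<in> A"
      then have ic: "i \<in> carrier R" using A(2) by blast
      obtain T where T: "open T" "B i = sphere 0 1 \<inter> T" using B(2) ic unfolding openin_open by blast
      have "\<xi> i \<in> T" using B(3) ic T(2) by auto
      then obtain e where e: "e > 0" "\<forall>z. dist z (\<xi> i) < e \<longrightarrow> z \<in> T" using T(1) unfolding open_dist by blast
      have "z \<in> B i" if "cmod z = 1" "cmod (z - \<xi> i) < e" for z
        using that e(2) T(2) by (simp add: dist_norm)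
      then show "\<exists>e>0. \<forall>z. cmod z = 1 \<longrightarrow> cmod (z - \<xi> i) < e \<longrightarrow> z \<in> B i" using e(1) by blast
    qed
    then obtain e where e: "\<And>i. i \<in> A \<Longrightarrow> e i > 0" "\<And>i z. i \<in> A \<Longrightarrow> cmod z = 1 \<Longrightarrow> cmod (z - \<xi> i) < e i \<Longrightarrow> z \<in> B i"
      by metis
    \<comment> \<open>The added \<open>1\<close> keeps the minimum defined when no coordinate is
      constrained.\<close>
    define \<epsilon> where "\<epsilon> = Min (insert 1 (e ` A))"
    have \<epsilon>: "\<epsilon> > 0" "\<And>i. i \<in> A \<Longrightarrow> \<epsilon> \<le> e i" using A(1) e(1) by (auto simp: \<epsilon>_def)
    obtain \<nu> where \<nu>: "\<nu> \<in> N" "\<forall>a\<in>A. cmod (\<nu> a - \<xi> a) < \<epsilon>"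
      using add.separating_chars_dense[OF Nc mult one sep \<xi>c A \<epsilon>(1)] by blast
    have "\<nu> \<in> PiE (carrier R) B"
    proof (rule PiE_I)
      fix i assume i: "i \<in> carrier R"
      have n: "cmod (\<nu> i) = 1" using additive_charD(1)[OF Nc[OF \<nu>(1)] i] .
      show "\<nu> i \<in> B i"
      proof (cases "i \<in> A")
        case True
        then have "cmod (\<nu> i - \<xi> i) < e i" using \<nu>(2) \<epsilon>(2) by fastforce
        then show ?thesis using e(2)[OF True n] by blast
      next
        case False
        then have "B i = sphere 0 1" using i by (simp add: A_def)
        then show ?thesis using n by simp
      qed
    next
      have "\<nu> \<in> extensional (carrier R)" using NX \<nu>(1) mem_dual by blast
      then show "\<nu> i = undefined" if "i \<notin> carrier R" for i using that by (rule extensional_arb)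
    qed
    then have "\<nu> \<in> U \<inter> carrier ?X" using B(4) NX \<nu>(1) by blast
    then show False using U(2) \<nu>(1) by blast
  qed
  ultimately show ?thesis unfolding I_def by blast
qed

end

context left_artinian_ring
begin

text \<open>Without a simultaneous character the submodules \<open>perp L\<close> cover the dual, so
  one of them is the whole dual; but characters separate a nonzero element of \<open>L\<close> from
  zero.\<close>

lemma almost_monothetic_imp_simultaneous_char:
  assumes am: "almost_monothetic R (dual_module R) (dual_topology R)"
    and \<L>: "finite \<L>" "\<And>L. L \<in> \<L> \<Longrightarrow> minimal_left_ideal L R"
  shows "simultaneous_char \<L>"
proof (rule ccontr)
  assume no: "\<not> simultaneous_char \<L>"
  let ?X = "dual_module R"
  have "carrier ?X = \<Union>(perp ` \<L>)"
  proof (intro equalityI subsetI)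
    fix f assume f: "f \<in> carrier ?X"
    then obtain L where "L \<in> \<L>" "\<forall>x\<in>L. f x = 1" using no mem_dual unfolding simultaneous_char_def by blast
    then show "f \<in> \<Union>(perp ` \<L>)" using f by (auto simp: perp_def)
  qed (auto simp: perp_def)
  moreover have "\<forall>N\<in>perp ` \<L>. closed_submodule R ?X (dual_topology R) N"
    using closed_submodule_perp min_idealD(1) \<L>(2) by blast
  ultimately have "carrier ?X \<in> perp ` \<L>"
    using am \<L>(1) unfolding almost_monothetic_def by simp
  then obtain L where L: "L \<in> \<L>" "carrier ?X = perp L" by blast
  note l = min_idealD[OF \<L>(2)[OF L(1)]]
  obtain y where y: "y \<in> L" "y \<noteq> \<zero>" using left_ideal_nonzero[OF l(1,2)] by blast
  have yc: "y \<in> carrier R" using y(1) left_idealD(1)[OF l(1)] by blast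
  obtain \<eta> where \<eta>: "additive_char (carrier R) \<eta>" "\<eta> y \<noteq> 1"
    using add.char_separates[OF left_ideal_subgroup[OF left_ideal_zero] yc] y(2) by blast
  have "restrict \<eta> (carrier R) \<in> perp L" using restrict_mem_dual[OF \<eta>(1)] L(2) by simp
  then have "restrict \<eta> (carrier R) y = 1" using y(1) unfolding perp_def by blast
  then show False using \<eta>(2) yc by simp
qed

text \<open>In a cover by proper closed submodules, each member is trivial on some minimal left
  ideal; a character nontrivial on all these ideals would belong to no member.\<close>

lemma simultaneous_char_imp_almost_monothetic:
  assumes char: "\<And>\<L>. finite \<L> \<Longrightarrow> (\<And>L. L \<in> \<L> \<Longrightarrow> minimal_left_ideal L R) \<Longrightarrow> simultaneous_char \<L>"
  shows "almost_monothetic R (dual_module R) (dual_topology R)"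
  unfolding almost_monothetic_def
proof (intro allI impI, elim conjE)
  let ?X = "dual_module R"
  fix \<M> assume M: "finite \<M>" "\<forall>N\<in>\<M>. closed_submodule R ?X (dual_topology R) N" "carrier ?X = \<Union>\<M>"
  show "carrier ?X \<in> \<M>"
  proof (rule ccontr)
    assume no: "carrier ?X \<notin> \<M>"
    have "\<exists>L. minimal_left_ideal L R \<and> (\<forall>\<nu>\<in>N. \<forall>x\<in>L. \<nu> x = 1)" if N: "N \<in> \<M>" for N
    proof -
      have "N \<noteq> carrier ?X" using N no by blast
      then obtain I where I: "left_ideal I R" "I \<noteq> {\<zero>}" "\<forall>\<nu>\<in>N. \<forall>x\<in>I. \<nu> x = 1"
        using proper_closed_submodule_annihilates M(2) N by blast
      obtain L where "minimal_left_ideal L R" "L \<subseteq> I" using contains_minimal_left_ideal[OF I(1,2)] by blast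
      then show ?thesis using I(3) by blast
    qed
    then obtain L where L: "\<And>N. N \<in> \<M> \<Longrightarrow> minimal_left_ideal (L N) R"
      "\<And>N \<nu> x. N \<in> \<M> \<Longrightarrow> \<nu> \<in> N \<Longrightarrow> x \<in> L N \<Longrightarrow> \<nu> x = 1" by metis
    have "simultaneous_char (L ` \<M>)" by (rule char) (use M(1) L(1) in auto)
    then obtain \<xi> where \<xi>: "additive_char (carrier R) \<xi>" "\<forall>N\<in>\<M>. \<exists>x\<in>L N. \<xi> x \<noteq> 1"
      unfolding simultaneous_char_def by blast
    have "restrict \<xi> (carrier R) \<in> \<Union>\<M>" using restrict_mem_dual[OF \<xi>(1)] M(3) by simp
    then obtain N where N: "N \<in> \<M>" "restrict \<xi> (carrier R) \<in> N" by blast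
    obtain x where x: "x \<in> L N" "\<xi> x \<noteq> 1" using \<xi>(2) N(1) by blast
    have "x \<in> carrier R" using x(1) left_idealD(1)[OF min_idealD(1)[OF L(1)[OF N(1)]]] by blast
    then show False using L(2)[OF N x(1)] x(2) by simp
  qed
qed

lemma socle_embeds_iff_almost_monothetic:
  "embeds_mod_rad (finitary_left_socle R) \<longleftrightarrow> almost_monothetic R (dual_module R) (dual_topology R)"
proof
  assume emb: "embeds_mod_rad (finitary_left_socle R)"
  show "almost_monothetic R (dual_module R) (dual_topology R)"
  proof (rule simultaneous_char_imp_almost_monothetic)
    fix \<L> assume "finite \<L>" "\<And>L. L \<in> \<L> \<Longrightarrow> minimal_left_ideal L R"
    with embeds_imp_simultaneous_char[OF emb] show "simultaneous_char \<L>" by (rule simultaneous_char_of_finite)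
  qed
next
  assume am: "almost_monothetic R (dual_module R) (dual_topology R)"
  show "embeds_mod_rad (finitary_left_socle R)"
  proof (rule simultaneous_char_imp_embeds)
    fix \<L> assume "finite \<L>" "\<And>L. L \<in> \<L> \<Longrightarrow> minimal_left_ideal L R \<and> finite L"
    then show "simultaneous_char \<L>" using almost_monothetic_imp_simultaneous_char[OF am] by simp
  qed
qed

end

theorem theorem3p6:
  fixes R :: "('a, 'm) ring_scheme"
  assumes "ring R" and "left_artinian R"
  shows "left_module_embeds R
           (left_ideal_module R (finitary_left_socle R))
           (left_quotient_module R (jacobson_radical R))
         \<longleftrightarrow> almost_monothetic R (dual_module R) (dual_topology R)"
  using assms by (intro left_artinian_ring.socle_embeds_iff_almost_monothetic)
    (simp add: left_artinian_ring_def left_artinian_ring_axioms_def)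

end
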